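(* Let $2\le p<\infty$ and let $(k_n)_{n\in\mathbb N}$ be a sequence of integers with $1\le k_n\le n$ and $\lim_{n\to\infty}\frac{k_n}{n}=\lambda\in[0,1]$. Assume that $k_n=\omega(1)$ and that the sequence $(t_n)_{n\in\mathbb N}$ of positive real numbers satisfies $t_n=\omega(1)$, $t_n=o(\sqrt{k_n})$ and either $t_n=o(\sqrt{n-k_n})$ or $(n-k_n)=o\big(\frac{\sqrt{k_n}}{t_n}\big)$. For each $n$ let $X_n$ be uniformly distributed in $\mathbb B_p^n$, let $E_n$ be a random $k_n$-dimensional linear subspace of $\mathbb R^n$ distributed according to the Haar probability measure on the Grassmannian of $k_n$-dimensional subspaces and independent of $X_n$, and put $$\mathscr X_{n,p}:=n^{1/p}\sqrt{\frac{\Gamma(\frac1p)}{p^{2/p}\Gamma(\frac3p)}}\;\|P_{E_n}X_n\|_2-\sqrt{k_n}.$$ Then the sequence of random variables $t_n^{-1}\mathscr X_{n,p}$ satisfies an MDP on $\mathbb R$ with speed $t_n^2$ and rate function $\mathbb I(x)=\alpha_{p,\lambda}x^2$, with constant $\alpha_{p,\lambda}$ given by $$\alpha_{p,\lambda}=\frac{2\Gamma(\frac1p)\Gamma(\frac3p)^2}{(2p-\lambda(4+3p))\Gamma(1+\frac1p)\Gamma(\frac3p)^2+\lambda\Gamma(\frac1p)^2\Gamma(\frac5p)}.$$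
   Context: $\mathbb B_p^n=\{x\in\mathbb R^n:\|x\|_p\le1\}$ with $\|x\|_p=(\sum_{i=1}^n|x_i|^p)^{1/p}$; $P_E$ denotes orthogonal projection onto the subspace $E$. Landau notation: $x_n=o(y_n)$ means $\lim_{n\to\infty} x_n/y_n=0$; $x_n=\omega(y_n)$ means $\lim_{n\to\infty}|x_n/y_n|=+\infty$. A moderate deviations principle (MDP) is formally the same as a large deviations principle: given positive reals $(s_n)$, a sequence $(X_n)$ of random vectors in $\mathbb R^d$ satisfies it with speed $s_n$ and rate function $\mathbb I:\mathbb R^d\to[0,\infty]$ if $\mathbb I$ is lower semi-continuous with compact level sets $\{\mathbb I\le\alpha\}$, $\alpha\in\mathbb R$, and for all Borel sets $A\subseteq\mathbb R^d$ $$-\inf_{x\in A^\circ}\mathbb I(x)\le\liminf_{n\to\infty}s_n^{-1}\log\mathbb P[X_n\in A]\le\limsup_{n\to\infty}s_n^{-1}\log\mathbb P[X_n\in A]\le-\inf_{x\in\overline A}\mathbb I(x),$$ where $A^\circ$ is the interior and $\overline A$ the closure of $A$. *)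

theory Defs
  imports
    "HOL-Probability.Probability"
    "HOL-Library.Function_Algebras"
    "HOL-Library.Landau_Symbols"
begin

(* Since n varies inside the statement, R^n is realised as the set of those real sequences that
   vanish from index n on. The coordinates are x 0, ..., x (n - 1). The pointwise vector space
   structure makes the library notions subspace, dim and linear available. *)

instantiation "fun" :: (type, real_vector) real_vector
begin

definition scaleR_fun :: "real \<Rightarrow> ('a \<Rightarrow> 'b) \<Rightarrow> 'a \<Rightarrow> 'b" where
  "scaleR_fun c f = (\<lambda>i. c *\<^sub>R f i)"

instance
  by standard (simp_all add: scaleR_fun_def fun_eq_iff scaleR_add_right scaleR_add_left)

end

definition Rn :: "nat \<Rightarrow> (nat \<Rightarrow> real) set" where
  "Rn n = {x. \<forall>i\<ge>n. x i = 0}"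

definition inner_n :: "nat \<Rightarrow> (nat \<Rightarrow> real) \<Rightarrow> (nat \<Rightarrow> real) \<Rightarrow> real" where
  "inner_n n x y = (\<Sum>i<n. x i * y i)"

definition lp_norm :: "real \<Rightarrow> nat \<Rightarrow> (nat \<Rightarrow> real) \<Rightarrow> real" where
  "lp_norm p n x = (\<Sum>i<n. \<bar>x i\<bar> powr p) powr (1 / p)"

definition lp_ball :: "real \<Rightarrow> nat \<Rightarrow> (nat \<Rightarrow> real) set" where
  "lp_ball p n = {x \<in> Rn n. lp_norm p n x \<le> 1}"

(* n-dimensional Lebesgue measure, transported from extensional functions to Rn n; it is a measure
   on the Borel sets of the sequence space, concentrated on Rn n. *)
definition lborel_n :: "nat \<Rightarrow> (nat \<Rightarrow> real) measure" where
  "lborel_n n = distr (\<Pi>\<^sub>M i\<in>{..<n}. lborel) borel (\<lambda>x i. if i < n then x i else 0)"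

definition orth_proj :: "nat \<Rightarrow> (nat \<Rightarrow> real) set \<Rightarrow> (nat \<Rightarrow> real) \<Rightarrow> (nat \<Rightarrow> real)" where
  "orth_proj n E x = (THE y. y \<in> E \<and> (\<forall>z\<in>E. inner_n n (x - y) z = 0))"

definition grassmannian :: "nat \<Rightarrow> nat \<Rightarrow> (nat \<Rightarrow> real) set set" where
  "grassmannian n k = {E. subspace E \<and> E \<subseteq> Rn n \<and> dim E = k}"

definition proj_matrix :: "nat \<Rightarrow> (nat \<Rightarrow> real) set \<Rightarrow> nat \<Rightarrow> nat \<Rightarrow> real" where
  "proj_matrix n E i j = orth_proj n E (\<lambda>l. if l = j then 1 else 0) i"

(* The Grassmannian carries the topology induced by the injective map E |-> (matrix of P_E), i.e.
   that of the metric ||P_E - P_F||; this is its Borel sigma-algebra. *)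
definition grassmannian_borel :: "nat \<Rightarrow> nat \<Rightarrow> (nat \<Rightarrow> real) set measure" where
  "grassmannian_borel n k = vimage_algebra (grassmannian n k) (proj_matrix n) borel"

(* Only the restriction of U to Rn n matters. *)
definition orth_group :: "nat \<Rightarrow> ((nat \<Rightarrow> real) \<Rightarrow> (nat \<Rightarrow> real)) set" where
  "orth_group n = {U. linear U \<and> U ` Rn n \<subseteq> Rn n \<and>
     (\<forall>x\<in>Rn n. \<forall>y\<in>Rn n. inner_n n (U x) (U y) = inner_n n x y)}"

(* The Haar probability measure is the unique Borel probability measure on the Grassmannian that is
   invariant under the action E |-> U E of the orthogonal group. *)
definition is_grassmannian_haar :: "nat \<Rightarrow> nat \<Rightarrow> (nat \<Rightarrow> real) set measure \<Rightarrow> bool" where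
  "is_grassmannian_haar n k \<mu> \<longleftrightarrow>
     prob_space \<mu> \<and>
     space \<mu> = grassmannian n k \<and>
     sets \<mu> = sets (grassmannian_borel n k) \<and>
     (\<forall>U\<in>orth_group n. distr \<mu> \<mu> (\<lambda>E. U ` E) = \<mu>)"

(* The library's indep_var requires both random elements to take values in the same type. *)
definition indep_elements ::
  "'a measure \<Rightarrow> 'b measure \<Rightarrow> ('a \<Rightarrow> 'b) \<Rightarrow> 'c measure \<Rightarrow> ('a \<Rightarrow> 'c) \<Rightarrow> bool" where
  "indep_elements M S X T Y \<longleftrightarrow>
     X \<in> measurable M S \<and> Y \<in> measurable M T \<and>
     prob_space.indep_set M {X -` A \<inter> space M | A. A \<in> sets S}
                            {Y -` B \<inter> space M | B. B \<in> sets T}"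

(* The real logarithm of the library has ln 0 = 0, whereas here log 0 = - infinity is needed. *)
definition log_ereal :: "real \<Rightarrow> ereal" where
  "log_ereal x = (if x = 0 then - \<infinity> else ereal (ln x))"

(* Sequences are indexed by n = 1, 2, ...; the term with n = 0 is ignored. The X n may live on
   different probability spaces, as only their laws matter. The same definition serves for large
   and moderate deviations. *)
definition satisfies_LDP ::
  "(nat \<Rightarrow> 'a measure) \<Rightarrow> (nat \<Rightarrow> 'a \<Rightarrow> 'b::euclidean_space) \<Rightarrow> (nat \<Rightarrow> real) \<Rightarrow> ('b \<Rightarrow> ereal) \<Rightarrow> bool"
where
  "satisfies_LDP M X s I \<longleftrightarrow>
     (\<forall>n\<ge>1. prob_space (M n) \<and> X n \<in> borel_measurable (M n) \<and> s n > 0) \<and>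
     (\<forall>x. 0 \<le> I x) \<and>
     (\<forall>x. I x \<le> Liminf (at x) I) \<and>
     (\<forall>a::real. compact {x. I x \<le> ereal a}) \<and>
     (\<forall>A\<in>sets borel.
        - (INF x\<in>interior A. I x)
            \<le> liminf (\<lambda>n. log_ereal (measure (M n) {\<omega>\<in>space (M n). X n \<omega> \<in> A}) / ereal (s n)) \<and>
        limsup (\<lambda>n. log_ereal (measure (M n) {\<omega>\<in>space (M n). X n \<omega> \<in> A}) / ereal (s n))
            \<le> - (INF x\<in>closure A. I x))"

definition proj_norm_fluctuation ::
  "real \<Rightarrow> nat \<Rightarrow> nat \<Rightarrow> (nat \<Rightarrow> real) set \<Rightarrow> (nat \<Rightarrow> real) \<Rightarrow> real" where
  "proj_norm_fluctuation p n k E x =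
     real n powr (1 / p) * sqrt (Gamma (1 / p) / (p powr (2 / p) * Gamma (3 / p)))
       * lp_norm 2 n (orth_proj n E x) - sqrt (real k)"

(* The denominator is positive except for p = 2, \<lambda> = 1, where it vanishes. Division in ereal then
   gives the value infinity, and infinity * 0 = 0 makes \<alpha> x^2 the rate function that is 0
   at 0 and infinite elsewhere. *)
definition alpha_const :: "real \<Rightarrow> real \<Rightarrow> ereal" where
  "alpha_const p \<Lambda> =
     ereal (2 * Gamma (1 / p) * (Gamma (3 / p))\<^sup>2) /
     ereal ((2 * p - \<Lambda> * (4 + 3 * p)) * Gamma (1 + 1 / p) * (Gamma (3 / p))\<^sup>2
            + \<Lambda> * (Gamma (1 / p))\<^sup>2 * Gamma (5 / p))"

end

theory Submission
  imports Defs "HOL-Real_Asymp.Real_Asymp"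
begin

text \<open>
  Write \<open>\<parallel>P\<^sub>E X\<parallel>\<^sub>2 = \<parallel>X\<parallel>\<^sub>p \<cdot> (\<parallel>X\<parallel>\<^sub>2 / \<parallel>X\<parallel>\<^sub>p) \<cdot> (\<parallel>P\<^sub>E X\<parallel>\<^sub>2 / \<parallel>X\<parallel>\<^sub>2)\<close>. The first factor is at most \<open>r\<close> with
  probability \<open>r ^ n\<close>, so replacing it by 1 is invisible on the scale of moderate deviations. The
  second factor depends on the direction of \<open>X\<close> only, and a layer-cake argument shows that it has
  the law of \<open>\<parallel>Y\<parallel>\<^sub>2 / \<parallel>Y\<parallel>\<^sub>p\<close>, where the coordinates of \<open>Y\<close> are independent with density proportional to
  \<open>exp (- \<bar>y\<bar> powr p / p)\<close> (\<open>uniform_lp_ball\<close>). The law of the third factor given \<open>X = x \<noteq> 0\<close> does not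
  depend on \<open>x\<close>, because the Haar measure is invariant under reflections; averaging over a standard Gaussian
  vector \<open>g\<close> in place of \<open>x\<close>, and using that the Gaussian law is invariant too, identifies it with the
  law of \<open>\<parallel>(g\<^sub>1, \<dots>, g\<^sub>k)\<parallel>\<^sub>2 / \<parallel>g\<parallel>\<^sub>2\<close> (\<open>haar_proj_ratio_law\<close>). Hence the last two factors together
  are distributed as a product of powers of averages of independent variables (\<open>ratio_pair_law\<close>).

  If \<open>a\<close>, \<open>b\<close>, \<open>c\<close>, \<open>d\<close> denote the deviations of the averages of \<open>Y\<^sub>i\<^sup>2 / \<sigma>\<^sup>2\<close>, of \<open>\<bar>Y\<^sub>i\<bar> powr p\<close>, of the first
  \<open>k\<close> and of all the \<open>g\<^sub>i\<^sup>2\<close> from their mean 1, that product, suitably scaled, is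
  \<open>sqrt k \<cdot> (1 + a) powr (1/2) \<cdot> (1 + b) powr (- 1/p) \<cdot> (1 + c) powr (1/2) \<cdot> (1 + d) powr (- 1/2)\<close>.
  Outside an event of probability \<open>exp (- \<omega>(t\<^sup>2))\<close> the deviations are at most \<open>K t / sqrt k\<close> with \<open>K\<close>
  growing slowly, so that the error of the linearization \<open>a/2 - b/p + c/2 - d/2\<close> is negligible, since
  \<open>t = o(sqrt k)\<close> (\<open>radial_stat_linearization\<close>). The linearized statistic is a sum of independent
  variables with exponential moments (here \<open>p \<ge> 2\<close> enters), whose rescaled cumulant generating
  function converges to \<open>v \<theta>\<^sup>2 / 2\<close> (\<open>lin_stat_mgf\<close>), where
  \<open>2 v = 1 - \<Lambda> + \<Lambda> ((E Y\<^sup>4 / (E Y\<^sup>2)\<^sup>2 - 1) / 2 - 2 / p)\<close> is the reciprocal of the constant in the rate function.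

  The convergence of the cumulant generating function is turned into deviation bounds by an
  exponential tilt (\<open>gaussian_bounds_of_mgf\<close>). These bounds are stable under exponentially equivalent
  perturbations and imply the full principle (\<open>gaussian_bounds_imp_LDP\<close>). All of this includes the
  degenerate case \<open>v = 0\<close>, which occurs for \<open>p = 2\<close> and \<open>\<Lambda> = 1\<close>.
\<close>

section \<open>Deviation bounds of Gaussian type\<close>

text \<open>A moderate deviations principle with rate \<open>x\<^sup>2 / (2 v)\<close>, reduced to what is needed on the line:
  upper bounds for the events \<open>\<bar>Z\<bar> \<ge> x\<close> and lower bounds for small intervals. The inequalities between
  \<open>x\<^sup>2\<close> and \<open>2 v \<beta>\<close> say that \<open>\<beta>\<close> lies strictly below or above the rate without dividing by \<open>v\<close>; the
  case \<open>v = 0\<close> then describes concentration at 0.\<close>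

definition gaussian_bounds ::
  "(nat \<Rightarrow> 'a measure) \<Rightarrow> (nat \<Rightarrow> 'a \<Rightarrow> real) \<Rightarrow> (nat \<Rightarrow> real) \<Rightarrow> real \<Rightarrow> bool" where
  "gaussian_bounds M Z s v \<longleftrightarrow>
     (\<forall>x \<beta>. 0 < x \<and> 2 * v * \<beta> < x\<^sup>2 \<longrightarrow>
        (\<forall>\<^sub>F n in sequentially. \<P>(\<omega> in M n. x \<le> \<bar>Z n \<omega>\<bar>) \<le> exp (- \<beta> * s n))) \<and>
     (\<forall>y \<epsilon> \<beta>. 0 < \<epsilon> \<and> 0 < \<beta> \<and> (y = 0 \<or> y\<^sup>2 < 2 * v * \<beta>) \<longrightarrow>
        (\<forall>\<^sub>F n in sequentially. exp (- \<beta> * s n) \<le> \<P>(\<omega> in M n. \<bar>Z n \<omega> - y\<bar> < \<epsilon>)))"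

text \<open>Probabilities that vanish faster than every \<open>exp (- \<beta> s)\<close>.\<close>

definition superexp ::
  "(nat \<Rightarrow> 'a measure) \<Rightarrow> (nat \<Rightarrow> 'a \<Rightarrow> bool) \<Rightarrow> (nat \<Rightarrow> real) \<Rightarrow> bool" where
  "superexp M P s \<longleftrightarrow> (\<forall>\<beta>. \<forall>\<^sub>F n in sequentially. \<P>(\<omega> in M n. P n \<omega>) \<le> exp (- \<beta> * s n))"

lemma gaussian_boundsD:
  assumes "gaussian_bounds M Z s v"
  shows "0 < x \<Longrightarrow> 2 * v * \<beta> < x\<^sup>2 \<Longrightarrow>
      \<forall>\<^sub>F n in sequentially. \<P>(\<omega> in M n. x \<le> \<bar>Z n \<omega>\<bar>) \<le> exp (- \<beta> * s n)"
    and "0 < \<epsilon> \<Longrightarrow> 0 < \<beta> \<Longrightarrow> y = 0 \<or> y\<^sup>2 < 2 * v * \<beta> \<Longrightarrow>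
      \<forall>\<^sub>F n in sequentially. exp (- \<beta> * s n) \<le> \<P>(\<omega> in M n. \<bar>Z n \<omega> - y\<bar> < \<epsilon>)"
  using assms unfolding gaussian_bounds_def by blast+

lemma eventually_const_exp_le:
  fixes s :: "nat \<Rightarrow> real"
  assumes "filterlim s at_top sequentially" "\<beta> < \<gamma>"
  shows "\<forall>\<^sub>F n in sequentially. C * exp (- \<gamma> * s n) \<le> exp (- \<beta> * s n)"
proof -
  have "\<forall>\<^sub>F n in sequentially. ln (max C 1) / (\<gamma> - \<beta>) \<le> s n"
    using assms(1) by (simp add: filterlim_at_top)
  then show ?thesis
  proof eventually_elim
    case (elim n)
    have "C * exp (- \<gamma> * s n) \<le> exp (ln (max C 1)) * exp (- \<gamma> * s n)" by simp
    also have "\<dots> = exp (ln (max C 1) - \<gamma> * s n)" by (simp add: exp_diff exp_minus field_simps)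
    also have "\<dots> \<le> exp (- \<beta> * s n)"
      using elim assms(2) by (simp add: field_simps)
    finally show ?case .
  qed
qed

lemma superexp_disj:
  assumes s: "filterlim s at_top sequentially"
    and P: "superexp M P s" and Q: "superexp M Q s"
    and m: "\<And>n. n \<ge> 1 \<Longrightarrow> {\<omega> \<in> space (M n). P n \<omega>} \<in> sets (M n)" "\<And>n. n \<ge> 1 \<Longrightarrow> {\<omega> \<in> space (M n). Q n \<omega>} \<in> sets (M n)"
  shows "superexp M (\<lambda>n \<omega>. P n \<omega> \<or> Q n \<omega>) s"
  unfolding superexp_def
proof
  fix \<beta> :: real
  have "\<forall>\<^sub>F n in sequentially. \<P>(\<omega> in M n. P n \<omega>) \<le> exp (- (\<beta>+1) * s n)"
    "\<forall>\<^sub>F n in sequentially. \<P>(\<omega> in M n. Q n \<omega>) \<le> exp (- (\<beta>+1) * s n)"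
    using P Q unfolding superexp_def by blast+
  moreover have "\<forall>\<^sub>F n in sequentially. 2 * exp (- (\<beta>+1) * s n) \<le> exp (- \<beta> * s n)"
    by (rule eventually_const_exp_le[OF s]) simp
  ultimately show "\<forall>\<^sub>F n in sequentially. \<P>(\<omega> in M n. P n \<omega> \<or> Q n \<omega>) \<le> exp (- \<beta> * s n)"
    using eventually_ge_at_top[of 1]
  proof eventually_elim
    case (elim n)
    have "{\<omega> \<in> space (M n). P n \<omega> \<or> Q n \<omega>} = {\<omega> \<in> space (M n). P n \<omega>} \<union> {\<omega> \<in> space (M n). Q n \<omega>}" by auto
    then have "\<P>(\<omega> in M n. P n \<omega> \<or> Q n \<omega>) \<le> \<P>(\<omega> in M n. P n \<omega>) + \<P>(\<omega> in M n. Q n \<omega>)"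
      using measure_Un_le[OF m(1) m(2)] elim by simp
    with elim show ?case by simp
  qed
qed

lemma superexp_mono:
  assumes "superexp M Q s"
    and "\<And>n. n \<ge> 1 \<Longrightarrow> prob_space (M n)"
    and "\<And>n. n \<ge> 1 \<Longrightarrow> {\<omega> \<in> space (M n). Q n \<omega>} \<in> sets (M n)"
    and "\<forall>\<^sub>F n in sequentially. \<forall>\<omega>\<in>space (M n). P n \<omega> \<longrightarrow> Q n \<omega>"
  shows "superexp M P s"
  unfolding superexp_def
proof
  fix \<beta> :: real
  have "\<forall>\<^sub>F n in sequentially. \<P>(\<omega> in M n. Q n \<omega>) \<le> exp (- \<beta> * s n)"
    using assms(1) unfolding superexp_def by blast
  then show "\<forall>\<^sub>F n in sequentially. \<P>(\<omega> in M n. P n \<omega>) \<le> exp (- \<beta> * s n)"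
    using assms(4) eventually_ge_at_top[of 1]
  proof eventually_elim
    case (elim n)
    interpret prob_space "M n" using assms(2) elim by simp
    have "\<P>(\<omega> in M n. P n \<omega>) \<le> \<P>(\<omega> in M n. Q n \<omega>)"
      using elim assms(3)[of n] by (intro finite_measure_mono) auto
    with elim show ?case by simp
  qed
qed

text \<open>The Gaussian rate grows without bound, so diverging thresholds are exceeded with negligible
  probability, however slowly they diverge.\<close>

lemma gaussian_bounds_superexp:
  assumes g: "gaussian_bounds M Z s v"
    and K: "filterlim K at_top sequentially"
    and p: "\<And>n. n \<ge> 1 \<Longrightarrow> prob_space (M n)"
    and m: "\<And>n. n \<ge> 1 \<Longrightarrow> Z n \<in> borel_measurable (M n)"
  shows "superexp M (\<lambda>n \<omega>. K n \<le> \<bar>Z n \<omega>\<bar>) s"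
  unfolding superexp_def
proof
  fix \<beta> :: real
  define x where "x = \<bar>2 * v * \<beta>\<bar> + 1"
  have "1 * x \<le> x * x" by (intro mult_right_mono) (auto simp: x_def)
  then have x: "0 < x" "2 * v * \<beta> < x\<^sup>2"
    by (auto simp: power2_eq_square x_def)
  have "\<forall>\<^sub>F n in sequentially. \<P>(\<omega> in M n. x \<le> \<bar>Z n \<omega>\<bar>) \<le> exp (- \<beta> * s n)"
    using g x unfolding gaussian_bounds_def by blast
  moreover have "\<forall>\<^sub>F n in sequentially. x \<le> K n" using K by (simp add: filterlim_at_top)
  ultimately show "\<forall>\<^sub>F n in sequentially. \<P>(\<omega> in M n. K n \<le> \<bar>Z n \<omega>\<bar>) \<le> exp (- \<beta> * s n)"
    using eventually_ge_at_top[of 1]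
  proof eventually_elim
    case (elim n)
    interpret prob_space "M n" using p elim by simp
    note m[OF elim(3), measurable]
    have "\<P>(\<omega> in M n. K n \<le> \<bar>Z n \<omega>\<bar>) \<le> \<P>(\<omega> in M n. x \<le> \<bar>Z n \<omega>\<bar>)"
      using elim by (intro finite_measure_mono) auto
    with elim show ?case by simp
  qed
qed

text \<open>Exponential equivalence: the strict inequalities in the bounds leave room for moving both the
  threshold and the exponent a little, which absorbs a negligible perturbation.\<close>

lemma gaussian_bounds_transfer:
  assumes s: "filterlim s at_top sequentially"
    and p: "\<And>n. n \<ge> 1 \<Longrightarrow> prob_space (M n)"
    and m: "\<And>n. n \<ge> 1 \<Longrightarrow> Z n \<in> borel_measurable (M n)" "\<And>n. n \<ge> 1 \<Longrightarrow> W n \<in> borel_measurable (M n)"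
    and g: "gaussian_bounds M Z s v"
    and e: "\<And>\<epsilon>. \<epsilon> > 0 \<Longrightarrow> superexp M (\<lambda>n \<omega>. \<epsilon> \<le> \<bar>W n \<omega> - Z n \<omega>\<bar>) s"
  shows "gaussian_bounds M W s v"
  unfolding gaussian_bounds_def
proof (intro conjI allI impI)
  fix x \<beta> :: real
  assume x: "0 < x \<and> 2 * v * \<beta> < x\<^sup>2"
  \<comment> \<open>both \<open>x\<close> and \<open>\<beta>\<close> have room to spare in a strict inequality\<close>
  have "((\<lambda>\<delta>. (x - \<delta>)\<^sup>2 - 2 * v * (\<beta> + \<delta>)) \<longlongrightarrow> (x - 0)\<^sup>2 - 2 * v * (\<beta> + 0)) (at_right 0)"
    by (intro tendsto_intros)
  then have "\<forall>\<^sub>F \<delta> in at_right 0. (x - \<delta>)\<^sup>2 - 2 * v * (\<beta> + \<delta>) > 0"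
    using x by (intro order_tendstoD(1)) auto
  moreover have "\<forall>\<^sub>F \<delta> in at_right 0. \<delta> \<in> {0<..<x}"
    using x by (intro eventually_at_right_real) auto
  ultimately have "\<forall>\<^sub>F \<delta> in at_right 0. (x - \<delta>)\<^sup>2 - 2 * v * (\<beta> + \<delta>) > 0 \<and> \<delta> \<in> {0<..<x}"
    by (rule eventually_conj)
  from eventually_happens'[OF trivial_limit_at_right_real this]
  obtain \<delta> where d: "(x - \<delta>)\<^sup>2 - 2 * v * (\<beta> + \<delta>) > 0" "0 < \<delta>" "\<delta> < x"
    by auto
  have "\<forall>\<^sub>F n in sequentially. \<P>(\<omega> in M n. x - \<delta> \<le> \<bar>Z n \<omega>\<bar>) \<le> exp (- (\<beta> + \<delta>) * s n)"
    using d by (intro gaussian_boundsD(1)[OF g]) auto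
  moreover have "\<forall>\<^sub>F n in sequentially. \<P>(\<omega> in M n. \<delta> \<le> \<bar>W n \<omega> - Z n \<omega>\<bar>) \<le> exp (- (\<beta> + \<delta>) * s n)"
    using e[OF d(2)] unfolding superexp_def by blast
  moreover have "\<forall>\<^sub>F n in sequentially. 2 * exp (- (\<beta>+\<delta>) * s n) \<le> exp (- \<beta> * s n)"
    by (rule eventually_const_exp_le[OF s]) (simp add: d)
  ultimately show "\<forall>\<^sub>F n in sequentially. \<P>(\<omega> in M n. x \<le> \<bar>W n \<omega>\<bar>) \<le> exp (- \<beta> * s n)"
    using eventually_ge_at_top[of 1]
  proof eventually_elim
    case (elim n)
    interpret prob_space "M n" using p elim by simp
    note m[OF elim(4), measurable]
    have "\<P>(\<omega> in M n. x \<le> \<bar>W n \<omega>\<bar>)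
      \<le> measure (M n) ({\<omega> \<in> space (M n). x - \<delta> \<le> \<bar>Z n \<omega>\<bar>} \<union> {\<omega> \<in> space (M n). \<delta> \<le> \<bar>W n \<omega> - Z n \<omega>\<bar>})"
      by (intro finite_measure_mono) auto
    also have "\<dots> \<le> \<P>(\<omega> in M n. x - \<delta> \<le> \<bar>Z n \<omega>\<bar>) + \<P>(\<omega> in M n. \<delta> \<le> \<bar>W n \<omega> - Z n \<omega>\<bar>)"
      by (intro measure_Un_le) auto
    finally show ?case using elim by simp
  qed
next
  fix y \<epsilon> \<beta> :: real
  assume y: "0 < \<epsilon> \<and> 0 < \<beta> \<and> (y = 0 \<or> y\<^sup>2 < 2 * v * \<beta>)"
  have "((\<lambda>\<delta>. 2 * v * (\<beta> - \<delta>) - y\<^sup>2) \<longlongrightarrow> 2 * v * (\<beta> - 0) - y\<^sup>2) (at_right 0)"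
    by (intro tendsto_intros)
  then have "\<forall>\<^sub>F \<delta> in at_right 0. y = 0 \<or> 2 * v * (\<beta> - \<delta>) - y\<^sup>2 > 0"
  proof (cases "y = 0")
    case False
    from order_tendstoD(1)[OF \<open>((\<lambda>\<delta>. 2 * v * (\<beta> - \<delta>) - y\<^sup>2) \<longlongrightarrow> 2 * v * (\<beta> - 0) - y\<^sup>2) (at_right 0)\<close>, of 0]
    show ?thesis using y False by (auto elim: eventually_mono)
  qed simp
  moreover have "\<forall>\<^sub>F \<delta> in at_right 0. \<delta> \<in> {0<..<\<beta>}"
    using y by (intro eventually_at_right_real) auto
  ultimately have "\<forall>\<^sub>F \<delta> in at_right 0. (y = 0 \<or> 2 * v * (\<beta> - \<delta>) - y\<^sup>2 > 0) \<and> \<delta> \<in> {0<..<\<beta>}"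
    by (rule eventually_conj)
  from eventually_happens'[OF trivial_limit_at_right_real this]
  obtain \<delta> where d: "y = 0 \<or> 2 * v * (\<beta> - \<delta>) - y\<^sup>2 > 0" "0 < \<delta>" "\<delta> < \<beta>"
    by auto
  have "\<forall>\<^sub>F n in sequentially. exp (- (\<beta> - \<delta>) * s n) \<le> \<P>(\<omega> in M n. \<bar>Z n \<omega> - y\<bar> < \<epsilon>/2)"
    using d y by (intro gaussian_boundsD(2)[OF g]) auto
  moreover have "\<forall>\<^sub>F n in sequentially. \<P>(\<omega> in M n. \<epsilon>/2 \<le> \<bar>W n \<omega> - Z n \<omega>\<bar>) \<le> exp (- \<beta> * s n)"
    using e[of "\<epsilon>/2"] y unfolding superexp_def by simp
  moreover have "\<forall>\<^sub>F n in sequentially. 2 * exp (- \<beta> * s n) \<le> exp (- (\<beta> - \<delta>) * s n)"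
    by (rule eventually_const_exp_le[OF s]) (simp add: d)
  ultimately show "\<forall>\<^sub>F n in sequentially. exp (- \<beta> * s n) \<le> \<P>(\<omega> in M n. \<bar>W n \<omega> - y\<bar> < \<epsilon>)"
    using eventually_ge_at_top[of 1]
  proof eventually_elim
    case (elim n)
    interpret prob_space "M n" using p elim by simp
    note m[OF elim(4), measurable]
    have "\<P>(\<omega> in M n. \<bar>Z n \<omega> - y\<bar> < \<epsilon>/2)
      \<le> measure (M n) ({\<omega> \<in> space (M n). \<bar>W n \<omega> - y\<bar> < \<epsilon>} \<union> {\<omega> \<in> space (M n). \<epsilon>/2 \<le> \<bar>W n \<omega> - Z n \<omega>\<bar>})"
    proof (intro finite_measure_mono subsetI)
      fix \<omega> assume "\<omega> \<in> {\<omega> \<in> space (M n). \<bar>Z n \<omega> - y\<bar> < \<epsilon>/2}"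
      moreover have "\<bar>W n \<omega> - y\<bar> \<le> \<bar>W n \<omega> - Z n \<omega>\<bar> + \<bar>Z n \<omega> - y\<bar>" by simp
      ultimately show "\<omega> \<in> {\<omega> \<in> space (M n). \<bar>W n \<omega> - y\<bar> < \<epsilon>} \<union> {\<omega> \<in> space (M n). \<epsilon>/2 \<le> \<bar>W n \<omega> - Z n \<omega>\<bar>}"
        by auto
    qed measurable
    also have "\<dots> \<le> \<P>(\<omega> in M n. \<bar>W n \<omega> - y\<bar> < \<epsilon>) + \<P>(\<omega> in M n. \<epsilon>/2 \<le> \<bar>W n \<omega> - Z n \<omega>\<bar>)"
      by (intro measure_Un_le) auto
    finally show ?case using elim by simp
  qed
qed

text \<open>Markov's inequality under the tilted measure with density proportional to \<open>exp ((\<theta> - r) Z)\<close>.\<close>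

lemma exponential_Markov:
  assumes Z[measurable]: "Z \<in> borel_measurable M" and r: "r \<ge> 0"
    and C: "(\<integral>\<^sup>+\<omega>. ennreal (exp (\<theta> * Z \<omega>)) \<partial>M) \<le> ennreal C" "C \<ge> 0"
  shows "(\<integral>\<^sup>+\<omega>. ennreal (exp ((\<theta> - r) * Z \<omega>)) * indicator {\<omega>. z \<le> Z \<omega>} \<omega> \<partial>M) \<le> ennreal (exp (- r * z) * C)"
proof -
  have "(\<integral>\<^sup>+\<omega>. ennreal (exp ((\<theta> - r) * Z \<omega>)) * indicator {\<omega>. z \<le> Z \<omega>} \<omega> \<partial>M)
     \<le> (\<integral>\<^sup>+\<omega>. ennreal (exp (- r * z)) * ennreal (exp (\<theta> * Z \<omega>)) \<partial>M)"
  proof (intro nn_integral_mono)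
    fix \<omega>
    show "ennreal (exp ((\<theta> - r) * Z \<omega>)) * indicator {\<omega>. z \<le> Z \<omega>} \<omega> \<le> ennreal (exp (- r * z)) * ennreal (exp (\<theta> * Z \<omega>))"
    proof (cases "z \<le> Z \<omega>")
      case True
      then have "(\<theta> - r) * Z \<omega> \<le> - r * z + \<theta> * Z \<omega>"
        using mult_left_mono[OF True r] by (simp add: algebra_simps)
      with True show ?thesis by (simp add: ennreal_mult[symmetric] exp_add[symmetric])
    qed simp
  qed
  also have "\<dots> = ennreal (exp (- r * z)) * (\<integral>\<^sup>+\<omega>. ennreal (exp (\<theta> * Z \<omega>)) \<partial>M)"
    by (rule nn_integral_cmult) measurable
  also have "\<dots> \<le> ennreal (exp (- r * z)) * ennreal C" by (intro mult_left_mono C) simp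
  also have "\<dots> = ennreal (exp (- r * z) * C)" using C(2) by (simp add: ennreal_mult)
  finally show ?thesis .
qed

text \<open>An upper bound by all reals below the infimum of a rate function is an upper bound by the
  infimum itself, which may be infinite.\<close>

lemma ereal_le_uminusI:
  fixes L c :: ereal
  assumes "\<And>\<beta>::real. ereal \<beta> < c \<Longrightarrow> L \<le> - ereal \<beta>"
  shows "L \<le> - c"
proof -
  have "c \<le> - L"
  proof (rule dense_le)
    fix d assume d: "d < c"
    show "d \<le> - L"
    proof (cases d)
      case (real r)
      then have "L \<le> - d" using assms[of r] d by simp
      then show ?thesis using ereal_minus_le_minus[of "- d" L] by simp
    qed (use d in auto)
  qed
  then show ?thesis using ereal_minus_le_minus[of "- L" c] by simp
qed

text \<open>The rate depends on the distance to the origin only, so a Borel set may be replaced by the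
  complement of an interval around 0 in the upper bound, and by a small interval in the lower bound.
  For \<open>v = 0\<close> the coefficient is the extended real \<open>1 / 0 = \<infinity>\<close>, and the rate is 0 at 0 and infinite elsewhere.\<close>

theorem gaussian_bounds_imp_LDP:
  fixes M :: "nat \<Rightarrow> 'a measure" and Z :: "nat \<Rightarrow> 'a \<Rightarrow> real"
  assumes s: "\<And>n. n \<ge> 1 \<Longrightarrow> s n > 0" and v: "v \<ge> 0"
    and p: "\<And>n. n \<ge> 1 \<Longrightarrow> prob_space (M n)"
    and m: "\<And>n. n \<ge> 1 \<Longrightarrow> Z n \<in> borel_measurable (M n)"
    and g: "gaussian_bounds M Z s v"
  shows "satisfies_LDP M Z s (\<lambda>x. ereal 1 / ereal (2 * v) * ereal (x\<^sup>2))"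
proof -
  define I where "I = (\<lambda>x. ereal 1 / ereal (2 * v) * ereal (x\<^sup>2))"
  have I: "I x = (if v = 0 then (if x = 0 then 0 else \<infinity>) else ereal (x\<^sup>2 / (2 * v)))" for x
    by (simp add: I_def)
  have I_nonneg: "0 \<le> I x" for x using v by (simp add: I)
  have I0: "I 0 = 0" by (simp add: I)
  have level: "{x. I x \<le> ereal a} = (if a < 0 then {} else {- sqrt (2 * v * a)..sqrt (2 * v * a)})" for a
  proof (cases "a < 0")
    case True
    then have "\<not> I x \<le> ereal a" for x using I_nonneg[of x] by (metis ereal_less_eq(3) less_ereal.simps(1) not_less order.trans zero_ereal_def)
    then show ?thesis using True by auto
  next
    case False
    have "I x \<le> ereal a \<longleftrightarrow> x\<^sup>2 \<le> 2 * v * a" for x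
      using False v by (auto simp: I field_simps)
    moreover have "x\<^sup>2 \<le> 2 * v * a \<longleftrightarrow> - sqrt (2 * v * a) \<le> x \<and> x \<le> sqrt (2 * v * a)" for x
      using False v by (metis abs_le_iff minus_le_iff real_sqrt_abs real_sqrt_le_iff)
    ultimately have "{x. I x \<le> ereal a} = {- sqrt (2 * v * a)..sqrt (2 * v * a)}"
      by (intro set_eqI) (simp only: mem_Collect_eq atLeastAtMost_iff)
    then show ?thesis using False by simp
  qed
  have lsc: "I x \<le> Liminf (at x) I" for x
    unfolding le_Liminf_iff
  proof (intro allI impI)
    fix c assume c: "c < I x"
    obtain a where a: "c \<le> ereal a" "ereal a < I x"
    proof (cases c)
      case MInf then show ?thesis using I_nonneg[of x] by (intro that[of "-1"]) (auto intro: less_le_trans[of _ 0])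
    next
      case PInf then show ?thesis using c by simp
    next
      case (real r) then show ?thesis using c by (intro that[of r]) auto
    qed
    have "closed {x. I x \<le> ereal a}" unfolding level by auto
    moreover have "x \<notin> {x. I x \<le> ereal a}" using a by simp
    ultimately have "\<forall>\<^sub>F y in at x. y \<in> - {x. I x \<le> ereal a}"
      by (intro topological_tendstoD[OF tendsto_ident_at]) (auto simp: open_Compl)
    then show "\<forall>\<^sub>F y in at x. c < I y"
      by eventually_elim (use a in auto)
  qed
  have comp: "compact {x. I x \<le> ereal a}" for a :: real unfolding level by auto
  have spos: "\<forall>\<^sub>F n in sequentially. 0 < s n"
    using eventually_ge_at_top[of 1] by eventually_elim (use s in auto)
  let ?L = "\<lambda>A n. log_ereal (\<P>(\<omega> in M n. Z n \<omega> \<in> A)) / ereal (s n)"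
  have log_le: "log_ereal q / ereal (s n) \<le> - ereal \<beta>" if "q \<le> exp (- \<beta> * s n)" "0 \<le> q" "0 < s n" for q \<beta> n
  proof (cases "q = 0")
    case False
    then have "ln q \<le> - \<beta> * s n" using that by (metis less_eq_real_def ln_exp ln_le_cancel_iff exp_gt_zero)
    then show ?thesis using False that by (simp add: log_ereal_def field_simps)
  qed (use that in \<open>simp add: log_ereal_def\<close>)
  have log_ge: "- ereal \<beta> \<le> log_ereal q / ereal (s n)" if "exp (- \<beta> * s n) \<le> q" "0 < s n" for q \<beta> n
  proof -
    have "q > 0" using that(1) exp_gt_zero less_le_trans by blast
    then have "- \<beta> * s n \<le> ln q" using that by (metis ln_exp ln_le_cancel_iff exp_gt_zero)
    then show ?thesis using \<open>q > 0\<close> that by (simp add: log_ereal_def field_simps)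
  qed
  have lower: "- (INF x\<in>interior A. I x) \<le> liminf (?L A)" if A: "A \<in> sets borel" for A
  proof -
    have "- I y \<le> liminf (?L A)" if y: "y \<in> interior A" for y
    proof (cases "I y = \<infinity>")
      case False
      then obtain a where a: "I y = ereal a" using I_nonneg[of y] by (cases "I y") auto
      have "a \<ge> 0" using I_nonneg[of y] a by simp
      obtain \<epsilon> where e: "\<epsilon> > 0" "ball y \<epsilon> \<subseteq> A" using y by (meson mem_interior)
      have "- ereal (a + \<delta>) \<le> liminf (?L A)" if d: "\<delta> > 0" for \<delta>
      proof (rule Liminf_bounded)
        have "y = 0 \<or> y\<^sup>2 < 2 * v * (a + \<delta>)"
          using a d v \<open>a \<ge> 0\<close> by (auto simp: I field_simps split: if_splits)
        then have "\<forall>\<^sub>F n in sequentially. exp (- (a + \<delta>) * s n) \<le> \<P>(\<omega> in M n. \<bar>Z n \<omega> - y\<bar> < \<epsilon>)"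
          using e d \<open>a \<ge> 0\<close> by (intro gaussian_boundsD(2)[OF g]) auto
        then show "\<forall>\<^sub>F n in sequentially. - ereal (a + \<delta>) \<le> ?L A n"
          using spos eventually_ge_at_top[of 1]
        proof eventually_elim
          case (elim n)
          interpret prob_space "M n" using p elim by simp
          note m[OF elim(3), measurable]
          note A[measurable]
          have "\<P>(\<omega> in M n. \<bar>Z n \<omega> - y\<bar> < \<epsilon>) \<le> \<P>(\<omega> in M n. Z n \<omega> \<in> A)"
            using e(2) by (intro finite_measure_mono) (auto simp: subset_eq dist_real_def abs_minus_commute)
          with elim show ?case by (intro log_ge) auto
        qed
      qed
      then have "- ereal a - ereal \<delta> \<le> liminf (?L A)" if "\<delta> > 0" for \<delta>
        using that by simp
      then have "- ereal a \<le> liminf (?L A) + ereal \<delta>" if "\<delta> > 0" for \<delta>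
        using that by (intro iffD1[OF ereal_minus_le]) auto
      then show ?thesis unfolding a by (rule ereal_le_epsilon2)
    qed simp
    then show ?thesis unfolding ereal_SUP_uminus_eq[symmetric] by (rule SUP_least)
  qed
  have upper: "limsup (?L A) \<le> - (INF x\<in>closure A. I x)" if A: "A \<in> sets borel" for A
  proof (cases "0 \<in> closure A")
    case True
    then have "(INF x\<in>closure A. I x) \<le> I 0" by (rule INF_lower)
    then have "- (INF x\<in>closure A. I x) \<ge> 0" by (simp add: I0 ereal_uminus_le_reorder)
    moreover have "limsup (?L A) \<le> 0"
    proof (rule Limsup_bounded)
      show "\<forall>\<^sub>F n in sequentially. ?L A n \<le> 0"
        using spos eventually_ge_at_top[of 1]
      proof eventually_elim
        case (elim n)
        interpret prob_space "M n" using p elim by simp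
        show ?case using log_le[of _ 0 n] elim by (simp add: zero_ereal_def)
      qed
    qed
    ultimately show ?thesis by (rule order_trans[rotated])
  next
    case False
    have "limsup (?L A) \<le> - ereal \<beta>" if b: "ereal \<beta> < (INF x\<in>closure A. I x)" for \<beta>
    proof (cases "A = {}")
      case True
      have "log_ereal 0 / ereal (s n) = -\<infinity>" if "s n > 0" for n using that by (simp add: log_ereal_def)
      then have "\<forall>\<^sub>F n in sequentially. ?L A n \<le> - ereal \<beta>"
        using spos by (auto simp: True elim: eventually_mono)
      then show ?thesis by (rule Limsup_bounded)
    next
      case ne: False
      \<comment> \<open>\<open>A\<close> lies outside the open interval whose radius is the smallest modulus in its closure\<close>
      obtain z where z: "z \<in> closure A" "\<And>y. y \<in> closure A \<Longrightarrow> dist 0 z \<le> dist 0 y"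
        using distance_attains_inf[of "closure A" 0] ne by auto
      have "z \<noteq> 0" using z(1) False by auto
      have "ereal \<beta> < I z" using b z(1) by (meson INF_lower less_le_trans)
      then have "2 * v * \<beta> < \<bar>z\<bar>\<^sup>2" using v \<open>z \<noteq> 0\<close> by (auto simp: I field_simps split: if_splits)
      then have "\<forall>\<^sub>F n in sequentially. \<P>(\<omega> in M n. \<bar>z\<bar> \<le> \<bar>Z n \<omega>\<bar>) \<le> exp (- \<beta> * s n)"
        using \<open>z \<noteq> 0\<close> by (intro gaussian_boundsD(1)[OF g]) auto
      then have "\<forall>\<^sub>F n in sequentially. ?L A n \<le> - ereal \<beta>"
        using spos eventually_ge_at_top[of 1]
      proof eventually_elim
        case (elim n)
        interpret prob_space "M n" using p elim by simp
        note m[OF elim(3), measurable]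
        have "\<P>(\<omega> in M n. Z n \<omega> \<in> A) \<le> \<P>(\<omega> in M n. \<bar>z\<bar> \<le> \<bar>Z n \<omega>\<bar>)"
          using z(2) closure_subset[of A] by (intro finite_measure_mono) (auto simp: dist_real_def)
        with elim show ?case by (intro log_le) auto
      qed
      then show ?thesis by (rule Limsup_bounded)
    qed
    then show ?thesis by (rule ereal_le_uminusI)
  qed
  show ?thesis
    unfolding satisfies_LDP_def I_def[symmetric]
    by (intro conjI ballI allI impI p m s I_nonneg lsc comp lower upper)
qed

section \<open>From moment generating functions to deviation bounds\<close>

text \<open>Shifting the tilt by \<open>r\<close> bounds the contribution of \<open>Z \<ge> z\<close> to the moment generating function.
  With \<open>\<theta> = 0\<close> this is the Chernoff bound.\<close>

lemma mgf_tail: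
  fixes M :: "nat \<Rightarrow> 'a measure" and Z :: "nat \<Rightarrow> 'a \<Rightarrow> real"
  assumes s: "filterlim s at_top sequentially"
    and m: "\<And>n. n \<ge> 1 \<Longrightarrow> Z n \<in> borel_measurable (M n)"
    and mgf: "\<And>\<theta> \<delta>. \<delta> > 0 \<Longrightarrow> \<forall>\<^sub>F n in sequentially.
       (\<integral>\<^sup>+\<omega>. ennreal (exp (\<theta> * (s n * Z n \<omega>))) \<partial>M n) \<le> ennreal (exp (s n * (v * \<theta>\<^sup>2 / 2 + \<delta>)))"
    and "\<delta> > 0" "r \<ge> 0"
  shows "\<forall>\<^sub>F n in sequentially.
      (\<integral>\<^sup>+\<omega>. ennreal (exp (\<theta> * (s n * Z n \<omega>))) * indicator {\<omega>. z \<le> Z n \<omega>} \<omega> \<partial>M n)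
        \<le> ennreal (exp (s n * (v * (\<theta> + r)\<^sup>2 / 2 - r * z + \<delta>)))"
proof -
  have "\<forall>\<^sub>F n in sequentially. 0 < s n" using s by (simp add: filterlim_at_top_dense)
  then show ?thesis using mgf[OF \<open>\<delta> > 0\<close>, of "\<theta> + r"] eventually_ge_at_top[of 1]
  proof eventually_elim
    case (elim n)
    note m[OF elim(3), measurable]
    have "(\<integral>\<^sup>+\<omega>. ennreal (exp (((\<theta> + r) - r) * (s n * Z n \<omega>))) * indicator {\<omega>. s n * z \<le> s n * Z n \<omega>} \<omega> \<partial>M n)
      \<le> ennreal (exp (- r * (s n * z)) * exp (s n * (v * (\<theta> + r)\<^sup>2 / 2 + \<delta>)))"
      using elim by (intro exponential_Markov \<open>r \<ge> 0\<close>) auto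
    also have "exp (- r * (s n * z)) * exp (s n * (v * (\<theta> + r)\<^sup>2 / 2 + \<delta>)) = exp (s n * (v * (\<theta> + r)\<^sup>2 / 2 - r * z + \<delta>))"
      by (simp add: exp_add[symmetric] algebra_simps)
    finally show ?case using elim by simp
  qed
qed

text \<open>The argument of Gaertner and Ellis. Under the tilt \<open>\<theta>\<close> with \<open>v \<theta> = y\<close> almost all of the mass
  of the moment generating function comes from a neighbourhood of \<open>y\<close>: the contributions from both sides are
  exponentially smaller by the preceding lemma. On the neighbourhood the integrand is nearly constant, which
  gives the lower bound for its probability.\<close>

theorem gaussian_bounds_of_mgf:
  fixes M :: "nat \<Rightarrow> 'a measure" and Z :: "nat \<Rightarrow> 'a \<Rightarrow> real"
  assumes s: "filterlim s at_top sequentially" and v: "v \<ge> 0"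
    and p: "\<And>n. n \<ge> 1 \<Longrightarrow> prob_space (M n)"
    and m: "\<And>n. n \<ge> 1 \<Longrightarrow> Z n \<in> borel_measurable (M n)"
    and mgf_le: "\<And>\<theta> \<delta>. \<delta> > 0 \<Longrightarrow> \<forall>\<^sub>F n in sequentially.
       (\<integral>\<^sup>+\<omega>. ennreal (exp (\<theta> * (s n * Z n \<omega>))) \<partial>M n) \<le> ennreal (exp (s n * (v * \<theta>\<^sup>2 / 2 + \<delta>)))"
    and mgf_ge: "\<And>\<theta> \<delta>. \<delta> > 0 \<Longrightarrow> \<forall>\<^sub>F n in sequentially.
       ennreal (exp (s n * (v * \<theta>\<^sup>2 / 2 - \<delta>))) \<le> (\<integral>\<^sup>+\<omega>. ennreal (exp (\<theta> * (s n * Z n \<omega>))) \<partial>M n)"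
  shows "gaussian_bounds M Z s v"
proof -
  have spos: "\<forall>\<^sub>F n in sequentially. 0 < s n" using s by (simp add: filterlim_at_top_dense)
  have upper: "\<forall>\<^sub>F n in sequentially.
      (\<integral>\<^sup>+\<omega>. ennreal (exp (\<theta> * (s n * Z n \<omega>))) * indicator {\<omega>. z \<le> Z n \<omega>} \<omega> \<partial>M n)
        \<le> ennreal (exp (s n * (v * (\<theta> + r)\<^sup>2 / 2 - r * z + \<delta>)))" if "\<delta> > 0" "r \<ge> 0" for \<theta> r z \<delta>
    by (rule mgf_tail[OF s m mgf_le that])
  have lower: "\<forall>\<^sub>F n in sequentially.
      (\<integral>\<^sup>+\<omega>. ennreal (exp (\<theta> * (s n * Z n \<omega>))) * indicator {\<omega>. z \<le> - Z n \<omega>} \<omega> \<partial>M n)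
        \<le> ennreal (exp (s n * (v * (- \<theta> + r)\<^sup>2 / 2 - r * z + \<delta>)))" if "\<delta> > 0" "r \<ge> 0" for \<theta> r z \<delta>
    using mgf_tail[OF s, where Z = "\<lambda>n \<omega>. - Z n \<omega>" and v = v and \<delta> = \<delta> and r = r and \<theta> = "- \<theta>" and z = z]
      mgf_le[where \<theta> = "- \<theta>" for \<theta>] that m by simp
  show ?thesis
    unfolding gaussian_bounds_def
  proof (intro conjI allI impI)
    fix x \<beta> :: real
    assume x: "0 < x \<and> 2 * v * \<beta> < x\<^sup>2"
    have "\<exists>r\<ge>0. v * r\<^sup>2 / 2 - r * x < - \<beta>"
    proof (cases "v = 0")
      case True
      have "0 * (0::real)\<^sup>2 / 2 - 0 * x < - \<beta>" if "\<beta> < 0" using that by simp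
      moreover have "0 * ((\<beta>+1)/x)\<^sup>2 / 2 - ((\<beta>+1)/x) * x < - \<beta>" using x by simp
      moreover have "(\<beta>+1)/x \<ge> 0" if "\<not> \<beta> < 0" using that x by simp
      ultimately show ?thesis using True by (metis order_refl)
    next
      case False
      then have "v * (x/v)\<^sup>2 / 2 - (x/v) * x < - \<beta>"
        using v x by (simp add: field_simps power2_eq_square)
      moreover have "x/v \<ge> 0" using v x by simp
      ultimately show ?thesis by blast
    qed
    then obtain r where r: "r \<ge> 0" "v * r\<^sup>2 / 2 - r * x < - \<beta>" by blast
    define \<delta> where "\<delta> = (- \<beta> - (v * r\<^sup>2 / 2 - r * x)) / 2"
    have d: "\<delta> > 0" "v * r\<^sup>2 / 2 - r * x + \<delta> = - (\<beta> + \<delta>)" using r by (auto simp: \<delta>_def field_simps)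
    have "\<forall>\<^sub>F n in sequentially. 2 * exp (- (\<beta>+\<delta>) * s n) \<le> exp (- \<beta> * s n)"
      by (rule eventually_const_exp_le[OF s]) (simp add: d)
    then show "\<forall>\<^sub>F n in sequentially. \<P>(\<omega> in M n. x \<le> \<bar>Z n \<omega>\<bar>) \<le> exp (- \<beta> * s n)"
      using upper[OF d(1) r(1), of 0 x] lower[OF d(1) r(1), of 0 x] eventually_ge_at_top[of 1]
    proof eventually_elim
      case (elim n)
      interpret prob_space "M n" using p elim by simp
      note m[OF elim(4), measurable]
      have e: "exp (s n * (v * (0 + r)\<^sup>2 / 2 - r * x + \<delta>)) = exp (- (\<beta>+\<delta>) * s n)"
        using d(2) by (simp add: mult.commute)
      have "(\<integral>\<^sup>+\<omega>. ennreal (exp (0 * (s n * Z n \<omega>))) * indicator {\<omega>. x \<le> Z n \<omega>} \<omega> \<partial>M n) = (\<integral>\<^sup>+\<omega>. indicator {\<omega> \<in> space (M n). x \<le> Z n \<omega>} \<omega> \<partial>M n)"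
        by (intro nn_integral_cong) (auto split: split_indicator)
      also have "\<dots> = emeasure (M n) {\<omega> \<in> space (M n). x \<le> Z n \<omega>}" by (intro nn_integral_indicator) measurable
      finally have 1: "\<P>(\<omega> in M n. x \<le> Z n \<omega>) \<le> exp (- (\<beta>+\<delta>) * s n)"
        using elim(2) unfolding e by (simp add: emeasure_eq_measure)
      have "(\<integral>\<^sup>+\<omega>. ennreal (exp (0 * (s n * Z n \<omega>))) * indicator {\<omega>. x \<le> - Z n \<omega>} \<omega> \<partial>M n) = (\<integral>\<^sup>+\<omega>. indicator {\<omega> \<in> space (M n). x \<le> - Z n \<omega>} \<omega> \<partial>M n)"
        by (intro nn_integral_cong) (auto split: split_indicator)
      also have "\<dots> = emeasure (M n) {\<omega> \<in> space (M n). x \<le> - Z n \<omega>}" by (intro nn_integral_indicator) measurable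
      finally have 2: "\<P>(\<omega> in M n. x \<le> - Z n \<omega>) \<le> exp (- (\<beta>+\<delta>) * s n)"
        using elim(3) unfolding minus_zero e by (simp add: emeasure_eq_measure)
      have "\<P>(\<omega> in M n. x \<le> \<bar>Z n \<omega>\<bar>) \<le> measure (M n) ({\<omega> \<in> space (M n). x \<le> Z n \<omega>} \<union> {\<omega> \<in> space (M n). x \<le> - Z n \<omega>})"
        by (intro finite_measure_mono) auto
      also have "\<dots> \<le> \<P>(\<omega> in M n. x \<le> Z n \<omega>) + \<P>(\<omega> in M n. x \<le> - Z n \<omega>)"
        by (intro measure_Un_le) auto
      finally show ?case using 1 2 elim(1) by simp
    qed
  next
    fix y \<epsilon> \<beta> :: real
    assume y: "0 < \<epsilon> \<and> 0 < \<beta> \<and> (y = 0 \<or> y\<^sup>2 < 2 * v * \<beta>)"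
    \<comment> \<open>the tilt \<open>\<theta>\<close> moves the centre of the Gaussian to \<open>y\<close>\<close>
    obtain \<theta> where \<theta>: "v * \<theta> = y" "\<theta> * y - v * \<theta>\<^sup>2 / 2 < \<beta>"
    proof (cases "v = 0 \<or> y = 0")
      case True
      then show ?thesis using y by (intro that[of 0]) auto
    next
      case False
      then show ?thesis using y v by (intro that[of "y/v"]) (auto simp: field_simps power2_eq_square)
    qed
    define \<gamma> where "\<gamma> = \<beta> - (\<theta> * y - v * \<theta>\<^sup>2 / 2)"
    define \<eta> where "\<eta> = min (min \<epsilon> 1) (\<gamma> / (2 * (\<bar>\<theta>\<bar> + 1)))"
    have g: "\<gamma> > 0" using \<theta> by (simp add: \<gamma>_def)
    have \<eta>: "0 < \<eta>" "\<eta> \<le> \<epsilon>" "\<eta> \<le> 1" "(\<bar>\<theta>\<bar> + 1) * \<eta> \<le> \<gamma> / 2"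
    proof -
      have "\<eta> \<le> \<gamma> / (2 * (\<bar>\<theta>\<bar> + 1))" by (simp add: \<eta>_def)
      then show "(\<bar>\<theta>\<bar> + 1) * \<eta> \<le> \<gamma> / 2" by (simp add: field_simps)
    qed (use y g in \<open>auto simp: \<eta>_def\<close>)
    \<comment> \<open>a further tilt by \<open>r\<close> costs \<open>v r\<^sup>2 / 2\<close> and gains \<open>r \<eta>\<close>; this \<open>r\<close> leaves a net gain of at least \<open>r \<eta> / 2 = 4 \<delta>\<close>\<close>
    define r where "r = \<eta> / (v + 1)"
    define \<delta> where "\<delta> = r * \<eta> / 8"
    have r: "0 < r" "v * r \<le> \<eta>" "r \<le> 1" using \<eta> v by (auto simp: r_def field_simps)
    have d: "0 < \<delta>" "\<delta> \<le> \<eta> / 8" using \<eta> r by (auto simp: \<delta>_def mult_le_cancel_right2)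
    have vr: "v * r\<^sup>2 / 2 - r * \<eta> \<le> - 4 * \<delta>"
    proof -
      have "v * r * r \<le> \<eta> * r" using r by (intro mult_right_mono) auto
      then show ?thesis unfolding \<delta>_def power2_eq_square by argo
    qed
    have sq: "v * (\<theta> + r)\<^sup>2 / 2 - r * (y + \<eta>) + \<delta> \<le> v * \<theta>\<^sup>2 / 2 - 3 * \<delta>"
         "v * (- \<theta> + r)\<^sup>2 / 2 - r * (- y + \<eta>) + \<delta> \<le> v * \<theta>\<^sup>2 / 2 - 3 * \<delta>"
    proof -
      have "v * (\<theta> + r)\<^sup>2 / 2 - r * (v * \<theta> + \<eta>) + \<delta> = v * \<theta>\<^sup>2 / 2 + (v * r\<^sup>2 / 2 - r * \<eta>) + \<delta>"
        "v * (- \<theta> + r)\<^sup>2 / 2 - r * (- (v * \<theta>) + \<eta>) + \<delta> = v * \<theta>\<^sup>2 / 2 + (v * r\<^sup>2 / 2 - r * \<eta>) + \<delta>"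
        by (simp_all add: power2_eq_square field_simps)
      then show "v * (\<theta> + r)\<^sup>2 / 2 - r * (y + \<eta>) + \<delta> \<le> v * \<theta>\<^sup>2 / 2 - 3 * \<delta>"
         "v * (- \<theta> + r)\<^sup>2 / 2 - r * (- y + \<eta>) + \<delta> \<le> v * \<theta>\<^sup>2 / 2 - 3 * \<delta>"
        using vr unfolding \<theta>(1)[symmetric] by linarith+
    qed
    have "\<forall>\<^sub>F n in sequentially. 4 * exp (- (2 * \<delta>) * s n) \<le> exp (- 0 * s n)"
      by (rule eventually_const_exp_le[OF s]) (simp add: d)
    moreover have "\<forall>\<^sub>F n in sequentially. 2 * exp (- (\<beta>) * s n) \<le> exp (- (\<beta> - \<delta>) * s n)"
      by (rule eventually_const_exp_le[OF s]) (simp add: d)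
    ultimately show "\<forall>\<^sub>F n in sequentially. exp (- \<beta> * s n) \<le> \<P>(\<omega> in M n. \<bar>Z n \<omega> - y\<bar> < \<epsilon>)"
      using spos mgf_ge[OF d(1), of \<theta>] upper[OF d(1) less_imp_le[OF r(1)], of \<theta> "y + \<eta>"]
        lower[OF d(1) less_imp_le[OF r(1)], of \<theta> "- y + \<eta>"] eventually_ge_at_top[of 1]
    proof eventually_elim
      case (elim n)
      interpret prob_space "M n" using p elim by simp
      note m[OF elim(7), measurable]
      define c where "c = exp (s n * (v * \<theta>\<^sup>2 / 2 - \<delta>))"
      define P where "P = \<P>(\<omega> in M n. \<bar>Z n \<omega> - y\<bar> < \<eta>)"
      define b where "b = exp (s n * (\<theta> * y + \<bar>\<theta>\<bar> * \<eta>))"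
      have small: "exp (s n * u) \<le> c / 4" if "u \<le> v * \<theta>\<^sup>2 / 2 - 3 * \<delta>" for u
      proof -
        have "exp (s n * u) \<le> exp (s n * (v * \<theta>\<^sup>2 / 2 - 3 * \<delta>))" using that elim(3) by simp
        also have "\<dots> = c * exp (- (2 * \<delta>) * s n)" by (simp add: c_def exp_add[symmetric] algebra_simps)
        also have "\<dots> \<le> c * (1 / 4)" using elim(1) by (intro mult_left_mono) (auto simp: c_def)
        finally show ?thesis by simp
      qed
      let ?e = "\<lambda>\<omega>. ennreal (exp (\<theta> * (s n * Z n \<omega>)))"
      have "ennreal c \<le> (\<integral>\<^sup>+\<omega>. ?e \<omega> \<partial>M n)" using elim(4) by (simp add: c_def)
      also have "\<dots> \<le> (\<integral>\<^sup>+\<omega>. ennreal b * indicator {\<omega> \<in> space (M n). \<bar>Z n \<omega> - y\<bar> < \<eta>} \<omega>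
          + (?e \<omega> * indicator {\<omega>. y + \<eta> \<le> Z n \<omega>} \<omega> + ?e \<omega> * indicator {\<omega>. - y + \<eta> \<le> - Z n \<omega>} \<omega>) \<partial>M n)"
      proof (intro nn_integral_mono)
        fix \<omega> assume w: "\<omega> \<in> space (M n)"
        consider "\<bar>Z n \<omega> - y\<bar> < \<eta>" | "y + \<eta> \<le> Z n \<omega>" | "- y + \<eta> \<le> - Z n \<omega>" by linarith
        then show "?e \<omega> \<le> ennreal b * indicator {\<omega> \<in> space (M n). \<bar>Z n \<omega> - y\<bar> < \<eta>} \<omega>
          + (?e \<omega> * indicator {\<omega>. y + \<eta> \<le> Z n \<omega>} \<omega> + ?e \<omega> * indicator {\<omega>. - y + \<eta> \<le> - Z n \<omega>} \<omega>)"
        proof cases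
          case 1
          have "\<theta> * (Z n \<omega> - y) \<le> \<bar>\<theta>\<bar> * \<bar>Z n \<omega> - y\<bar>" by (metis abs_ge_self abs_mult)
          also have "\<dots> \<le> \<bar>\<theta>\<bar> * \<eta>" using 1 by (intro mult_left_mono) auto
          finally have "\<theta> * Z n \<omega> \<le> \<theta> * y + \<bar>\<theta>\<bar> * \<eta>" by (simp add: algebra_simps)
          then have "exp (\<theta> * (s n * Z n \<omega>)) \<le> b"
            using mult_left_mono[of "\<theta> * Z n \<omega>" "\<theta> * y + \<bar>\<theta>\<bar> * \<eta>" "s n"] elim(3) by (simp add: b_def mult.left_commute)
          then have "?e \<omega> \<le> ennreal b" by (rule ennreal_leI)
          then show ?thesis using 1 w by (simp add: add_increasing2)
        qed auto
      qed
      also have "\<dots> = ennreal b * emeasure (M n) {\<omega> \<in> space (M n). \<bar>Z n \<omega> - y\<bar> < \<eta>}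
          + ((\<integral>\<^sup>+\<omega>. ?e \<omega> * indicator {\<omega>. y + \<eta> \<le> Z n \<omega>} \<omega> \<partial>M n) + (\<integral>\<^sup>+\<omega>. ?e \<omega> * indicator {\<omega>. - y + \<eta> \<le> - Z n \<omega>} \<omega> \<partial>M n))"
        by (simp add: nn_integral_add nn_integral_cmult)
      also have "\<dots> \<le> ennreal b * ennreal P + (ennreal (c / 4) + ennreal (c / 4))"
        using order_trans[OF elim(5) ennreal_leI[OF small[OF sq(1)]]] order_trans[OF elim(6) ennreal_leI[OF small[OF sq(2)]]]
        by (intro add_mono) (auto simp: emeasure_eq_measure P_def)
      also have "\<dots> = ennreal (b * P + c / 2)"
        by (simp add: ennreal_mult[symmetric] ennreal_plus[symmetric] b_def P_def c_def del: ennreal_plus)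
      finally have "c \<le> b * P + c / 2" by (subst (asm) ennreal_le_iff) (auto simp: b_def P_def c_def)
      then have "c / (2 * b) \<le> P" by (simp add: b_def field_simps)
      moreover have "c / b = exp (s n * (v * \<theta>\<^sup>2 / 2 - \<delta> - (\<theta> * y + \<bar>\<theta>\<bar> * \<eta>)))"
        by (simp add: c_def b_def exp_diff[symmetric] algebra_simps)
      moreover have "exp (- (\<beta> - \<delta>) * s n) \<le> exp (s n * (v * \<theta>\<^sup>2 / 2 - \<delta> - (\<theta> * y + \<bar>\<theta>\<bar> * \<eta>)))"
      proof -
        have "- (\<beta> - \<delta>) \<le> v * \<theta>\<^sup>2 / 2 - \<delta> - (\<theta> * y + \<bar>\<theta>\<bar> * \<eta>)"
          using \<eta>(1,4) d g by (simp add: \<gamma>_def field_simps)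
        from mult_left_mono[OF this, of "s n"] elim(3) show ?thesis by (simp add: mult.commute)
      qed
      moreover have "c / (2 * b) = c / b / 2" by simp
      ultimately have "exp (- \<beta> * s n) \<le> P" using elim(2) by linarith
      also have "P \<le> \<P>(\<omega> in M n. \<bar>Z n \<omega> - y\<bar> < \<epsilon>)"
        unfolding P_def using \<eta>(2) by (intro finite_measure_mono) auto
      finally show ?case .
    qed
  qed
qed

lemma exp_Taylor3: "\<bar>exp x - 1 - x - x\<^sup>2 / 2\<bar> \<le> \<bar>x\<bar>^3 * exp \<bar>x\<bar>" for x :: real
proof -
  obtain t where t: "\<bar>t\<bar> \<le> \<bar>x\<bar>" "exp x = (\<Sum>m<3. x ^ m / fact m) + exp t / fact 3 * x ^ 3"
    using Maclaurin_exp_le[of x 3] by auto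
  have "(\<Sum>m<3. x ^ m / fact m) = 1 + x + x\<^sup>2 / 2"
    by (simp add: numeral_eq_Suc)
  then have "\<bar>exp x - 1 - x - x\<^sup>2 / 2\<bar> = exp t / 6 * \<bar>x\<bar>^3"
    using t(2) by (simp add: abs_mult power_abs fact_numeral)
  also have "\<dots> \<le> exp \<bar>x\<bar> * \<bar>x\<bar>^3"
  proof (rule mult_right_mono)
    have "exp t \<le> exp \<bar>x\<bar>" "0 < exp t" using t(1) by auto
    then show "exp t / 6 \<le> exp \<bar>x\<bar>" by linarith
  qed simp
  finally show ?thesis by (simp add: mult.commute)
qed

lemma power_le_exp: "x ^ k \<le> fact k * exp x" if "x \<ge> 0" for x :: real
proof -
  obtain t where t: "\<bar>t\<bar> \<le> \<bar>x\<bar>" "exp x = (\<Sum>m<Suc k. x ^ m / fact m) + exp t / fact (Suc k) * x ^ Suc k"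
    using Maclaurin_exp_le[of x "Suc k"] by blast
  have "x ^ k / fact k \<le> (\<Sum>m<Suc k. x ^ m / fact m)"
    using that by (intro member_le_sum) auto
  also have "\<dots> \<le> exp x" unfolding t(2) using that by simp
  finally show ?thesis by (simp add: field_simps)
qed

text \<open>The second-order expansion of a moment generating function at 0, in a multiplicative form that
  is preserved when independent summands are combined.\<close>

lemma mgf_near_zero:
  fixes \<xi> :: "'a \<Rightarrow> real"
  assumes P: "prob_space P" and m[measurable]: "\<xi> \<in> borel_measurable P"
    and a: "a > 0" and int: "integrable P (\<lambda>\<omega>. exp (a * \<bar>\<xi> \<omega>\<bar>))"
    and mean: "(\<integral>\<omega>. \<xi> \<omega> \<partial>P) = 0" and var: "(\<integral>\<omega>. (\<xi> \<omega>)\<^sup>2 \<partial>P) = v" and d: "\<delta> > 0"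
  obtains b where "b > 0" and
    "\<And>s. \<bar>s\<bar> \<le> b \<Longrightarrow> (\<integral>\<^sup>+\<omega>. ennreal (exp (s * \<xi> \<omega>)) \<partial>P) \<le> ennreal (exp (s\<^sup>2 * (v / 2 + \<delta>)))" and
    "\<And>s. \<bar>s\<bar> \<le> b \<Longrightarrow> ennreal (exp (s\<^sup>2 * (v / 2 - \<delta>))) \<le> (\<integral>\<^sup>+\<omega>. ennreal (exp (s * \<xi> \<omega>)) \<partial>P)"
proof -
  interpret prob_space P by fact
  have pw: "\<bar>x\<bar> ^ k \<le> fact k / (a/2) ^ k * exp (a / 2 * \<bar>x\<bar>)" for k and x :: real
    using power_le_exp[of "a/2 * \<bar>x\<bar>" k] a by (simp add: power_mult_distrib field_simps)
  have pw': "\<bar>x\<bar> ^ k \<le> fact k / (a/2) ^ k * exp (a * \<bar>x\<bar>)" for k and x :: real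
  proof -
    have "a / 2 * \<bar>x\<bar> \<le> a * \<bar>x\<bar>" using a by (intro mult_right_mono) auto
    then show ?thesis using a by (intro order_trans[OF pw] mult_left_mono) auto
  qed
  have ipow: "integrable P (\<lambda>\<omega>. \<bar>\<xi> \<omega>\<bar> ^ k)" for k
    by (rule Bochner_Integration.integrable_bound[OF integrable_mult_right[OF int, of "fact k / (a/2) ^ k"]])
       (use a pw' in \<open>auto simp: abs_mult\<close>)
  have i1: "integrable P \<xi>" using ipow[of 1] by (simp add: integrable_abs_iff)
  have i2: "integrable P (\<lambda>\<omega>. (\<xi> \<omega>)\<^sup>2)" using ipow[of 2] by simp
  define C where "C = 6 / (a/2)^3 * (\<integral>\<omega>. exp (a * \<bar>\<xi> \<omega>\<bar>) \<partial>P)"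
  have v: "v \<ge> 0" unfolding var[symmetric] by simp
  have C: "C \<ge> 0" using a by (auto simp: C_def)
  have iexp: "integrable P (\<lambda>\<omega>. exp (s * \<xi> \<omega>))" if "\<bar>s\<bar> \<le> a" for s
  proof (rule Bochner_Integration.integrable_bound[OF int])
    show "AE \<omega> in P. norm (exp (s * \<xi> \<omega>)) \<le> norm (exp (a * \<bar>\<xi> \<omega>\<bar>))"
    proof (intro AE_I2)
      fix \<omega>
      have "s * \<xi> \<omega> \<le> \<bar>s\<bar> * \<bar>\<xi> \<omega>\<bar>" by (metis abs_ge_self abs_mult)
      also have "\<dots> \<le> a * \<bar>\<xi> \<omega>\<bar>" using that by (intro mult_right_mono) auto
      finally show "norm (exp (s * \<xi> \<omega>)) \<le> norm (exp (a * \<bar>\<xi> \<omega>\<bar>))" by simp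
    qed
  qed measurable
  have main: "\<bar>(\<integral>\<omega>. exp (s * \<xi> \<omega>) \<partial>P) - 1 - s\<^sup>2 * v / 2\<bar> \<le> C * \<bar>s\<bar>^3" if s: "\<bar>s\<bar> \<le> a / 2" for s
  proof -
    have ie: "integrable P (\<lambda>\<omega>. exp (s * \<xi> \<omega>))" using s by (intro iexp) (use a in auto)
    have "(\<integral>\<omega>. exp (s * \<xi> \<omega>) - 1 - s * \<xi> \<omega> - s\<^sup>2 * (\<xi> \<omega>)\<^sup>2 / 2 \<partial>P) = (\<integral>\<omega>. exp (s * \<xi> \<omega>) \<partial>P) - 1 - s * 0 - s\<^sup>2 * v / 2"
      using ie i1 i2 by (simp add: mean var prob_space)
    then have "\<bar>(\<integral>\<omega>. exp (s * \<xi> \<omega>) \<partial>P) - 1 - s\<^sup>2 * v / 2\<bar> = \<bar>\<integral>\<omega>. exp (s * \<xi> \<omega>) - 1 - s * \<xi> \<omega> - s\<^sup>2 * (\<xi> \<omega>)\<^sup>2 / 2 \<partial>P\<bar>"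
      by simp
    also have "\<dots> \<le> (\<integral>\<omega>. \<bar>exp (s * \<xi> \<omega>) - 1 - s * \<xi> \<omega> - s\<^sup>2 * (\<xi> \<omega>)\<^sup>2 / 2\<bar> \<partial>P)" by (rule integral_abs_bound)
    also have "\<dots> \<le> (\<integral>\<omega>. \<bar>s\<bar>^3 * (6 / (a/2)^3) * exp (a * \<bar>\<xi> \<omega>\<bar>) \<partial>P)"
    proof (rule integral_mono)
      show "integrable P (\<lambda>\<omega>. \<bar>exp (s * \<xi> \<omega>) - 1 - s * \<xi> \<omega> - s\<^sup>2 * (\<xi> \<omega>)\<^sup>2 / 2\<bar>)" using ie i1 i2 by auto
      show "integrable P (\<lambda>\<omega>. \<bar>s\<bar>^3 * (6 / (a/2)^3) * exp (a * \<bar>\<xi> \<omega>\<bar>))" using int by simp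
      fix \<omega>
      have "\<bar>exp (s * \<xi> \<omega>) - 1 - s * \<xi> \<omega> - s\<^sup>2 * (\<xi> \<omega>)\<^sup>2 / 2\<bar> \<le> \<bar>s * \<xi> \<omega>\<bar>^3 * exp \<bar>s * \<xi> \<omega>\<bar>"
        using exp_Taylor3[of "s * \<xi> \<omega>"] by (simp add: power_mult_distrib)
      also have "\<dots> \<le> \<bar>s\<bar>^3 * \<bar>\<xi> \<omega>\<bar>^3 * exp (a / 2 * \<bar>\<xi> \<omega>\<bar>)"
      proof -
        have "\<bar>s * \<xi> \<omega>\<bar> \<le> a / 2 * \<bar>\<xi> \<omega>\<bar>" unfolding abs_mult using s by (intro mult_right_mono) auto
        then show ?thesis by (auto simp: abs_mult power_mult_distrib intro!: mult_left_mono)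
      qed
      also have "\<dots> \<le> \<bar>s\<bar>^3 * (6 / (a/2)^3 * exp (a / 2 * \<bar>\<xi> \<omega>\<bar>)) * exp (a / 2 * \<bar>\<xi> \<omega>\<bar>)"
        using pw[of "\<xi> \<omega>" 3] by (intro mult_right_mono mult_left_mono) (auto simp: fact_numeral)
      also have "\<dots> = \<bar>s\<bar>^3 * (6 / (a/2)^3) * exp (a * \<bar>\<xi> \<omega>\<bar>)"
        by (simp add: mult.assoc exp_add[symmetric])
      finally show "\<bar>exp (s * \<xi> \<omega>) - 1 - s * \<xi> \<omega> - s\<^sup>2 * (\<xi> \<omega>)\<^sup>2 / 2\<bar> \<le> \<bar>s\<bar>^3 * (6 / (a/2)^3) * exp (a * \<bar>\<xi> \<omega>\<bar>)" .
    qed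
    also have "\<dots> = C * \<bar>s\<bar>^3" by (simp add: C_def)
    finally show ?thesis .
  qed
  \<comment> \<open>\<open>b\<close> is small enough for the cubic error and the second-order error of \<open>exp\<close> to be absorbed by \<open>\<delta> s\<^sup>2\<close>\<close>
  define w where "w = v / 2 + \<delta>"
  \<comment> \<open>the last bound keeps \<open>\<bar>y\<bar> \<le> 1\<close> for the exponent \<open>y\<close> of the lower bound, where \<open>exp y \<le> 1 + y + y\<^sup>2\<close>\<close>
  define b where "b = min (min (a/2) 1) (min (\<delta> / (C + w\<^sup>2 + 1)) (1 / (w + 1)))"
  have w: "w > 0" using v d by (simp add: w_def)
  have b: "b > 0" "b \<le> a / 2" "b \<le> 1" "b * (C + w\<^sup>2) \<le> \<delta>" "b * w \<le> 1"
  proof -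
    have pos: "C + w\<^sup>2 + 1 > 0" using C by (simp add: add_nonneg_pos)
    show "b > 0" unfolding b_def using a d w pos by auto
    show "b \<le> a / 2" "b \<le> 1" unfolding b_def by linarith+
    have "b \<le> \<delta> / (C + w\<^sup>2 + 1)" by (simp add: b_def)
    then have "b * (C + w\<^sup>2 + 1) \<le> \<delta>" using pos by (simp add: pos_le_divide_eq)
    then show "b * (C + w\<^sup>2) \<le> \<delta>" using \<open>b > 0\<close> by (simp add: algebra_simps)
    have "b \<le> 1 / (w + 1)" by (simp add: b_def)
    then have "b * (w + 1) \<le> 1" using w by (simp add: pos_le_divide_eq)
    then show "b * w \<le> 1" using \<open>b > 0\<close> by (simp add: algebra_simps)
  qed
  have nn: "(\<integral>\<^sup>+\<omega>. ennreal (exp (s * \<xi> \<omega>)) \<partial>P) = ennreal (\<integral>\<omega>. exp (s * \<xi> \<omega>) \<partial>P)" if "\<bar>s\<bar> \<le> b" for s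
    using that b a by (intro nn_integral_eq_integral iexp) auto
  show ?thesis
  proof (rule that[OF b(1)])
    fix s assume s: "\<bar>s\<bar> \<le> b"
    have s3: "\<bar>s\<bar>^3 * C \<le> s\<^sup>2 * (b * C)"
    proof -
      have "\<bar>s\<bar>^3 * C = s\<^sup>2 * (\<bar>s\<bar> * C)" by (simp add: power3_eq_cube power2_eq_square)
      also have "\<dots> \<le> s\<^sup>2 * (b * C)" using s C by (intro mult_left_mono mult_right_mono) auto
      finally show ?thesis .
    qed
    have bC: "s\<^sup>2 * (b * C) \<le> s\<^sup>2 * \<delta>"
    proof (rule mult_left_mono)
      have "0 \<le> b * w\<^sup>2" using b(1) by simp
      then show "b * C \<le> \<delta>" using b(4) by (simp add: distrib_left)
    qed simp
    have "(\<integral>\<omega>. exp (s * \<xi> \<omega>) \<partial>P) \<le> 1 + s\<^sup>2 * v / 2 + C * \<bar>s\<bar>^3"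
      using main[of s] s b(2) by linarith
    also have "\<dots> \<le> 1 + s\<^sup>2 * (v / 2 + \<delta>)" using s3 bC by (simp add: algebra_simps)
    also have "\<dots> \<le> exp (s\<^sup>2 * (v / 2 + \<delta>))" by (rule exp_ge_add_one_self)
    finally show "(\<integral>\<^sup>+\<omega>. ennreal (exp (s * \<xi> \<omega>)) \<partial>P) \<le> ennreal (exp (s\<^sup>2 * (v / 2 + \<delta>)))"
      unfolding nn[OF s] by (rule ennreal_leI)
    define y where "y = s\<^sup>2 * (v / 2 - \<delta>)"
    have s2: "s\<^sup>2 \<le> b"
    proof -
      have "s\<^sup>2 = \<bar>s\<bar> * \<bar>s\<bar>" by (simp add: power2_eq_square)
      also have "\<dots> \<le> b * 1" using s b by (intro mult_mono) auto
      finally show ?thesis by simp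
    qed
    have yw: "\<bar>y\<bar> \<le> s\<^sup>2 * w" unfolding y_def abs_mult using v d by (intro mult_mono) (auto simp: w_def)
    also have "\<dots> \<le> b * w" using s2 w by (intro mult_right_mono) auto
    finally have y1: "\<bar>y\<bar> \<le> 1" using b(5) by simp
    have "y\<^sup>2 \<le> (s\<^sup>2 * w)\<^sup>2" using yw by (metis abs_ge_zero power2_abs power_mono)
    also have "\<dots> = s\<^sup>2 * (s\<^sup>2 * w\<^sup>2)" by (simp add: power2_eq_square)
    also have "\<dots> \<le> s\<^sup>2 * (b * w\<^sup>2)" using s2 by (intro mult_left_mono mult_right_mono) auto
    finally have y2: "y\<^sup>2 \<le> s\<^sup>2 * (b * w\<^sup>2)" .
    have "exp y \<le> 1 + y + y\<^sup>2"
    proof (cases "y \<ge> 0")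
      case True then show ?thesis using exp_bound[of y] y1 by simp
    next
      case False
      have "exp y * (1 - y) \<le> exp y * exp (- y)" by (intro mult_left_mono) (use exp_ge_add_one_self[of "- y"] in auto)
      then have "exp y \<le> 1 / (1 - y)" using False by (simp add: exp_minus field_simps)
      also have "\<dots> \<le> 1 + y + y\<^sup>2"
      proof -
        have "(1 - y) * (1 + y + y\<^sup>2) = 1 - y ^ 3" by (simp add: power2_eq_square power3_eq_cube algebra_simps)
        moreover have "y ^ 3 \<le> 0" using False by (simp add: power_le_zero_eq)
        ultimately show ?thesis using False by (simp add: divide_le_eq mult.commute)
      qed
      finally show ?thesis .
    qed
    also have "\<dots> \<le> 1 + s\<^sup>2 * v / 2 - C * \<bar>s\<bar>^3"
    proof -
      have "s\<^sup>2 * (b * (C + w\<^sup>2)) \<le> s\<^sup>2 * \<delta>" using b(4) by (intro mult_left_mono) auto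
      then have "s\<^sup>2 * (b * C) + s\<^sup>2 * (b * w\<^sup>2) \<le> s\<^sup>2 * \<delta>" by (simp add: distrib_left)
      then have "y\<^sup>2 + C * \<bar>s\<bar>^3 \<le> s\<^sup>2 * \<delta>" using y2 s3 by (simp add: mult.commute)
      then show ?thesis by (simp add: y_def algebra_simps)
    qed
    also have "\<dots> \<le> (\<integral>\<omega>. exp (s * \<xi> \<omega>) \<partial>P)"
      using main[of s] s b(2) by linarith
    finally show "ennreal (exp (s\<^sup>2 * (v / 2 - \<delta>))) \<le> (\<integral>\<^sup>+\<omega>. ennreal (exp (s * \<xi> \<omega>)) \<partial>P)"
      unfolding nn[OF s] y_def by (rule ennreal_leI)
  qed
qed

section \<open>The generalized Gaussian distribution\<close>

text \<open>The substitution \<open>u = c y powr p\<close> turns this into Euler's integral for the Gamma function.\<close>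

lemma nn_integral_powr_exp_pos:
  fixes p c r :: real
  assumes p: "p > 0" and c: "c > 0" and r: "r > -1"
  shows "(\<integral>\<^sup>+y. ennreal (y powr r * exp (- c * y powr p)) * indicator {0<..} y \<partial>lborel)
    = ennreal (c powr (- ((r + 1) / p)) * Gamma ((r + 1) / p) / p)"
proof -
  define q where "q = (r + 1) / p"
  have q: "q > 0" using p r by (simp add: q_def)
  define f where "f = (\<lambda>t::real. t powr (q - 1) / exp t)"
  define g where "g = (\<lambda>y::real. c * y powr p)"
  define g' where "g' = (\<lambda>y::real. c * p * y powr (p - 1))"
  have f: "(f has_integral Gamma q) {0<..}"
    using Gamma_integral_real[OF q] unfolding f_def
    by (rule iffD1[OF has_integral_spike_set_eq, rotated 2]) (auto intro: negligible_subset[of "{0}"])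
  have f_abs: "f absolutely_integrable_on {0<..}"
    using f by (intro nonnegative_absolutely_integrable_1) (auto simp: f_def)
  have "g ` {0<..} = {0<..}"
  proof
    show "g ` {0<..} \<subseteq> {0<..}" using c by (auto simp: g_def)
    show "{0<..} \<subseteq> g ` {0<..}"
    proof
      fix t :: real assume "t \<in> {0<..}"
      then have "t = g ((t / c) powr (1 / p))" "(t / c) powr (1 / p) \<in> {0<..}"
        using c p by (auto simp: g_def powr_powr)
      then show "t \<in> g ` {0<..}" by blast
    qed
  qed
  moreover have "inj_on g {0<..}"
  proof (rule inj_onI)
    fix x y assume "x \<in> {0<..}" "y \<in> {0<..}" "g x = g y"
    then have "(x powr p) powr (1 / p) = (y powr p) powr (1 / p)" "0 < x" "0 < y" using c by (auto simp: g_def)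
    then show "x = y" using p by (simp add: powr_powr)
  qed
  moreover have "(g has_field_derivative g' y) (at y within {0<..})" if "y \<in> {0<..}" for y
    using that unfolding g_def g'_def by (auto intro!: derivative_eq_intros)
  ultimately have abs: "(\<lambda>y. \<bar>g' y\<bar> * f (g y)) absolutely_integrable_on {0<..}"
    and int: "integral {0<..} (\<lambda>y. \<bar>g' y\<bar> * f (g y)) = Gamma q"
    using has_absolute_integral_change_of_variables_1'[of "{0<..}" g g' f "Gamma q"] f_abs integral_unique[OF f]
    by auto
  have eq: "\<bar>g' y\<bar> * f (g y) = p * c powr q * (y powr r * exp (- c * y powr p))" if "y > 0" for y
  proof -
    have "p - 1 + p * (q - 1) = r" using p by (simp add: q_def field_simps)
    then have "y powr (p - 1) * (y powr p) powr (q - 1) = y powr r"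
      by (simp add: powr_powr powr_add[symmetric])
    moreover have "c * c powr (q - 1) = c powr q" using c by (simp add: powr_diff)
    moreover have "(c * y powr p) powr (q - 1) = c powr (q - 1) * (y powr p) powr (q - 1)"
      using c by (simp add: powr_mult)
    moreover have "\<bar>g' y\<bar> * f (g y) = p * (c * (c * y powr p) powr (q - 1)) * y powr (p - 1) * exp (- c * y powr p)"
      using c p by (simp add: g'_def f_def g_def abs_mult exp_minus field_simps)
    ultimately show ?thesis by (simp add: mult_ac)
  qed
  have "((\<lambda>y. p * c powr q * (y powr r * exp (- c * y powr p))) has_integral Gamma q) {0<..}"
    using abs int eq
    by (intro has_integral_eq[OF _ integrable_integral[OF set_lebesgue_integral_eq_integral(1)[OF abs], unfolded int]]) auto
  then have "((\<lambda>y. (y powr r * exp (- c * y powr p))) has_integral (Gamma q / (p * c powr q))) {0<..}"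
    using p c by (auto dest: has_integral_divide[of _ _ _ "p * c powr q"])
  then have "((\<lambda>y. if y \<in> {0<..} then (y powr r * exp (- c * y powr p)) else 0) has_integral (Gamma q / (p * c powr q))) UNIV"
    by (simp only: has_integral_restrict_UNIV)
  then have "(\<integral>\<^sup>+y. ennreal (if y \<in> {0<..} then (y powr r * exp (- c * y powr p)) else 0) \<partial>lborel) = ennreal (Gamma q / (p * c powr q))"
    by (intro nn_integral_has_integral_lborel) auto
  moreover have "Gamma q / (p * c powr q) = c powr (- q) * Gamma q / p"
    by (simp add: powr_minus field_simps)
  moreover have "ennreal (if y \<in> {0<..} then (y powr r * exp (- c * y powr p)) else 0) = ennreal (y powr r * exp (- c * y powr p)) * indicator {0<..} y" for y
    by auto
  ultimately show ?thesis by (simp add: q_def)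
qed

lemma nn_integral_abs_powr_exp:
  fixes p c r :: real
  assumes p: "p > 0" and c: "c > 0" and r: "r > -1"
  shows "(\<integral>\<^sup>+y. ennreal (\<bar>y\<bar> powr r * exp (- c * \<bar>y\<bar> powr p)) \<partial>lborel)
    = ennreal (2 * c powr (- ((r + 1) / p)) * Gamma ((r + 1) / p) / p)"
proof -
  let ?f = "\<lambda>y::real. ennreal (\<bar>y\<bar> powr r * exp (- c * \<bar>y\<bar> powr p))"
  let ?I = "c powr (- ((r + 1) / p)) * Gamma ((r + 1) / p) / p"
  have pos: "(\<integral>\<^sup>+y. ?f y * indicator {0<..} y \<partial>lborel) = ennreal ?I"
    unfolding nn_integral_powr_exp_pos[OF assms, symmetric]
    by (intro nn_integral_cong) (auto split: split_indicator)
  have "(\<integral>\<^sup>+y. ?f y * indicator {..<0} y \<partial>lborel) = (\<integral>\<^sup>+y. ?f (0 + (-1) * y) * indicator {..<0} (0 + (-1) * y) \<partial>lborel)"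
    by (subst nn_integral_real_affine[of _ "-1" 0]) auto
  also have "\<dots> = (\<integral>\<^sup>+y. ?f y * indicator {0<..} y \<partial>lborel)"
    by (intro nn_integral_cong) (auto split: split_indicator)
  finally have neg: "(\<integral>\<^sup>+y. ?f y * indicator {..<0} y \<partial>lborel) = ennreal ?I" using pos by simp
  have "(\<integral>\<^sup>+y. ?f y \<partial>lborel) = (\<integral>\<^sup>+y. ?f y * indicator {0<..} y + ?f y * indicator {..<0} y \<partial>lborel)"
  proof (rule nn_integral_cong_AE)
    have "AE y in lborel. y \<noteq> (0::real)" by (rule AE_lborel_singleton)
    then show "AE y in lborel. ?f y = ?f y * indicator {0<..} y + ?f y * indicator {..<0} y"
      by eventually_elim (auto split: split_indicator)
  qed
  also have "\<dots> = ennreal ?I + ennreal ?I" by (subst nn_integral_add) (simp_all only: pos neg, auto)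
  also have "\<dots> = ennreal (2 * ?I)"
    using p c r by (subst ennreal_plus[symmetric]) (auto intro!: Gamma_real_nonneg divide_nonneg_pos)
  finally show ?thesis by (simp add: mult.assoc)
qed

text \<open>The density \<open>exp (- \<bar>y\<bar> powr p / p)\<close>, normalized; for \<open>p = 2\<close> the standard Gaussian density.\<close>

definition gen_gauss_density :: "real \<Rightarrow> real \<Rightarrow> real" where
  "gen_gauss_density p y = exp (- (1 / p) * \<bar>y\<bar> powr p) / (2 * p powr (1 / p) * Gamma (1 + 1 / p))"

definition gen_gauss :: "real \<Rightarrow> real measure" where
  "gen_gauss p = density lborel (\<lambda>y. ennreal (gen_gauss_density p y))"

lemma gen_gauss_density_pos: "p > 0 \<Longrightarrow> gen_gauss_density p y > 0"
  by (auto simp: gen_gauss_density_def intro!: divide_pos_pos mult_pos_pos Gamma_real_pos add_pos_pos)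

lemma measurable_gen_gauss_density [measurable]: "gen_gauss_density p \<in> borel_measurable borel"
  unfolding gen_gauss_density_def by measurable

lemma sets_gen_gauss [measurable_cong, simp]: "sets (gen_gauss p) = sets borel"
  by (simp add: gen_gauss_def)

lemma space_gen_gauss [simp]: "space (gen_gauss p) = UNIV"
  by (simp add: gen_gauss_def)

lemma AE_gen_gauss_nonzero: "AE y in gen_gauss p. y \<noteq> 0"
proof -
  have "AE y in lborel. y \<noteq> (0::real)" by (rule AE_lborel_singleton)
  then have "AE y in lborel. 0 < ennreal (gen_gauss_density p y) \<longrightarrow> y \<noteq> 0" by eventually_elim simp
  then show ?thesis unfolding gen_gauss_def by (subst AE_density) auto
qed

text \<open>The tilt \<open>a\<close> gives the exponential moments; the case \<open>a = 0\<close> gives the moments.\<close>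

lemma nn_integral_gen_gauss_tilted:
  assumes p: "p > 0" and a: "a < 1 / p" and r: "r > -1"
  shows "(\<integral>\<^sup>+y. ennreal (\<bar>y\<bar> powr r * exp (a * \<bar>y\<bar> powr p)) \<partial>gen_gauss p)
    = ennreal ((1 / p - a) powr (- ((r + 1) / p)) * Gamma ((r + 1) / p) / (p powr (1 / p) * Gamma (1 / p)))"
proof -
  let ?Z = "2 * p powr (1 / p) * Gamma (1 + 1 / p)"
  have Z: "?Z = 2 * p powr (1 / p) * Gamma (1 / p) / p"
  proof -
    have "1 / p \<notin> \<int>\<^sub>\<le>\<^sub>0" 
    proof
      assume "1 / p \<in> \<int>\<^sub>\<le>\<^sub>0"
      then have "1 / p \<le> 0" by (rule nonpos_Ints_nonpos)
      then show False using p by simp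
    qed
    from Gamma_plus1[OF this] show ?thesis by (simp add: add.commute)
  qed
  have Zpos: "?Z > 0" using p by (auto intro!: mult_pos_pos Gamma_real_pos add_pos_pos)
  have "(\<integral>\<^sup>+y. ennreal (\<bar>y\<bar> powr r * exp (a * \<bar>y\<bar> powr p)) \<partial>gen_gauss p)
      = (\<integral>\<^sup>+y. ennreal (gen_gauss_density p y) * ennreal (\<bar>y\<bar> powr r * exp (a * \<bar>y\<bar> powr p)) \<partial>lborel)"
    unfolding gen_gauss_def by (intro nn_integral_density) auto
  also have "\<dots> = (\<integral>\<^sup>+y. ennreal (1 / ?Z) * ennreal (\<bar>y\<bar> powr r * exp (- (1 / p - a) * \<bar>y\<bar> powr p)) \<partial>lborel)"
  proof (intro nn_integral_cong)
    fix y :: real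
    have "gen_gauss_density p y * (\<bar>y\<bar> powr r * exp (a * \<bar>y\<bar> powr p)) = 1 / ?Z * (\<bar>y\<bar> powr r * exp (- (1 / p - a) * \<bar>y\<bar> powr p))"
      by (simp add: gen_gauss_density_def left_diff_distrib mult_exp_exp)
    then show "ennreal (gen_gauss_density p y) * ennreal (\<bar>y\<bar> powr r * exp (a * \<bar>y\<bar> powr p))
       = ennreal (1 / ?Z) * ennreal (\<bar>y\<bar> powr r * exp (- (1 / p - a) * \<bar>y\<bar> powr p))"
      using gen_gauss_density_pos[OF p, of y] Zpos
      by (subst (1 2) ennreal_mult[symmetric]) (auto simp: less_imp_le)
  qed
  also have "\<dots> = ennreal (1 / ?Z) * (\<integral>\<^sup>+y. ennreal (\<bar>y\<bar> powr r * exp (- (1 / p - a) * \<bar>y\<bar> powr p)) \<partial>lborel)"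
    by (intro nn_integral_cmult) auto
  also have "\<dots> = ennreal (1 / ?Z) * ennreal (2 * (1 / p - a) powr (- ((r + 1) / p)) * Gamma ((r + 1) / p) / p)"
    using a p r by (subst nn_integral_abs_powr_exp) auto
  also have "\<dots> = ennreal (1 / ?Z * (2 * (1 / p - a) powr (- ((r + 1) / p)) * Gamma ((r + 1) / p) / p))"
    using Zpos p r by (intro ennreal_mult[symmetric]) (auto intro!: divide_nonneg_pos mult_nonneg_nonneg Gamma_real_nonneg)
  also have "1 / ?Z * (2 * (1 / p - a) powr (- ((r + 1) / p)) * Gamma ((r + 1) / p) / p)
    = (1 / p - a) powr (- ((r + 1) / p)) * Gamma ((r + 1) / p) / (p powr (1 / p) * Gamma (1 / p))"
    unfolding Z using p by (simp add: field_simps)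
  finally show ?thesis .
qed

lemma prob_space_gen_gauss: assumes "p > 0" shows "prob_space (gen_gauss p)"
proof
  have "emeasure (gen_gauss p) (space (gen_gauss p)) = (\<integral>\<^sup>+y. 1 \<partial>gen_gauss p)" by simp
  \<comment> \<open>\<open>\<bar>y\<bar> powr 0\<close> is 0 instead of 1 at \<open>y = 0\<close>, hence equality almost everywhere only\<close>
  also have "\<dots> = (\<integral>\<^sup>+y. ennreal (\<bar>y\<bar> powr 0 * exp (0 * \<bar>y\<bar> powr p)) \<partial>gen_gauss p)"
    by (rule nn_integral_cong_AE, rule eventually_mono[OF AE_gen_gauss_nonzero]) auto
  also have "\<dots> = ennreal ((1 / p) powr (- (1 / p)) / p powr (1 / p))"
  proof -
    have "Gamma (1 / p) > 0" using assms by (intro Gamma_real_pos) auto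
    then have "Gamma (1 / p) \<noteq> 0" by simp
    then show ?thesis by (subst nn_integral_gen_gauss_tilted) (use assms in simp_all)
  qed
  also have "(1 / p) powr (- (1 / p)) / p powr (1 / p) = 1"
    using assms by (simp add: powr_minus_divide powr_divide)
  finally show "emeasure (gen_gauss p) (space (gen_gauss p)) = 1" by simp
qed

lemma gen_gauss_moment:
  assumes p: "p > 0" and r: "r > -1"
  shows "has_bochner_integral (gen_gauss p) (\<lambda>y. \<bar>y\<bar> powr r) (p powr (r / p) * Gamma ((r + 1) / p) / Gamma (1 / p))"
proof (rule has_bochner_integral_nn_integral)
  have "(1 / p) powr (- ((r + 1) / p)) / p powr (1 / p) = p powr (r / p)"
  proof -
    have "(1 / p) powr (- ((r + 1) / p)) = p powr ((r + 1) / p)" using p by (simp add: powr_minus_divide powr_divide)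
    then show ?thesis using p by (simp add: powr_diff[symmetric] diff_divide_distrib[symmetric])
  qed
  then have "(1 / p - 0) powr (- ((r + 1) / p)) * Gamma ((r + 1) / p) / (p powr (1 / p) * Gamma (1 / p)) = p powr (r / p) * Gamma ((r + 1) / p) / Gamma (1 / p)"
    by (simp flip: times_divide_eq_left divide_divide_eq_left)
  then show "(\<integral>\<^sup>+y. ennreal (\<bar>y\<bar> powr r) \<partial>gen_gauss p) = ennreal (p powr (r / p) * Gamma ((r + 1) / p) / Gamma (1 / p))"
    using nn_integral_gen_gauss_tilted[OF p, of 0 r] p r by simp
qed (use p r in \<open>auto intro!: divide_nonneg_pos mult_nonneg_nonneg Gamma_real_nonneg Gamma_real_pos\<close>)

lemma gen_gauss_exp_integrable:
  assumes p: "p > 0" and a: "a < 1 / p"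
  shows "integrable (gen_gauss p) (\<lambda>y. exp (a * \<bar>y\<bar> powr p))"
proof (rule integrableI_bounded)
  have "(\<integral>\<^sup>+y. ennreal (norm (exp (a * \<bar>y\<bar> powr p))) \<partial>gen_gauss p) = (\<integral>\<^sup>+y. ennreal (\<bar>y\<bar> powr 0 * exp (a * \<bar>y\<bar> powr p)) \<partial>gen_gauss p)"
    by (rule nn_integral_cong_AE, rule eventually_mono[OF AE_gen_gauss_nonzero]) auto
  then show "(\<integral>\<^sup>+y. ennreal (norm (exp (a * \<bar>y\<bar> powr p))) \<partial>gen_gauss p) < \<infinity>"
    using nn_integral_gen_gauss_tilted[OF p a, of 0] by simp
qed measurable

text \<open>The second moment of the distribution.\<close>

definition gen_gauss_var :: "real \<Rightarrow> real" where
  "gen_gauss_var p = p powr (2 / p) * Gamma (3 / p) / Gamma (1 / p)"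

text \<open>The fourth moment divided by the square of the second.\<close>

definition gamma_ratio :: "real \<Rightarrow> real" where
  "gamma_ratio p = Gamma (1 / p) * Gamma (5 / p) / (Gamma (3 / p))\<^sup>2"

text \<open>The centred statistics of one coordinate that enter the linearization. For \<open>p = 2\<close> and \<open>b = 1\<close>,
  \<open>a = 0\<close> this is \<open>y\<^sup>2 - 1\<close>, so that the coordinates of the Gaussian vector are covered as well.\<close>

definition cstat :: "real \<Rightarrow> real \<Rightarrow> real \<Rightarrow> real \<Rightarrow> real" where
  "cstat p a b y = a * (y\<^sup>2 / gen_gauss_var p - 1) + b * (\<bar>y\<bar> powr p - 1)"

lemma measurable_cstat [measurable]: "cstat p a b \<in> borel_measurable borel"
  unfolding cstat_def by measurable

lemma gen_gauss_var_pos: "p > 0 \<Longrightarrow> gen_gauss_var p > 0"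
  by (auto simp: gen_gauss_var_def intro!: divide_pos_pos mult_pos_pos Gamma_real_pos)

lemma Gamma_real_Suc: "x > 0 \<Longrightarrow> Gamma (x + 1) = x * Gamma (x::real)"
proof (rule Gamma_plus1)
  assume "x > 0"
  then show "x \<notin> \<int>\<^sub>\<le>\<^sub>0" using nonpos_Ints_nonpos[of x] by auto
qed

text \<open>By \<open>\<Gamma> (x + 1) = x \<Gamma> (x)\<close> the moments that involve \<open>\<bar>y\<bar> powr p\<close> simplify: its mean is 1, its
  second moment is \<open>p + 1\<close>, and its covariance with the normalized square is 2.\<close>

lemma cstat_moments:
  assumes p: "p > 0"
  shows "integrable (gen_gauss p) (cstat p a b)"
    and "(\<integral>y. cstat p a b y \<partial>gen_gauss p) = 0"
    and "(\<integral>y. (cstat p a b y)\<^sup>2 \<partial>gen_gauss p) = a\<^sup>2 * (gamma_ratio p - 1) + 4 * a * b + b\<^sup>2 * p"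
proof -
  interpret prob_space "gen_gauss p" by (rule prob_space_gen_gauss[OF p])
  let ?v = "gen_gauss_var p"
  have v: "?v > 0" by (rule gen_gauss_var_pos[OF p])
  have "Gamma (1 / p) > 0" "Gamma (3 / p) > 0" using p by (auto intro!: Gamma_real_pos)
  then have G: "Gamma (1 / p) \<noteq> 0" "Gamma (3 / p) \<noteq> 0" by auto
  note mom = gen_gauss_moment[OF p]
  have sq: "\<bar>y\<bar> powr 2 = y\<^sup>2" for y :: real by (cases "y = 0") auto
  have m2: "has_bochner_integral (gen_gauss p) (\<lambda>y. y\<^sup>2) ?v"
    using mom[of 2] by (simp add: sq gen_gauss_var_def)
  have m4: "has_bochner_integral (gen_gauss p) (\<lambda>y. y ^ 4) (?v\<^sup>2 * gamma_ratio p)"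
  proof -
    have "\<bar>y\<bar> powr 4 = y ^ 4" for y :: real by (cases "y = 0") auto
    moreover have "p powr (4 / p) = (p powr (2 / p))\<^sup>2" using p by (simp add: power2_eq_square powr_add[symmetric])
    then have "p powr (4 / p) * Gamma (5 / p) / Gamma (1 / p) = ?v\<^sup>2 * gamma_ratio p"
      using G by (simp add: gen_gauss_var_def gamma_ratio_def field_simps power2_eq_square)
    ultimately show ?thesis using mom[of 4] by simp
  qed
  have mp: "has_bochner_integral (gen_gauss p) (\<lambda>y. \<bar>y\<bar> powr p) 1"
  proof -
    have "Gamma ((p + 1) / p) = Gamma (1 / p) / p" using Gamma_real_Suc[of "1 / p"] p by (simp add: add_divide_distrib add.commute)
    then have e: "p powr (p / p) * Gamma ((p + 1) / p) / Gamma (1 / p) = 1" using p G by simp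
    show ?thesis using mom[of p, unfolded e] p by simp
  qed
  have mp2: "has_bochner_integral (gen_gauss p) (\<lambda>y. \<bar>y\<bar> powr p * y\<^sup>2) (3 * ?v)"
  proof -
    have "\<bar>y\<bar> powr (p + 2) = \<bar>y\<bar> powr p * y\<^sup>2" for y :: real by (simp add: powr_add sq)
    moreover have "Gamma ((p + 2 + 1) / p) = 3 / p * Gamma (3 / p)" using Gamma_real_Suc[of "3 / p"] p by (simp add: add_divide_distrib add.commute)
    then have e: "p powr ((p + 2) / p) * Gamma ((p + 2 + 1) / p) / Gamma (1 / p) = 3 * ?v"
      using p by (simp add: gen_gauss_var_def add_divide_distrib powr_add)
    ultimately show ?thesis using mom[of "p + 2", unfolded e] p by simp
  qed
  have mpp: "has_bochner_integral (gen_gauss p) (\<lambda>y. (\<bar>y\<bar> powr p)\<^sup>2) (p + 1)"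
  proof -
    have "\<bar>y\<bar> powr (2 * p) = (\<bar>y\<bar> powr p)\<^sup>2" for y :: real by (simp add: power2_eq_square powr_add[symmetric])
    moreover have "Gamma ((2 * p + 1) / p) = (1 / p + 1) * (1 / p * Gamma (1 / p))"
      using Gamma_real_Suc[of "1 / p"] Gamma_real_Suc[of "1 / p + 1"] p by (simp add: add_divide_distrib add_ac add_pos_pos)
    then have e: "p powr (2 * p / p) * Gamma ((2 * p + 1) / p) / Gamma (1 / p) = p + 1"
      using p G by (simp add: field_simps power2_eq_square)
    ultimately show ?thesis using mom[of "2 * p", unfolded e] p by simp
  qed
  note I = m2 m4 mp mp2 mpp
  note int = I[THEN integrable.intros]
  note val = I[THEN has_bochner_integral_integral_eq]
  show "integrable (gen_gauss p) (cstat p a b)"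
    unfolding cstat_def using int by (intro Bochner_Integration.integrable_add integrable_mult_right Bochner_Integration.integrable_diff integrable_divide) auto
  show "(\<integral>y. cstat p a b y \<partial>gen_gauss p) = 0"
    unfolding cstat_def using int v prob_space by (simp add: val)
  have "(cstat p a b y)\<^sup>2 = a\<^sup>2 / ?v\<^sup>2 * y ^ 4 + (2 * a * b / ?v * (\<bar>y\<bar> powr p * y\<^sup>2) + (b\<^sup>2 * (\<bar>y\<bar> powr p)\<^sup>2
     + ((- 2 * a\<^sup>2 / ?v - 2 * a * b / ?v) * y\<^sup>2 + ((- 2 * b\<^sup>2 - 2 * a * b) * \<bar>y\<bar> powr p + (a + b)\<^sup>2))))" for y
    unfolding cstat_def by (simp add: power2_eq_square algebra_simps add_divide_distrib numeral_eq_Suc)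
  then show "(\<integral>y. (cstat p a b y)\<^sup>2 \<partial>gen_gauss p) = a\<^sup>2 * (gamma_ratio p - 1) + 4 * a * b + b\<^sup>2 * p"
    using int v prob_space by (simp add: val) (simp add: power2_eq_square algebra_simps)
qed

lemma cstat_exp_integrable:
  assumes p: "p \<ge> 2"
  obtains c where "c > 0" "integrable (gen_gauss p) (\<lambda>y. exp (c * \<bar>cstat p a b y\<bar>))"
proof -
  let ?v = "gen_gauss_var p"
  have v: "?v > 0" using p by (intro gen_gauss_var_pos) auto
  define C where "C = \<bar>a\<bar> / ?v + \<bar>b\<bar> + 1"
  define D where "D = \<bar>a\<bar> / ?v + \<bar>a\<bar> + \<bar>b\<bar>"
  have C: "C > 0" using v by (simp add: C_def add_nonneg_pos)
  \<comment> \<open>for \<open>p \<ge> 2\<close> the square is dominated by \<open>1 + \<bar>y\<bar>\<^sup>p\<close>\<close>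
  have sq: "y\<^sup>2 \<le> 1 + \<bar>y\<bar> powr p" for y :: real
  proof (cases "\<bar>y\<bar> \<le> 1")
    case True
    then have "y\<^sup>2 \<le> 1" by (simp add: abs_square_le_1)
    then show ?thesis by (simp add: add_increasing2)
  next
    case False
    then have "\<bar>y\<bar> powr 2 \<le> \<bar>y\<bar> powr p" using p by (intro powr_mono) auto
    moreover have "\<bar>y\<bar> powr 2 = y\<^sup>2" using False by auto
    ultimately show ?thesis by simp
  qed
  have bound: "\<bar>cstat p a b y\<bar> \<le> D + C * \<bar>y\<bar> powr p" for y
  proof -
    have "\<bar>cstat p a b y\<bar> \<le> \<bar>a\<bar> * (y\<^sup>2 / ?v + 1) + \<bar>b\<bar> * (\<bar>y\<bar> powr p + 1)"
      unfolding cstat_def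
    proof (rule order_trans[OF abs_triangle_ineq add_mono])
      show "\<bar>a * (y\<^sup>2 / ?v - 1)\<bar> \<le> \<bar>a\<bar> * (y\<^sup>2 / ?v + 1)"
        unfolding abs_mult using v by (intro mult_left_mono) (auto simp: abs_le_iff)
      show "\<bar>b * (\<bar>y\<bar> powr p - 1)\<bar> \<le> \<bar>b\<bar> * (\<bar>y\<bar> powr p + 1)"
        unfolding abs_mult by (intro mult_left_mono) (auto simp: abs_le_iff add_increasing)
    qed
    also have "\<dots> \<le> \<bar>a\<bar> * ((1 + \<bar>y\<bar> powr p) / ?v + 1) + \<bar>b\<bar> * (\<bar>y\<bar> powr p + 1)"
      using sq[of y] v by (intro add_right_mono mult_left_mono divide_right_mono) auto
    also have "\<dots> = D + (C - 1) * \<bar>y\<bar> powr p" by (simp add: C_def D_def algebra_simps add_divide_distrib)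
    also have "\<dots> \<le> D + C * \<bar>y\<bar> powr p" by (intro add_left_mono mult_right_mono) auto
    finally show ?thesis .
  qed
  define c where "c = 1 / (2 * p * C)"
  have c: "c > 0" "c * C < 1 / p" using C p by (auto simp: c_def frac_less2)
  have "integrable (gen_gauss p) (\<lambda>y. exp (c * D) * exp (c * C * \<bar>y\<bar> powr p))"
    using p c by (intro integrable_mult_right gen_gauss_exp_integrable) auto
  then have "integrable (gen_gauss p) (\<lambda>y. exp (c * \<bar>cstat p a b y\<bar>))"
  proof (rule Bochner_Integration.integrable_bound)
    show "AE y in gen_gauss p. norm (exp (c * \<bar>cstat p a b y\<bar>)) \<le> norm (exp (c * D) * exp (c * C * \<bar>y\<bar> powr p))"
    proof (intro AE_I2)
      fix y
      have "c * \<bar>cstat p a b y\<bar> \<le> c * (D + C * \<bar>y\<bar> powr p)" using bound c(1) by (intro mult_left_mono) auto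
      then show "norm (exp (c * \<bar>cstat p a b y\<bar>)) \<le> norm (exp (c * D) * exp (c * C * \<bar>y\<bar> powr p))"
        by (simp add: exp_add[symmetric] distrib_left mult.assoc)
    qed
  qed measurable
  with c(1) show ?thesis by (rule that)
qed

text \<open>Vectors with independent coordinates. Defining the measure by its density with respect to
  Lebesgue measure serves both for integrating products and for changes of coordinates.\<close>

definition gauss_vec :: "nat \<Rightarrow> real \<Rightarrow> (nat \<Rightarrow> real) measure" where
  "gauss_vec n p = density (\<Pi>\<^sub>M i\<in>{..<n}. lborel) (\<lambda>x. \<Prod>i<n. ennreal (gen_gauss_density p (x i)))"

lemma sets_gauss_vec [measurable_cong, simp]: "sets (gauss_vec n p) = sets (\<Pi>\<^sub>M i\<in>{..<n}. lborel)"
  by (simp add: gauss_vec_def)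

lemma space_gauss_vec [simp]: "space (gauss_vec n p) = {..<n} \<rightarrow>\<^sub>E UNIV"
  by (simp add: gauss_vec_def space_PiM)

lemma measurable_gauss_vec_component: "i < n \<Longrightarrow> (\<lambda>x. x i) \<in> borel_measurable (gauss_vec n p)"
  using measurable_component_singleton[of i "{..<n}" "\<lambda>_. lborel :: real measure"]
    measurable_cong_sets[OF sets_gauss_vec sets_lborel, of n p]
  by simp

lemma nn_integral_gauss_vec_prod:
  fixes f :: "nat \<Rightarrow> real \<Rightarrow> ennreal"
  assumes [measurable]: "\<And>i. f i \<in> borel_measurable borel"
  shows "(\<integral>\<^sup>+x. (\<Prod>i<n. f i (x i)) \<partial>gauss_vec n p) = (\<Prod>i<n. \<integral>\<^sup>+y. f i y \<partial>gen_gauss p)"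
proof -
  interpret product_sigma_finite "\<lambda>_::nat. lborel :: real measure" ..
  have "(\<integral>\<^sup>+x. (\<Prod>i<n. f i (x i)) \<partial>gauss_vec n p)
    = (\<integral>\<^sup>+x. (\<Prod>i<n. ennreal (gen_gauss_density p (x i))) * (\<Prod>i<n. f i (x i)) \<partial>(\<Pi>\<^sub>M i\<in>{..<n}. lborel))"
    unfolding gauss_vec_def by (intro nn_integral_density) measurable
  also have "\<dots> = (\<integral>\<^sup>+x. (\<Prod>i<n. ennreal (gen_gauss_density p (x i)) * f i (x i)) \<partial>(\<Pi>\<^sub>M i\<in>{..<n}. lborel))"
    by (simp add: prod.distrib)
  also have "\<dots> = (\<Prod>i<n. \<integral>\<^sup>+y. ennreal (gen_gauss_density p y) * f i y \<partial>lborel)"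
    by (intro product_nn_integral_prod) auto
  also have "\<dots> = (\<Prod>i<n. \<integral>\<^sup>+y. f i y \<partial>gen_gauss p)"
    unfolding gen_gauss_def by (intro prod.cong refl nn_integral_density[symmetric]) auto
  finally show ?thesis .
qed

lemma prob_space_gauss_vec: assumes "p > 0" shows "prob_space (gauss_vec n p)"
proof
  interpret prob_space "gen_gauss p" by (rule prob_space_gen_gauss[OF assms])
  have "emeasure (gauss_vec n p) (space (gauss_vec n p)) = (\<integral>\<^sup>+x. 1 \<partial>gauss_vec n p)"
    by (simp only: nn_integral_const) simp
  also have "\<dots> = (\<integral>\<^sup>+x. (\<Prod>i<n. 1) \<partial>gauss_vec n p)" by simp
  also have "\<dots> = (\<Prod>i<n. \<integral>\<^sup>+y. 1 \<partial>gen_gauss p)" by (rule nn_integral_gauss_vec_prod) simp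
  also have "\<dots> = 1" using emeasure_space_1 by simp
  finally show "emeasure (gauss_vec n p) (space (gauss_vec n p)) = 1" .
qed

lemma nn_integral_exp_sum_gauss_vec:
  fixes f :: "real \<Rightarrow> real"
  assumes [measurable]: "f \<in> borel_measurable borel"
  shows "(\<integral>\<^sup>+x. ennreal (exp (\<Sum>i<n. B i * f (x i))) \<partial>gauss_vec n p) = (\<Prod>i<n. \<integral>\<^sup>+y. ennreal (exp (B i * f y)) \<partial>gen_gauss p)"
  by (subst nn_integral_gauss_vec_prod[symmetric]) (auto simp: exp_sum prod_ennreal intro!: nn_integral_cong)

text \<open>The pair \<open>(Y, g)\<close>.\<close>

definition gauss_pair :: "nat \<Rightarrow> real \<Rightarrow> ((nat \<Rightarrow> real) \<times> (nat \<Rightarrow> real)) measure" where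
  "gauss_pair n p = gauss_vec n p \<Otimes>\<^sub>M gauss_vec n 2"

lemma prob_space_gauss_pair: assumes "p > 0" shows "prob_space (gauss_pair n p)"
proof -
  interpret A: prob_space "gauss_vec n p" by (rule prob_space_gauss_vec[OF assms])
  interpret B: prob_space "gauss_vec n 2" by (rule prob_space_gauss_vec) simp
  interpret pair_prob_space "gauss_vec n p" "gauss_vec n 2" ..
  show ?thesis unfolding gauss_pair_def by unfold_locales
qed

lemma sets_gauss_pair [measurable_cong, simp]:
  "sets (gauss_pair n p) = sets ((\<Pi>\<^sub>M i\<in>{..<n}. lborel) \<Otimes>\<^sub>M (\<Pi>\<^sub>M i\<in>{..<n}. lborel))"
  unfolding gauss_pair_def by (intro sets_pair_measure_cong) auto

lemma nn_integral_exp_sum_gauss_pair: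
  fixes f h :: "real \<Rightarrow> real"
  assumes [measurable]: "f \<in> borel_measurable borel" "h \<in> borel_measurable borel" and p: "p > 0"
  shows "(\<integral>\<^sup>+\<omega>. ennreal (exp ((\<Sum>i<n. A i * f (fst \<omega> i)) + (\<Sum>i<n. B i * h (snd \<omega> i)))) \<partial>gauss_pair n p)
    = (\<Prod>i<n. \<integral>\<^sup>+y. ennreal (exp (A i * f y)) \<partial>gen_gauss p) * (\<Prod>i<n. \<integral>\<^sup>+y. ennreal (exp (B i * h y)) \<partial>gen_gauss 2)"
proof -
  interpret A: prob_space "gauss_vec n p" by (rule prob_space_gauss_vec[OF p])
  interpret B: prob_space "gauss_vec n 2" by (rule prob_space_gauss_vec) simp
  interpret pair_prob_space "gauss_vec n p" "gauss_vec n 2" ..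
  let ?F = "\<lambda>x. ennreal (exp (\<Sum>i<n. A i * f (x i)))" and ?H = "\<lambda>x. ennreal (exp (\<Sum>i<n. B i * h (x i)))"
  have "(\<integral>\<^sup>+\<omega>. ennreal (exp ((\<Sum>i<n. A i * f (fst \<omega> i)) + (\<Sum>i<n. B i * h (snd \<omega> i)))) \<partial>gauss_pair n p)
     = (\<integral>\<^sup>+\<omega>. ?F (fst \<omega>) * ?H (snd \<omega>) \<partial>(gauss_vec n p \<Otimes>\<^sub>M gauss_vec n 2))"
    unfolding gauss_pair_def by (simp add: exp_add ennreal_mult)
  also have "\<dots> = (\<integral>\<^sup>+x. \<integral>\<^sup>+y. ?F x * ?H y \<partial>gauss_vec n 2 \<partial>gauss_vec n p)"
    by (subst B.nn_integral_fst[symmetric]) (auto simp: case_prod_beta')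
  also have "\<dots> = (\<integral>\<^sup>+x. ?F x \<partial>gauss_vec n p) * (\<integral>\<^sup>+y. ?H y \<partial>gauss_vec n 2)"
    by (simp add: nn_integral_cmult nn_integral_multc)
  finally show ?thesis by (simp add: nn_integral_exp_sum_gauss_vec)
qed

section \<open>Moderate deviations of the linearized statistic\<close>

locale mdp_scaling =
  fixes p \<Lambda> :: real and k :: "nat \<Rightarrow> nat" and t :: "nat \<Rightarrow> real"
  assumes p: "2 \<le> p"
    and k_bounds: "n \<ge> 1 \<Longrightarrow> 1 \<le> k n \<and> k n \<le> n"
    and ratio: "(\<lambda>n. real (k n) / real n) \<longlonglongrightarrow> \<Lambda>"
    and t_pos: "n \<ge> 1 \<Longrightarrow> t n > 0"
    and t_top: "filterlim t at_top sequentially"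
    and t_small: "(\<lambda>n. t n / sqrt (real (k n))) \<longlonglongrightarrow> 0"
begin

text \<open>The averages are taken over all coordinates of \<open>Y\<close>, the first \<open>k n\<close> coordinates of \<open>g\<close>, and all
  coordinates of \<open>g\<close>. The coefficients are left free since bounds for each of the averages alone are
  needed in order to control the error of the linearization.\<close>

definition lin_stat :: "real \<Rightarrow> real \<Rightarrow> real \<Rightarrow> real \<Rightarrow> nat \<Rightarrow> (nat \<Rightarrow> real) \<times> (nat \<Rightarrow> real) \<Rightarrow> real" where
  "lin_stat a b \<alpha> \<beta> n \<omega> = sqrt (real (k n)) / t n *
     ((\<Sum>i<n. cstat p a b (fst \<omega> i)) / real n
      + \<alpha> * (\<Sum>i<k n. cstat 2 0 1 (snd \<omega> i)) / real (k n)
      + \<beta> * (\<Sum>i<n. cstat 2 0 1 (snd \<omega> i)) / real n)"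

definition limit_var :: "real \<Rightarrow> real \<Rightarrow> real \<Rightarrow> real \<Rightarrow> real" where
  "limit_var a b \<alpha> \<beta> = \<Lambda> * (a\<^sup>2 * (gamma_ratio p - 1) + 4 * a * b + b\<^sup>2 * p)
     + 2 * (\<alpha>\<^sup>2 + 2 * \<alpha> * \<beta> * \<Lambda> + \<beta>\<^sup>2 * \<Lambda>)"

lemma \<Lambda>_bounds: "0 \<le> \<Lambda>" "\<Lambda> \<le> 1"
proof -
  have "\<forall>\<^sub>F n in sequentially. 0 \<le> real (k n) / real n" by simp
  then show "0 \<le> \<Lambda>" using ratio by (intro tendsto_lowerbound[of _ _ sequentially]) auto
  have "\<forall>\<^sub>F n in sequentially. real (k n) / real n \<le> 1"
    using eventually_ge_at_top[of 1] by eventually_elim (use k_bounds in auto)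
  then show "\<Lambda> \<le> 1" using ratio by (intro tendsto_upperbound[of _ _ sequentially]) auto
qed

lemma cstat_var_nonneg: "a\<^sup>2 * (gamma_ratio p - 1) + 4 * a * b + b\<^sup>2 * p \<ge> 0"
  using p by (subst cstat_moments(3)[symmetric]) auto

lemma limit_var_nonneg: "limit_var a b \<alpha> \<beta> \<ge> 0"
proof -
  have "\<alpha>\<^sup>2 + 2 * \<alpha> * \<beta> * \<Lambda> + \<beta>\<^sup>2 * \<Lambda> = (1 - \<Lambda>) * \<alpha>\<^sup>2 + \<Lambda> * (\<alpha> + \<beta>)\<^sup>2"
    by (simp add: power2_eq_square algebra_simps)
  then show ?thesis unfolding limit_var_def using \<Lambda>_bounds cstat_var_nonneg[of a b]
    by (simp add: add_nonneg_nonneg)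
qed

lemma measurable_lin_stat [measurable]: "n \<ge> 1 \<Longrightarrow> lin_stat a b \<alpha> \<beta> n \<in> borel_measurable (gauss_pair n p)"
proof -
  assume n: "n \<ge> 1"
  have f: "(\<lambda>\<omega>. cstat p a b (fst \<omega> i)) \<in> borel_measurable (gauss_pair n p)" if "i < n" for i
    using that unfolding gauss_pair_def
    by (intro measurable_compose[OF measurable_compose[OF measurable_fst measurable_gauss_vec_component] measurable_cstat])
  have g: "(\<lambda>\<omega>. cstat 2 0 1 (snd \<omega> i)) \<in> borel_measurable (gauss_pair n p)" if "i < n" for i
    using that unfolding gauss_pair_def
    by (intro measurable_compose[OF measurable_compose[OF measurable_snd measurable_gauss_vec_component] measurable_cstat])
  show ?thesis unfolding lin_stat_def using k_bounds[OF n]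
    by (intro borel_measurable_times borel_measurable_divide borel_measurable_add borel_measurable_sum borel_measurable_const f g) auto
qed

lemma speed_top: "filterlim (\<lambda>n. (t n)\<^sup>2) at_top sequentially"
  using t_top by (intro filterlim_pow_at_top) auto

text \<open>The first \<open>k n\<close> coordinates of \<open>g\<close> occur in two averages and carry the sum of two weights. All
  weights are \<open>O(t / sqrt k)\<close>, hence tend to 0, and only their sums of squares matter in the limit.\<close>

lemma lin_stat_exponent:
  fixes \<theta> a b \<alpha> \<beta> :: real and n :: nat
  assumes n: "n \<ge> 1"
  defines "A \<equiv> \<theta> * t n * sqrt (real (k n)) / real n"
    and "B \<equiv> \<lambda>i. \<theta> * t n * sqrt (real (k n)) * (\<beta> / real n + (if i < k n then \<alpha> / real (k n) else 0))"
  shows "\<theta> * ((t n)\<^sup>2 * lin_stat a b \<alpha> \<beta> n \<omega>) = (\<Sum>i<n. A * cstat p a b (fst \<omega> i)) + (\<Sum>i<n. B i * cstat 2 0 1 (snd \<omega> i))"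
    and "real n * A\<^sup>2 = \<theta>\<^sup>2 * (t n)\<^sup>2 * (real (k n) / real n)"
    and "(\<Sum>i<n. (B i)\<^sup>2) = \<theta>\<^sup>2 * (t n)\<^sup>2 * (\<alpha>\<^sup>2 + 2 * \<alpha> * \<beta> * (real (k n) / real n) + \<beta>\<^sup>2 * (real (k n) / real n))"
    and "\<bar>A\<bar> \<le> \<bar>\<theta>\<bar> * (t n / sqrt (real (k n)))"
    and "\<And>i. \<bar>B i\<bar> \<le> \<bar>\<theta>\<bar> * (\<bar>\<alpha>\<bar> + \<bar>\<beta>\<bar>) * (t n / sqrt (real (k n)))"
proof -
  let ?K = "sqrt (real (k n))"
  have k: "1 \<le> k n" "k n \<le> n" using k_bounds[OF n] by auto
  have K: "?K > 0" "?K * ?K = real (k n)" using k by auto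
  have tn: "t n > 0" using t_pos[OF n] .
  have restr: "(\<Sum>i<n. if i < k n then c i else 0) = (\<Sum>i<k n. c i)" for c :: "nat \<Rightarrow> real"
  proof -
    have "{..<n} \<inter> {i. i < k n} = {..<k n}" using k by auto
    then show ?thesis by (simp add: sum.If_cases)
  qed
  have "(\<Sum>i<n. B i * cstat 2 0 1 (snd \<omega> i)) = (\<Sum>i<n. \<theta> * t n * ?K * \<beta> / real n * cstat 2 0 1 (snd \<omega> i)
      + (if i < k n then \<theta> * t n * ?K * \<alpha> / real (k n) * cstat 2 0 1 (snd \<omega> i) else 0))"
    by (intro sum.cong refl) (simp add: B_def algebra_simps add_divide_distrib)
  also have "\<dots> = \<theta> * t n * ?K * \<beta> / real n * (\<Sum>i<n. cstat 2 0 1 (snd \<omega> i)) + \<theta> * t n * ?K * \<alpha> / real (k n) * (\<Sum>i<k n. cstat 2 0 1 (snd \<omega> i))"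
    by (simp add: sum.distrib restr sum_distrib_left)
  finally show "\<theta> * ((t n)\<^sup>2 * lin_stat a b \<alpha> \<beta> n \<omega>) = (\<Sum>i<n. A * cstat p a b (fst \<omega> i)) + (\<Sum>i<n. B i * cstat 2 0 1 (snd \<omega> i))"
    unfolding lin_stat_def A_def sum_distrib_left[symmetric] using tn by (simp add: power2_eq_square algebra_simps)
  have "real n * A\<^sup>2 = \<theta>\<^sup>2 * (t n)\<^sup>2 * (?K * ?K) / real n"
    using n by (simp add: A_def power2_eq_square field_simps)
  then show "real n * A\<^sup>2 = \<theta>\<^sup>2 * (t n)\<^sup>2 * (real (k n) / real n)" using K by simp
  have "(\<Sum>i<n. (B i)\<^sup>2) = (\<Sum>i<n. \<theta>\<^sup>2 * (t n)\<^sup>2 * (?K * ?K) * (\<beta>\<^sup>2 / (real n)\<^sup>2 + (if i < k n then 2 * \<alpha> * \<beta> / (real n * real (k n)) + \<alpha>\<^sup>2 / (real (k n))\<^sup>2 else 0)))"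
    by (intro sum.cong refl) (simp add: B_def power2_eq_square algebra_simps)
  also have "\<dots> = \<theta>\<^sup>2 * (t n)\<^sup>2 * real (k n) * (real n * (\<beta>\<^sup>2 / (real n)\<^sup>2) + real (k n) * (2 * \<alpha> * \<beta> / (real n * real (k n)) + \<alpha>\<^sup>2 / (real (k n))\<^sup>2))"
    by (simp only: sum_distrib_left[symmetric] sum.distrib restr K sum_constant card_lessThan distrib_left)
  also have "\<dots> = \<theta>\<^sup>2 * (t n)\<^sup>2 * (\<alpha>\<^sup>2 + 2 * \<alpha> * \<beta> * (real (k n) / real n) + \<beta>\<^sup>2 * (real (k n) / real n))"
  proof -
    have "T * x * (N * (\<beta>\<^sup>2 / N\<^sup>2) + x * (2 * \<alpha> * \<beta> / (N * x) + \<alpha>\<^sup>2 / x\<^sup>2)) = T * (\<alpha>\<^sup>2 + 2 * \<alpha> * \<beta> * (x / N) + \<beta>\<^sup>2 * (x / N))"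
      if "x > 0" "N > 0" for T x N :: real
      using that by (simp add: power2_eq_square field_simps)
    then show ?thesis by this (use n k in auto)
  qed
  finally show "(\<Sum>i<n. (B i)\<^sup>2) = \<theta>\<^sup>2 * (t n)\<^sup>2 * (\<alpha>\<^sup>2 + 2 * \<alpha> * \<beta> * (real (k n) / real n) + \<beta>\<^sup>2 * (real (k n) / real n))" .
  have Kn: "?K / real n \<le> 1 / ?K" using K k n by (simp add: field_simps)
  have Kk: "?K / real (k n) = 1 / ?K" using K k by (simp add: field_simps)
  have "\<bar>A\<bar> = \<bar>\<theta>\<bar> * (t n * (?K / real n))" using tn n by (simp add: A_def abs_mult)
  also have "\<dots> \<le> \<bar>\<theta>\<bar> * (t n * (1 / ?K))" using Kn tn by (intro mult_left_mono) auto
  finally show "\<bar>A\<bar> \<le> \<bar>\<theta>\<bar> * (t n / ?K)" by simp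
  fix i
  have "\<bar>\<beta> / real n + (if i < k n then \<alpha> / real (k n) else 0)\<bar> \<le> \<bar>\<beta>\<bar> / real n + \<bar>\<alpha>\<bar> / real (k n)"
    by (rule order_trans[OF abs_triangle_ineq]) (auto simp: abs_mult)
  then have "?K * \<bar>\<beta> / real n + (if i < k n then \<alpha> / real (k n) else 0)\<bar> \<le> ?K * (\<bar>\<beta>\<bar> / real n + \<bar>\<alpha>\<bar> / real (k n))"
    by (intro mult_left_mono) auto
  also have "\<dots> = \<bar>\<beta>\<bar> * (?K / real n) + \<bar>\<alpha>\<bar> * (?K / real (k n))" by (simp add: algebra_simps)
  also have "\<dots> \<le> \<bar>\<beta>\<bar> * (1 / ?K) + \<bar>\<alpha>\<bar> * (1 / ?K)" using Kn Kk by (intro add_mono mult_left_mono) auto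
  finally have *: "?K * \<bar>\<beta> / real n + (if i < k n then \<alpha> / real (k n) else 0)\<bar> \<le> (\<bar>\<alpha>\<bar> + \<bar>\<beta>\<bar>) / ?K"
    by (simp add: add_divide_distrib add.commute)
  have "\<bar>B i\<bar> = (\<bar>\<theta>\<bar> * t n) * (?K * \<bar>\<beta> / real n + (if i < k n then \<alpha> / real (k n) else 0)\<bar>)"
    using tn by (simp only: B_def abs_mult) simp
  also have "\<dots> \<le> (\<bar>\<theta>\<bar> * t n) * ((\<bar>\<alpha>\<bar> + \<bar>\<beta>\<bar>) / ?K)" using * tn by (intro mult_left_mono) auto
  finally show "\<bar>B i\<bar> \<le> \<bar>\<theta>\<bar> * (\<bar>\<alpha>\<bar> + \<bar>\<beta>\<bar>) * (t n / ?K)" by (simp add: mult_ac)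
qed

text \<open>The moment generating function factorizes over the coordinates, and each factor has small argument.\<close>

lemma lin_stat_mgf:
  assumes d: "\<delta> > 0"
  shows "\<forall>\<^sub>F n in sequentially.
     (\<integral>\<^sup>+\<omega>. ennreal (exp (\<theta> * ((t n)\<^sup>2 * lin_stat a b \<alpha> \<beta> n \<omega>))) \<partial>gauss_pair n p)
        \<le> ennreal (exp ((t n)\<^sup>2 * (limit_var a b \<alpha> \<beta> * \<theta>\<^sup>2 / 2 + \<delta>))) \<and>
     ennreal (exp ((t n)\<^sup>2 * (limit_var a b \<alpha> \<beta> * \<theta>\<^sup>2 / 2 - \<delta>)))
        \<le> (\<integral>\<^sup>+\<omega>. ennreal (exp (\<theta> * ((t n)\<^sup>2 * lin_stat a b \<alpha> \<beta> n \<omega>))) \<partial>gauss_pair n p)"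
proof -
  define v where "v = a\<^sup>2 * (gamma_ratio p - 1) + 4 * a * b + b\<^sup>2 * p"
  define q where "q = (\<lambda>\<kappa>. \<alpha>\<^sup>2 + 2 * \<alpha> * \<beta> * \<kappa> + \<beta>\<^sup>2 * \<kappa>)"
  have q\<Lambda>: "q \<Lambda> \<ge> 0"
  proof -
    have "q \<Lambda> = (1 - \<Lambda>) * \<alpha>\<^sup>2 + \<Lambda> * (\<alpha> + \<beta>)\<^sup>2" by (simp add: q_def power2_eq_square algebra_simps)
    then show ?thesis using \<Lambda>_bounds by simp
  qed
  \<comment> \<open>the relative error \<open>\<eta>\<close> of the variances changes the limiting exponent by \<open>\<theta>\<^sup>2 (\<Lambda> + q \<Lambda>) \<eta>\<close>\<close>
  define \<eta> where "\<eta> = \<delta> / (2 * (\<theta>\<^sup>2 * (\<Lambda> + q \<Lambda>) + 1))"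
  have den: "2 * (\<theta>\<^sup>2 * (\<Lambda> + q \<Lambda>) + 1) > 0"
    using q\<Lambda> \<Lambda>_bounds by (intro mult_pos_pos add_nonneg_pos mult_nonneg_nonneg) auto
  have \<eta>: "\<eta> > 0" "\<theta>\<^sup>2 * (\<Lambda> + q \<Lambda>) * \<eta> < \<delta>"
  proof -
    show e: "\<eta> > 0" unfolding \<eta>_def using d den by (rule divide_pos_pos)
    have "2 * (\<theta>\<^sup>2 * (\<Lambda> + q \<Lambda>) + 1) * \<eta> = \<delta>" using den by (simp add: \<eta>_def)
    moreover have "0 \<le> \<theta>\<^sup>2 * (\<Lambda> + q \<Lambda>) * \<eta>" using q\<Lambda> \<Lambda>_bounds e by simp
    ultimately show "\<theta>\<^sup>2 * (\<Lambda> + q \<Lambda>) * \<eta> < \<delta>" using e by (simp add: algebra_simps)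
  qed
  interpret P: prob_space "gen_gauss p" using p by (intro prob_space_gen_gauss) auto
  obtain c where c: "c > 0" "integrable (gen_gauss p) (\<lambda>y. exp (c * \<bar>cstat p a b y\<bar>))"
    by (rule cstat_exp_integrable[OF p])
  obtain c' where c': "c' > 0" "integrable (gen_gauss 2) (\<lambda>y. exp (c' * \<bar>cstat 2 0 1 y\<bar>))"
    by (rule cstat_exp_integrable[of 2]) auto
  have pp: "p > 0" using p by simp
  obtain r where r: "r > 0"
    "\<And>s. \<bar>s\<bar> \<le> r \<Longrightarrow> (\<integral>\<^sup>+y. ennreal (exp (s * cstat p a b y)) \<partial>gen_gauss p) \<le> ennreal (exp (s\<^sup>2 * (v / 2 + \<eta>)))"
    "\<And>s. \<bar>s\<bar> \<le> r \<Longrightarrow> ennreal (exp (s\<^sup>2 * (v / 2 - \<eta>))) \<le> (\<integral>\<^sup>+y. ennreal (exp (s * cstat p a b y)) \<partial>gen_gauss p)"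
    by (rule mgf_near_zero[OF P.prob_space_axioms _ c cstat_moments(2)[OF pp] cstat_moments(3)[OF pp, of a b, folded v_def] \<eta>(1)]) auto
  have "(\<integral>y. (cstat 2 0 1 y)\<^sup>2 \<partial>gen_gauss 2) = 2" by (subst cstat_moments(3)) auto
  then obtain r' where r': "r' > 0"
    "\<And>s. \<bar>s\<bar> \<le> r' \<Longrightarrow> (\<integral>\<^sup>+y. ennreal (exp (s * cstat 2 0 1 y)) \<partial>gen_gauss 2) \<le> ennreal (exp (s\<^sup>2 * (2 / 2 + \<eta>)))"
    "\<And>s. \<bar>s\<bar> \<le> r' \<Longrightarrow> ennreal (exp (s\<^sup>2 * (2 / 2 - \<eta>))) \<le> (\<integral>\<^sup>+y. ennreal (exp (s * cstat 2 0 1 y)) \<partial>gen_gauss 2)"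
    using mgf_near_zero[OF prob_space_gen_gauss _ c' cstat_moments(2)[of 2 0 1] _ \<eta>(1), of 2] by auto
  have small: "\<forall>\<^sub>F n in sequentially. C * (t n / sqrt (real (k n))) < e" if "e > 0" for C e
    using tendsto_mult_right_zero[OF t_small, of C] that by (intro order_tendstoD(2)) auto
  have lim: "(\<lambda>n. \<theta>\<^sup>2 * ((real (k n) / real n) * (v / 2 + s * \<eta>) + (1 + s * \<eta>) * q (real (k n) / real n)))
      \<longlonglongrightarrow> \<theta>\<^sup>2 * (\<Lambda> * (v / 2 + s * \<eta>) + (1 + s * \<eta>) * q \<Lambda>)" for s
    unfolding q_def by (intro tendsto_intros ratio)
  have V: "\<theta>\<^sup>2 * (\<Lambda> * (v / 2 + s * \<eta>) + (1 + s * \<eta>) * q \<Lambda>) = limit_var a b \<alpha> \<beta> * \<theta>\<^sup>2 / 2 + s * (\<theta>\<^sup>2 * (\<Lambda> + q \<Lambda>) * \<eta>)" for s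
  proof -
    have "limit_var a b \<alpha> \<beta> = \<Lambda> * v + 2 * q \<Lambda>" by (simp add: limit_var_def v_def q_def)
    then show ?thesis by (simp add: algebra_simps)
  qed
  have "\<forall>\<^sub>F n in sequentially. \<theta>\<^sup>2 * ((real (k n) / real n) * (v / 2 + 1 * \<eta>) + (1 + 1 * \<eta>) * q (real (k n) / real n)) < limit_var a b \<alpha> \<beta> * \<theta>\<^sup>2 / 2 + \<delta>"
    by (rule order_tendstoD(2)[OF lim]) (use \<eta>(2) V[of 1] in linarith)
  moreover have "\<forall>\<^sub>F n in sequentially. \<theta>\<^sup>2 * ((real (k n) / real n) * (v / 2 + (-1) * \<eta>) + (1 + (-1) * \<eta>) * q (real (k n) / real n)) > limit_var a b \<alpha> \<beta> * \<theta>\<^sup>2 / 2 - \<delta>"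
    by (rule order_tendstoD(1)[OF lim]) (use \<eta>(2) V[of "-1"] in linarith)
  ultimately show ?thesis
    using small[OF r(1), of "\<bar>\<theta>\<bar>"] small[OF r'(1), of "\<bar>\<theta>\<bar> * (\<bar>\<alpha>\<bar> + \<bar>\<beta>\<bar>)"] eventually_ge_at_top[of 1]
  proof eventually_elim
    case (elim n)
    let ?\<kappa> = "real (k n) / real n"
    define A where "A = \<theta> * t n * sqrt (real (k n)) / real n"
    define B where "B = (\<lambda>i. \<theta> * t n * sqrt (real (k n)) * (\<beta> / real n + (if i < k n then \<alpha> / real (k n) else 0)))"
    have smallA: "\<bar>A\<bar> \<le> r" using lin_stat_exponent(4)[OF elim(5), of \<theta>, folded A_def] elim(3) by linarith
    have smallB: "\<bar>B i\<bar> \<le> r'" for i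
      using lin_stat_exponent(5)[OF elim(5), of \<theta> \<beta> i \<alpha>] elim(4) unfolding B_def by linarith
    have B2: "(\<Sum>i<n. (B i)\<^sup>2) = \<theta>\<^sup>2 * (t n)\<^sup>2 * q ?\<kappa>"
      unfolding B_def q_def by (rule lin_stat_exponent(3)[OF elim(5)])
    have A2: "real n * A\<^sup>2 = \<theta>\<^sup>2 * (t n)\<^sup>2 * ?\<kappa>" unfolding A_def by (rule lin_stat_exponent(2)[OF elim(5)])
    have "\<theta> * ((t n)\<^sup>2 * lin_stat a b \<alpha> \<beta> n \<omega>) = (\<Sum>i<n. A * cstat p a b (fst \<omega> i)) + (\<Sum>i<n. B i * cstat 2 0 1 (snd \<omega> i))" for \<omega>
      unfolding A_def B_def by (rule lin_stat_exponent(1)[OF elim(5)])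
    then have mgf: "(\<integral>\<^sup>+\<omega>. ennreal (exp (\<theta> * ((t n)\<^sup>2 * lin_stat a b \<alpha> \<beta> n \<omega>))) \<partial>gauss_pair n p)
      = (\<Prod>i<n. \<integral>\<^sup>+y. ennreal (exp (A * cstat p a b y)) \<partial>gen_gauss p) * (\<Prod>i<n. \<integral>\<^sup>+y. ennreal (exp (B i * cstat 2 0 1 y)) \<partial>gen_gauss 2)"
      using nn_integral_exp_sum_gauss_pair[of "cstat p a b" "cstat 2 0 1" p n "\<lambda>_. A" B] pp by simp
    have prods: "(\<Prod>i<n. ennreal (exp (A\<^sup>2 * (v / 2 + s * \<eta>)))) * (\<Prod>i<n. ennreal (exp ((B i)\<^sup>2 * (2 / 2 + s * \<eta>))))
      = ennreal (exp ((t n)\<^sup>2 * (\<theta>\<^sup>2 * (?\<kappa> * (v / 2 + s * \<eta>) + (1 + s * \<eta>) * q ?\<kappa>))))" for s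
    proof -
      have "(\<Prod>i<n. ennreal (exp (A\<^sup>2 * (v / 2 + s * \<eta>)))) * (\<Prod>i<n. ennreal (exp ((B i)\<^sup>2 * (2 / 2 + s * \<eta>))))
        = ennreal (exp ((\<Sum>i<n. A\<^sup>2 * (v / 2 + s * \<eta>)) + (\<Sum>i<n. (B i)\<^sup>2 * (2 / 2 + s * \<eta>))))"
        by (simp only: prod_ennreal exp_ge_zero exp_sum[symmetric] finite_lessThan exp_add ennreal_mult[symmetric])
      also have "(\<Sum>i<n. A\<^sup>2 * (v / 2 + s * \<eta>)) + (\<Sum>i<n. (B i)\<^sup>2 * (2 / 2 + s * \<eta>)) = (real n * A\<^sup>2) * (v / 2 + s * \<eta>) + (\<Sum>i<n. (B i)\<^sup>2) * (1 + s * \<eta>)"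
        by (simp add: sum_distrib_right)
      also have "\<dots> = (t n)\<^sup>2 * (\<theta>\<^sup>2 * (?\<kappa> * (v / 2 + s * \<eta>) + (1 + s * \<eta>) * q ?\<kappa>))"
      proof -
        have "\<theta>\<^sup>2 * T * x * (v / 2 + s * \<eta>) + \<theta>\<^sup>2 * T * y * (1 + s * \<eta>) = T * (\<theta>\<^sup>2 * (x * (v / 2 + s * \<eta>) + (1 + s * \<eta>) * y))"
          for T x y by (simp add: algebra_simps)
        then show ?thesis unfolding A2 B2 .
      qed
      finally show ?thesis .
    qed
    have tn: "(t n)\<^sup>2 > 0" using t_pos[OF elim(5)] by simp
    show ?case
    proof
      have "(\<integral>\<^sup>+\<omega>. ennreal (exp (\<theta> * ((t n)\<^sup>2 * lin_stat a b \<alpha> \<beta> n \<omega>))) \<partial>gauss_pair n p)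
        \<le> (\<Prod>i<n. ennreal (exp (A\<^sup>2 * (v / 2 + 1 * \<eta>)))) * (\<Prod>i<n. ennreal (exp ((B i)\<^sup>2 * (2 / 2 + 1 * \<eta>))))"
        unfolding mgf using r(2)[OF smallA] r'(2)[OF smallB] by (intro mult_mono prod_mono_ennreal) auto
      also have "\<dots> \<le> ennreal (exp ((t n)\<^sup>2 * (limit_var a b \<alpha> \<beta> * \<theta>\<^sup>2 / 2 + \<delta>)))"
        unfolding prods using elim(1) tn by (intro ennreal_leI) simp
      finally show "(\<integral>\<^sup>+\<omega>. ennreal (exp (\<theta> * ((t n)\<^sup>2 * lin_stat a b \<alpha> \<beta> n \<omega>))) \<partial>gauss_pair n p)
        \<le> ennreal (exp ((t n)\<^sup>2 * (limit_var a b \<alpha> \<beta> * \<theta>\<^sup>2 / 2 + \<delta>)))" .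
      have "ennreal (exp ((t n)\<^sup>2 * (limit_var a b \<alpha> \<beta> * \<theta>\<^sup>2 / 2 - \<delta>)))
         \<le> (\<Prod>i<n. ennreal (exp (A\<^sup>2 * (v / 2 + (-1) * \<eta>)))) * (\<Prod>i<n. ennreal (exp ((B i)\<^sup>2 * (2 / 2 + (-1) * \<eta>))))"
        unfolding prods using elim(2) tn by (intro ennreal_leI) simp
      also have "\<dots> \<le> (\<integral>\<^sup>+\<omega>. ennreal (exp (\<theta> * ((t n)\<^sup>2 * lin_stat a b \<alpha> \<beta> n \<omega>))) \<partial>gauss_pair n p)"
        unfolding mgf using r(3)[OF smallA] r'(3)[OF smallB] by (intro mult_mono prod_mono_ennreal) auto
      finally show "ennreal (exp ((t n)\<^sup>2 * (limit_var a b \<alpha> \<beta> * \<theta>\<^sup>2 / 2 - \<delta>)))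
        \<le> (\<integral>\<^sup>+\<omega>. ennreal (exp (\<theta> * ((t n)\<^sup>2 * lin_stat a b \<alpha> \<beta> n \<omega>))) \<partial>gauss_pair n p)" .
    qed
  qed
qed

lemma lin_stat_gaussian_bounds:
  "gaussian_bounds (\<lambda>n. gauss_pair n p) (lin_stat a b \<alpha> \<beta>) (\<lambda>n. (t n)\<^sup>2) (limit_var a b \<alpha> \<beta>)"
proof (rule gaussian_bounds_of_mgf[OF speed_top limit_var_nonneg])
  fix \<theta> \<delta> :: real assume "\<delta> > 0"
  from lin_stat_mgf[OF this, of \<theta> a b \<alpha> \<beta>]
  show "\<forall>\<^sub>F n in sequentially. (\<integral>\<^sup>+\<omega>. ennreal (exp (\<theta> * ((t n)\<^sup>2 * lin_stat a b \<alpha> \<beta> n \<omega>))) \<partial>gauss_pair n p)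
        \<le> ennreal (exp ((t n)\<^sup>2 * (limit_var a b \<alpha> \<beta> * \<theta>\<^sup>2 / 2 + \<delta>)))"
    and "\<forall>\<^sub>F n in sequentially. ennreal (exp ((t n)\<^sup>2 * (limit_var a b \<alpha> \<beta> * \<theta>\<^sup>2 / 2 - \<delta>)))
        \<le> (\<integral>\<^sup>+\<omega>. ennreal (exp (\<theta> * ((t n)\<^sup>2 * lin_stat a b \<alpha> \<beta> n \<omega>))) \<partial>gauss_pair n p)"
    by (auto elim: eventually_mono)
qed (use p in \<open>auto intro!: prob_space_gauss_pair\<close>)

end

section \<open>Linearization of the product of norm ratios\<close>

lemma abs_powr_two: "\<bar>x\<bar> powr 2 = x\<^sup>2" for x :: real
  by (cases "x = 0") auto

text \<open>Taking logarithms reduces the product to four expansions of \<open>ln (1 + x)\<close> and one of \<open>exp\<close>.\<close>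

lemma product_of_powers_Taylor:
  fixes a b c d u p :: real
  assumes p: "p \<ge> 2" and u: "u \<le> 1/8" and ab: "\<bar>a\<bar> \<le> u" "\<bar>b\<bar> \<le> u" "\<bar>c\<bar> \<le> u" "\<bar>d\<bar> \<le> u"
  shows "\<bar>(1 + a) powr (1/2) / (1 + b) powr (1/p) * ((1 + c) powr (1/2) / (1 + d) powr (1/2)) - 1
           - (a / 2 - b / p + c / 2 - d / 2)\<bar> \<le> 20 * u\<^sup>2"
proof -
  define y where "y = ln (1 + a) / 2 - ln (1 + b) / p + ln (1 + c) / 2 - ln (1 + d) / 2"
  define l where "l = a / 2 - b / p + c / 2 - d / 2"
  have u0: "0 \<le> u" using ab(1) by linarith
  have ln: "\<bar>ln (1 + x) - x\<bar> \<le> 2 * u\<^sup>2" if "\<bar>x\<bar> \<le> u" for x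
  proof -
    have "\<bar>ln (1 + x) - x\<bar> \<le> 2 * x\<^sup>2" using that u by (intro abs_ln_one_plus_x_minus_x_bound) linarith
    moreover have "x\<^sup>2 \<le> u\<^sup>2" using that by (metis abs_ge_zero power2_abs power_mono)
    ultimately show ?thesis by linarith
  qed
  have pos: "1 + a > 0" "1 + b > 0" "1 + c > 0" "1 + d > 0" using ab u by linarith+
  have prod: "(1 + a) powr (1/2) / (1 + b) powr (1/p) * ((1 + c) powr (1/2) / (1 + d) powr (1/2)) = exp y"
    using pos by (simp add: powr_def y_def exp_diff exp_add)
  have bp: "\<bar>z / p\<bar> \<le> \<bar>z\<bar> / 2" for z
  proof -
    have "\<bar>z\<bar> / p \<le> \<bar>z\<bar> / 2" using p by (intro divide_left_mono) auto
    then show ?thesis using p by (simp add: abs_divide)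
  qed
  have "\<bar>ln (1 + b) / p - b / p\<bar> = \<bar>(ln (1 + b) - b) / p\<bar>" by (simp add: diff_divide_distrib)
  also have "\<dots> \<le> \<bar>ln (1 + b) - b\<bar> / 2" by (rule bp)
  also have "\<dots> \<le> u\<^sup>2" using ln[OF ab(2)] by simp
  finally have yl: "\<bar>y - l\<bar> \<le> 4 * u\<^sup>2"
    unfolding y_def l_def using ln[OF ab(1)] ln[OF ab(3)] ln[OF ab(4)] by linarith
  have "\<bar>l\<bar> \<le> 2 * u" unfolding l_def using bp[of b] ab by linarith
  moreover have "u\<^sup>2 \<le> u / 8" using u u0 mult_left_mono[of u "1/8" u] by (simp add: power2_eq_square)
  ultimately have y: "\<bar>y\<bar> \<le> 5/2 * u" using yl by linarith
  then have y2: "\<bar>y\<bar> \<le> 1/2" using u by linarith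
  have "exp \<bar>y\<bar> \<le> exp (1/2)" using y2 by simp
  then have "exp \<bar>y\<bar> \<le> 2" using exp_half_le2 by linarith
  then have "\<bar>y\<bar> * exp \<bar>y\<bar> \<le> 1/2 * 2" using y2 by (intro mult_mono) auto
  then have "y\<^sup>2 * (\<bar>y\<bar> * exp \<bar>y\<bar>) \<le> y\<^sup>2 * 1" by (intro mult_left_mono) auto
  moreover have "\<bar>y\<bar>^3 * exp \<bar>y\<bar> = y\<^sup>2 * (\<bar>y\<bar> * exp \<bar>y\<bar>)" by (simp add: power3_eq_cube power2_eq_square)
  ultimately have "\<bar>exp y - 1 - y\<bar> \<le> 3/2 * y\<^sup>2" using exp_Taylor3[of y] by linarith
  moreover have "y\<^sup>2 \<le> (5/2 * u)\<^sup>2" using y by (metis abs_ge_zero power2_abs power_mono)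
  then have "y\<^sup>2 \<le> 25/4 * u\<^sup>2" by (simp add: power_mult_distrib power2_eq_square)
  ultimately show ?thesis unfolding prod l_def[symmetric] using yl zero_le_power2[of u] by linarith
qed

context mdp_scaling
begin

text \<open>The scaled norm of the projection without the factor \<open>\<parallel>X\<parallel>\<^sub>p\<close>, expressed through \<open>(Y, g)\<close>.\<close>

definition radial_stat :: "nat \<Rightarrow> (nat \<Rightarrow> real) \<times> (nat \<Rightarrow> real) \<Rightarrow> real" where
  "radial_stat n \<omega> = real n powr (1/p) / sqrt (gen_gauss_var p)
     * (lp_norm 2 n (fst \<omega>) / lp_norm p n (fst \<omega>)) * (lp_norm 2 (k n) (snd \<omega>) / lp_norm 2 n (snd \<omega>))"

lemma measurable_radial_stat [measurable]: "n \<ge> 1 \<Longrightarrow> radial_stat n \<in> borel_measurable (gauss_pair n p)"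
proof -
  assume n: "n \<ge> 1"
  have f: "(\<lambda>\<omega>. fst \<omega> i) \<in> borel_measurable (gauss_pair n p)" if "i < n" for i
    using that unfolding gauss_pair_def by (intro measurable_compose[OF measurable_fst measurable_gauss_vec_component])
  have g: "(\<lambda>\<omega>. snd \<omega> i) \<in> borel_measurable (gauss_pair n p)" if "i < n" for i
    using that unfolding gauss_pair_def by (intro measurable_compose[OF measurable_snd measurable_gauss_vec_component])
  show ?thesis unfolding radial_stat_def lp_norm_def using k_bounds[OF n]
    by (intro borel_measurable_times borel_measurable_divide powr_real_measurable borel_measurable_sum borel_measurable_abs borel_measurable_const f g) auto
qed

lemma radial_stat_linearization:
  assumes n: "n \<ge> 1" and u: "u \<le> 1/8"
    and small: "\<bar>lin_stat 1 0 0 0 n \<omega>\<bar> \<le> sqrt (real (k n)) / t n * u" "\<bar>lin_stat 0 1 0 0 n \<omega>\<bar> \<le> sqrt (real (k n)) / t n * u"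
      "\<bar>lin_stat 0 0 1 0 n \<omega>\<bar> \<le> sqrt (real (k n)) / t n * u" "\<bar>lin_stat 0 0 0 1 n \<omega>\<bar> \<le> sqrt (real (k n)) / t n * u"
  shows "\<bar>(radial_stat n \<omega> - sqrt (real (k n))) / t n - lin_stat (1/2) (- 1/p) (1/2) (- 1/2) n \<omega>\<bar> \<le> sqrt (real (k n)) / t n * (20 * u\<^sup>2)"
proof -
  define x where "x = sqrt (real (k n)) / t n"
  define a where "a = (\<Sum>i<n. cstat p 1 0 (fst \<omega> i)) / real n"
  define b where "b = (\<Sum>i<n. cstat p 0 1 (fst \<omega> i)) / real n"
  define c where "c = (\<Sum>i<k n. cstat 2 0 1 (snd \<omega> i)) / real (k n)"
  define d where "d = (\<Sum>i<n. cstat 2 0 1 (snd \<omega> i)) / real n"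
  have kn: "1 \<le> k n" "k n \<le> n" using k_bounds[OF n] by auto
  have tn: "t n > 0" by (rule t_pos[OF n])
  have x: "x > 0" using kn tn by (simp add: x_def)
  have v: "gen_gauss_var p > 0" using p by (intro gen_gauss_var_pos) auto
  have score0: "cstat q 0 0 y = 0" for q y by (simp add: cstat_def)
  have "lin_stat 1 0 0 0 n \<omega> = x * a" "lin_stat 0 1 0 0 n \<omega> = x * b" "lin_stat 0 0 1 0 n \<omega> = x * c" "lin_stat 0 0 0 1 n \<omega> = x * d"
    by (auto simp: lin_stat_def a_def b_def c_def d_def x_def score0)
  then have abcd: "\<bar>a\<bar> \<le> u" "\<bar>b\<bar> \<le> u" "\<bar>c\<bar> \<le> u" "\<bar>d\<bar> \<le> u"
    using small x unfolding x_def[symmetric] by (auto simp: abs_mult)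
  have lin: "lin_stat (1/2) (- 1/p) (1/2) (- 1/2) n \<omega> = x * (a / 2 - b / p + c / 2 - d / 2)"
  proof -
    have "cstat p (1/2) (- 1/p) y = cstat p 1 0 y / 2 - cstat p 0 1 y / p" for y by (simp add: cstat_def)
    then have "(\<Sum>i<n. cstat p (1/2) (- 1/p) (fst \<omega> i)) / real n = a / 2 - b / p"
      by (simp add: a_def b_def sum_subtractf sum_divide_distrib[symmetric] diff_divide_distrib mult.commute)
    then show ?thesis by (simp add: lin_stat_def x_def c_def d_def)
  qed
  have n2: "lp_norm 2 n (fst \<omega>) = sqrt (gen_gauss_var p) * real n powr (1/2) * (1 + a) powr (1/2)"
  proof -
    have "(\<Sum>i<n. \<bar>fst \<omega> i\<bar> powr 2) = (\<Sum>i<n. gen_gauss_var p * (1 + cstat p 1 0 (fst \<omega> i)))"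
      using v by (intro sum.cong refl) (simp add: cstat_def abs_powr_two)
    also have "\<dots> = gen_gauss_var p * (real n * (1 + a))"
      using n by (simp add: sum_distrib_left[symmetric] sum.distrib a_def field_simps)
    finally show ?thesis using v abcd u by (simp add: lp_norm_def powr_mult powr_half_sqrt mult.assoc)
  qed
  have np: "lp_norm p n (fst \<omega>) = real n powr (1/p) * (1 + b) powr (1/p)"
  proof -
    have "(\<Sum>i<n. \<bar>fst \<omega> i\<bar> powr p) = (\<Sum>i<n. 1 + cstat p 0 1 (fst \<omega> i))"
      by (intro sum.cong refl) (simp add: cstat_def)
    also have "\<dots> = real n * (1 + b)" using n by (simp add: sum.distrib b_def field_simps)
    finally show ?thesis using abcd u by (simp add: lp_norm_def powr_mult)
  qed
  have nk: "lp_norm 2 (k n) (snd \<omega>) = real (k n) powr (1/2) * (1 + c) powr (1/2)"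
  proof -
    have "(\<Sum>i<k n. \<bar>snd \<omega> i\<bar> powr 2) = (\<Sum>i<k n. 1 + cstat 2 0 1 (snd \<omega> i))"
      by (intro sum.cong refl) (simp add: cstat_def)
    also have "\<dots> = real (k n) * (1 + c)" using kn by (simp add: sum.distrib c_def field_simps)
    finally show ?thesis using abcd u by (simp add: lp_norm_def powr_mult)
  qed
  have nn: "lp_norm 2 n (snd \<omega>) = real n powr (1/2) * (1 + d) powr (1/2)"
  proof -
    have "(\<Sum>i<n. \<bar>snd \<omega> i\<bar> powr 2) = (\<Sum>i<n. 1 + cstat 2 0 1 (snd \<omega> i))"
      by (intro sum.cong refl) (simp add: cstat_def)
    also have "\<dots> = real n * (1 + d)" using n by (simp add: sum.distrib d_def field_simps)
    finally show ?thesis using abcd u by (simp add: lp_norm_def powr_mult)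
  qed
  define P where "P = (1 + a) powr (1/2) / (1 + b) powr (1/p) * ((1 + c) powr (1/2) / (1 + d) powr (1/2))"
  have "radial_stat n \<omega> = sqrt (real (k n)) * P"
    unfolding radial_stat_def n2 np nk nn P_def using n v by (simp add: powr_half_sqrt field_simps)
  then have "(radial_stat n \<omega> - sqrt (real (k n))) / t n - lin_stat (1/2) (- 1/p) (1/2) (- 1/2) n \<omega>
      = x * (P - 1 - (a / 2 - b / p + c / 2 - d / 2))"
    unfolding lin by (simp add: x_def diff_divide_distrib right_diff_distrib)
  then show ?thesis
    using product_of_powers_Taylor[OF p u abcd] x unfolding P_def[symmetric] x_def[symmetric] by (simp add: abs_mult)
qed

text \<open>The four averages are simultaneously below a threshold that is small enough for the quadratic
  error and exceeded with negligible probability only.\<close>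

theorem radial_stat_gaussian_bounds:
  "gaussian_bounds (\<lambda>n. gauss_pair n p) (\<lambda>n \<omega>. (radial_stat n \<omega> - sqrt (real (k n))) / t n) (\<lambda>n. (t n)\<^sup>2)
     (limit_var (1/2) (- 1/p) (1/2) (- 1/2))"
proof (rule gaussian_bounds_transfer[OF speed_top _ _ _ lin_stat_gaussian_bounds])
  fix \<epsilon> :: real assume \<epsilon>: "\<epsilon> > 0"
  define x where "x = (\<lambda>n. sqrt (real (k n)) / t n)"
  define K where "K = (\<lambda>n. sqrt (sqrt (x n)))"
  have prob: "prob_space (gauss_pair n p)" for n using p by (intro prob_space_gauss_pair) auto
  have x_top: "filterlim x at_top sequentially"
  proof -
    have "filterlim (\<lambda>n. inverse (t n / sqrt (real (k n)))) at_top sequentially"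
    proof (rule filterlim_inverse_at_top[OF t_small])
      show "\<forall>\<^sub>F n in sequentially. 0 < t n / sqrt (real (k n))"
        using eventually_ge_at_top[of 1] by eventually_elim (use t_pos k_bounds in \<open>fastforce intro!: divide_pos_pos\<close>)
    qed
    then show ?thesis by (simp add: x_def)
  qed
  have K_top: "filterlim K at_top sequentially"
    unfolding K_def by (intro filterlim_compose[OF sqrt_at_top] x_top)
  \<comment> \<open>with threshold \<open>K\<close> the fluctuations are at most \<open>K / x = x powr (-3/4)\<close>, hence the quadratic error is \<open>20 x powr (-1/2)\<close>\<close>
  have lim1: "((\<lambda>x. sqrt (sqrt x) / x) \<longlongrightarrow> 0) (at_top :: real filter)"
    and lim2: "((\<lambda>x. x * (20 * (sqrt (sqrt x) / x)\<^sup>2)) \<longlongrightarrow> 0) (at_top :: real filter)"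
    by real_asymp+
  have small_u: "\<forall>\<^sub>F n in sequentially. K n / x n < 1/8"
    unfolding K_def by (rule order_tendstoD(2)[OF filterlim_compose[OF lim1 x_top]]) simp
  have small_err: "\<forall>\<^sub>F n in sequentially. x n * (20 * (K n / x n)\<^sup>2) < \<epsilon>"
    unfolding K_def by (rule order_tendstoD(2)[OF filterlim_compose[OF lim2 x_top] \<epsilon>])
  have neg: "superexp (\<lambda>n. gauss_pair n p) (\<lambda>n \<omega>. K n \<le> \<bar>lin_stat a b \<alpha> \<beta> n \<omega>\<bar>) (\<lambda>n. (t n)\<^sup>2)" for a b \<alpha> \<beta>
    by (rule gaussian_bounds_superexp[OF lin_stat_gaussian_bounds K_top prob measurable_lin_stat])
  have meas: "n \<ge> 1 \<Longrightarrow> {\<omega> \<in> space (gauss_pair n p). K n \<le> \<bar>lin_stat a b \<alpha> \<beta> n \<omega>\<bar>} \<in> sets (gauss_pair n p)" for n a b \<alpha> \<beta>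
    using measurable_lin_stat[of n a b \<alpha> \<beta>] by measurable
  let ?P = "\<lambda>n \<omega>. (K n \<le> \<bar>lin_stat 1 0 0 0 n \<omega>\<bar> \<or> K n \<le> \<bar>lin_stat 0 1 0 0 n \<omega>\<bar>) \<or> (K n \<le> \<bar>lin_stat 0 0 1 0 n \<omega>\<bar> \<or> K n \<le> \<bar>lin_stat 0 0 0 1 n \<omega>\<bar>)"
  show "superexp (\<lambda>n. gauss_pair n p) (\<lambda>n \<omega>. \<epsilon> \<le> \<bar>(radial_stat n \<omega> - sqrt (real (k n))) / t n - lin_stat (1/2) (- 1/p) (1/2) (- 1/2) n \<omega>\<bar>) (\<lambda>n. (t n)\<^sup>2)"
  proof (rule superexp_mono[where Q = ?P])
    show "superexp (\<lambda>n. gauss_pair n p) ?P (\<lambda>n. (t n)\<^sup>2)"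
      by (intro superexp_disj[OF speed_top] neg meas sets.sets_Collect_disj)
    show "\<And>n. 1 \<le> n \<Longrightarrow> {\<omega> \<in> space (gauss_pair n p). ?P n \<omega>} \<in> sets (gauss_pair n p)"
      by (intro meas sets.sets_Collect_disj)
    show "\<forall>\<^sub>F n in sequentially. \<forall>\<omega>\<in>space (gauss_pair n p).
        \<epsilon> \<le> \<bar>(radial_stat n \<omega> - sqrt (real (k n))) / t n - lin_stat (1/2) (- 1/p) (1/2) (- 1/2) n \<omega>\<bar> \<longrightarrow> ?P n \<omega>"
      using small_u small_err eventually_ge_at_top[of 1]
    proof eventually_elim
      case (elim n)
      have "x n > 0" using k_bounds[OF elim(3)] t_pos[OF elim(3)] by (auto simp: x_def)
      then have "x n * (K n / x n) = K n" by simp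
      then have xK: "sqrt (real (k n)) / t n * (K n / x n) = K n" unfolding x_def .
      show ?case
      proof (intro ballI impI, rule ccontr)
        fix \<omega> assume e: "\<epsilon> \<le> \<bar>(radial_stat n \<omega> - sqrt (real (k n))) / t n - lin_stat (1/2) (- 1/p) (1/2) (- 1/2) n \<omega>\<bar>"
          and "\<not> ?P n \<omega>"
        then have "\<bar>(radial_stat n \<omega> - sqrt (real (k n))) / t n - lin_stat (1/2) (- 1/p) (1/2) (- 1/2) n \<omega>\<bar> \<le> x n * (20 * (K n / x n)\<^sup>2)"
          unfolding x_def using elim(1)
          by (intro radial_stat_linearization[OF elim(3)]) (auto simp only: xK[unfolded x_def] x_def not_le de_Morgan_disj less_imp_le)
        with e elim(2) show False by linarith
      qed
    qed
  qed (rule prob)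
qed (use p in \<open>auto intro!: prob_space_gauss_pair\<close>)

lemma limit_var_radial: "2 * limit_var (1/2) (- 1/p) (1/2) (- 1/2) = 1 - \<Lambda> + \<Lambda> * ((gamma_ratio p - 1) / 2 - 2 / p)"
  using p by (simp add: limit_var_def power2_eq_square field_simps)

lemma alpha_const_eq: "alpha_const p \<Lambda> = ereal 1 / ereal (2 * limit_var (1/2) (- 1/p) (1/2) (- 1/2))"
proof -
  define V where "V = 1 - \<Lambda> + \<Lambda> * ((gamma_ratio p - 1) / 2 - 2 / p)"
  define N where "N = 2 * Gamma (1 / p) * (Gamma (3 / p))\<^sup>2"
  have G: "Gamma (1 / p) > 0" "Gamma (3 / p) > 0" using p by (auto intro!: Gamma_real_pos)
  then have N: "N > 0" by (simp add: N_def)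
  have G1: "Gamma (1 + 1 / p) = Gamma (1 / p) / p" using Gamma_real_Suc[of "1/p"] p by (simp add: add.commute)
  have "(2 * p - \<Lambda> * (4 + 3 * p)) * Gamma (1 + 1 / p) * (Gamma (3 / p))\<^sup>2 + \<Lambda> * (Gamma (1 / p))\<^sup>2 * Gamma (5 / p) = N * V"
  proof -
    have "(2 * p - \<Lambda> * (4 + 3 * p)) * (g / p) * h\<^sup>2 + \<Lambda> * g\<^sup>2 * f = 2 * g * h\<^sup>2 * (1 - \<Lambda> + \<Lambda> * ((g * f / h\<^sup>2 - 1) / 2 - 2 / p))"
      if "g > 0" "h > 0" for f g h :: real
      using that p by (simp add: field_simps power2_eq_square)
    from this[OF G] show ?thesis unfolding G1 N_def V_def gamma_ratio_def .
  qed
  then have "alpha_const p \<Lambda> = ereal N / ereal (N * V)" unfolding alpha_const_def N_def by simp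
  also have "\<dots> = ereal 1 / ereal V" using N by (cases "V = 0") (auto simp: divide_ereal_def)
  finally show ?thesis unfolding limit_var_radial V_def .
qed

end

section \<open>Affine changes of coordinates and reflections\<close>

abbreviation lborel_vec :: "nat set \<Rightarrow> (nat \<Rightarrow> real) measure" where
  "lborel_vec I \<equiv> \<Pi>\<^sub>M i\<in>I. lborel"

lemma measurable_coordinate_change:
  assumes "\<And>i. i \<in> J \<Longrightarrow> \<phi> i \<in> borel_measurable (lborel_vec I)" "J \<subseteq> I"
  shows "(\<lambda>x i. if i \<in> J then \<phi> i x else x i) \<in> measurable (lborel_vec I) (lborel_vec I)"
proof (rule measurable_PiM_single')
  fix i assume i: "i \<in> I"
  show "(\<lambda>x. if i \<in> J then \<phi> i x else x i) \<in> measurable (lborel_vec I) lborel"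
  proof (cases "i \<in> J")
    case True then show ?thesis using assms(1) by simp
  next
    case False then show ?thesis using measurable_component_singleton[OF i, of "\<lambda>_. lborel :: real measure"] by simp
  qed
next
  show "(\<lambda>x i. if i \<in> J then \<phi> i x else x i) \<in> space (lborel_vec I) \<rightarrow> (\<Pi>\<^sub>E i\<in>I. space lborel)"
    using assms(2) by (auto simp: space_PiM PiE_def extensional_def)
qed

text \<open>By Fubini's theorem this is the affine change of variable in one coordinate, the others being fixed.\<close>

lemma nn_integral_change_one_coordinate:
  fixes f :: "(nat \<Rightarrow> real) \<Rightarrow> ennreal"
  assumes I: "finite I" "i \<in> I" and f[measurable]: "f \<in> borel_measurable (lborel_vec I)"
    and c: "c \<noteq> 0" and \<phi>: "\<phi> \<in> borel_measurable (lborel_vec I)" "\<And>x y. \<phi> (x(i := y)) = \<phi> x"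
  shows "ennreal \<bar>c\<bar> * (\<integral>\<^sup>+x. f (x(i := c * x i + \<phi> x)) \<partial>lborel_vec I) = (\<integral>\<^sup>+x. f x \<partial>lborel_vec I)"
proof -
  interpret product_sigma_finite "\<lambda>_::nat. lborel :: real measure" ..
  define J where "J = I - {i}"
  have J: "finite J" "i \<notin> J" "insert i J = I" using I by (auto simp: J_def)
  have upd: "(\<lambda>x. x(i := c * x i + \<phi> x)) \<in> measurable (lborel_vec I) (lborel_vec I)"
  proof -
    have "(\<lambda>x. c * x i + \<phi> x) \<in> borel_measurable (lborel_vec I)"
      using measurable_component_singleton[OF I(2), of "\<lambda>_. lborel :: real measure"] \<phi>(1) by simp
    then have "(\<lambda>x j. if j \<in> {i} then c * x i + \<phi> x else x j) \<in> measurable (lborel_vec I) (lborel_vec I)"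
      using I(2) by (intro measurable_coordinate_change) auto
    moreover have "(\<lambda>x j. if j \<in> {i} then c * x i + \<phi> x else x j) = (\<lambda>x. x(i := c * x i + \<phi> x))" by (auto simp: fun_eq_iff)
    ultimately show ?thesis by simp
  qed
  have comp: "(\<lambda>x. f (x(i := c * x i + \<phi> x))) \<in> borel_measurable (lborel_vec I)"
    using measurable_compose[OF upd f] .
  have inner: "(\<integral>\<^sup>+y. f (x(i := y)) \<partial>lborel) = ennreal \<bar>c\<bar> * (\<integral>\<^sup>+y. f (x(i := c * y + \<phi> x)) \<partial>lborel)"
    if x: "x \<in> space (lborel_vec J)" for x
  proof -
    have "(\<lambda>y. f (x(i := y))) \<in> borel_measurable borel"
      using measurable_comp[OF measurable_component_update[OF x J(2)], of f borel] f unfolding J(3) by (simp add: comp_def)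
    from nn_integral_real_affine[OF this c, of "\<phi> x"] show ?thesis by (simp add: add.commute)
  qed
  have "(\<integral>\<^sup>+x. f x \<partial>lborel_vec I) = (\<integral>\<^sup>+x. \<integral>\<^sup>+y. f (x(i := y)) \<partial>lborel \<partial>lborel_vec J)"
    using product_nn_integral_insert[OF J(1,2), of f] f unfolding J(3) .
  also have "\<dots> = (\<integral>\<^sup>+x. ennreal \<bar>c\<bar> * (\<integral>\<^sup>+y. f ((x(i := y))(i := c * (x(i := y)) i + \<phi> (x(i := y)))) \<partial>lborel) \<partial>lborel_vec J)"
    by (intro nn_integral_cong) (simp add: inner \<phi>(2))
  also have "\<dots> = ennreal \<bar>c\<bar> * (\<integral>\<^sup>+x. \<integral>\<^sup>+y. f ((x(i := y))(i := c * (x(i := y)) i + \<phi> (x(i := y)))) \<partial>lborel \<partial>lborel_vec J)"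
  proof (rule nn_integral_cmult)
    interpret F: finite_product_sigma_finite "\<lambda>_::nat. lborel :: real measure" J by standard (rule J(1))
    have "(\<lambda>(x, y). f ((x(i := y))(i := c * (x(i := y)) i + \<phi> (x(i := y))))) \<in> borel_measurable (lborel_vec J \<Otimes>\<^sub>M lborel)"
      using measurable_compose[OF measurable_add_dim comp[folded J(3)]] by (simp add: case_prod_beta')
    then show "(\<lambda>x. \<integral>\<^sup>+y. f ((x(i := y))(i := c * (x(i := y)) i + \<phi> (x(i := y)))) \<partial>lborel) \<in> borel_measurable (lborel_vec J)"
      by (rule lborel.borel_measurable_nn_integral)
  qed
  also have "(\<integral>\<^sup>+x. \<integral>\<^sup>+y. f ((x(i := y))(i := c * (x(i := y)) i + \<phi> (x(i := y)))) \<partial>lborel \<partial>lborel_vec J)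
      = (\<integral>\<^sup>+x. f (x(i := c * x i + \<phi> x)) \<partial>lborel_vec I)"
    using product_nn_integral_insert[OF J(1,2), of "\<lambda>x. f (x(i := c * x i + \<phi> x))"] comp unfolding J(3) by simp
  finally show ?thesis ..
qed

text \<open>Coordinates that are changed independently of each other may be changed one after another. This
  covers dilations, shears and changes of sign, from which reflections are composed.\<close>

lemma nn_integral_change_coordinates:
  fixes f :: "(nat \<Rightarrow> real) \<Rightarrow> ennreal"
  assumes I: "finite I" "J \<subseteq> I" and f: "f \<in> borel_measurable (lborel_vec I)" and c: "c \<noteq> 0"
    and \<phi>: "\<And>i. i \<in> J \<Longrightarrow> \<phi> i \<in> borel_measurable (lborel_vec I)"
      "\<And>i j x y. i \<in> J \<Longrightarrow> j \<in> J \<Longrightarrow> \<phi> i (x(j := y)) = \<phi> i x"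
  shows "ennreal (\<bar>c\<bar> ^ card J) * (\<integral>\<^sup>+x. f (\<lambda>i. if i \<in> J then c * x i + \<phi> i x else x i) \<partial>lborel_vec I) = (\<integral>\<^sup>+x. f x \<partial>lborel_vec I)"
proof -
  have "finite J" using I finite_subset by auto
  then show ?thesis using I(2) \<phi>
  proof (induction J)
    case empty
    then show ?case by simp
  next
    case (insert j J)
    let ?T = "\<lambda>x i. if i \<in> J then c * x i + \<phi> i x else x i"
    have [measurable]: "(\<lambda>x. x i) \<in> borel_measurable (lborel_vec I)" if "i \<in> I" for i
      using measurable_component_singleton[OF that, of "\<lambda>_. lborel :: real measure"] by simp
    have T: "?T \<in> measurable (lborel_vec I) (lborel_vec I)"
      using insert.prems by (intro measurable_coordinate_change borel_measurable_add borel_measurable_times) auto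
    have split: "(\<lambda>i. if i \<in> insert j J then c * x i + \<phi> i x else x i) = ?T (x(j := c * x j + \<phi> j x))" for x
    proof
      fix i
      show "(if i \<in> insert j J then c * x i + \<phi> i x else x i) = ?T (x(j := c * x j + \<phi> j x)) i"
      proof (cases "i \<in> J")
        case True
        then have "\<phi> i (x(j := c * x j + \<phi> j x)) = \<phi> i x" by (intro insert.prems(3)) auto
        then show ?thesis using True insert.hyps(2) by auto
      qed auto
    qed
    have "ennreal (\<bar>c\<bar> ^ card (insert j J)) * (\<integral>\<^sup>+x. f (\<lambda>i. if i \<in> insert j J then c * x i + \<phi> i x else x i) \<partial>lborel_vec I)
      = ennreal (\<bar>c\<bar> ^ card J) * (ennreal \<bar>c\<bar> * (\<integral>\<^sup>+x. f (?T (x(j := c * x j + \<phi> j x))) \<partial>lborel_vec I))"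
      unfolding split using insert.hyps by (simp add: ennreal_mult mult_ac)
    also have "ennreal \<bar>c\<bar> * (\<integral>\<^sup>+x. f (?T (x(j := c * x j + \<phi> j x))) \<partial>lborel_vec I) = (\<integral>\<^sup>+x. f (?T x) \<partial>lborel_vec I)"
    proof (rule nn_integral_change_one_coordinate[where f = "\<lambda>x. f (?T x)", OF I(1) _ measurable_compose[OF T f] c])
      show "\<phi> j (x(j := y)) = \<phi> j x" for x y by (rule insert.prems(3)) auto
    qed (use insert.prems(1,2) in auto)
    also have "ennreal (\<bar>c\<bar> ^ card J) * \<dots> = (\<integral>\<^sup>+x. f x \<partial>lborel_vec I)"
    proof (rule insert.IH)
      show "\<phi> i (x(j := y)) = \<phi> i x" if "i \<in> J" "j \<in> J" for i j x y using that by (intro insert.prems(3)) auto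
    qed (use insert.prems(1,2) in auto)
    finally show ?case .
  qed
qed

lemma nn_integral_scale_vec:
  fixes f :: "(nat \<Rightarrow> real) \<Rightarrow> ennreal"
  assumes f: "f \<in> borel_measurable (lborel_vec {..<n})" and r: "r > 0"
  shows "ennreal (r ^ n) * (\<integral>\<^sup>+x. f (\<lambda>i. if i < n then r * x i else x i) \<partial>lborel_vec {..<n}) = (\<integral>\<^sup>+x. f x \<partial>lborel_vec {..<n})"
  using nn_integral_change_coordinates[of "{..<n}" "{..<n}" f r "\<lambda>_ _. 0"] f r by (simp cong: if_cong)

text \<open>The reflection in the hyperplane orthogonal to \<open>w\<close>. Coordinates from \<open>n\<close> on are left alone, so that it
  acts both on \<open>Rn n\<close> and on the extensional functions that carry the product measure.\<close>

definition householder :: "nat \<Rightarrow> (nat \<Rightarrow> real) \<Rightarrow> (nat \<Rightarrow> real) \<Rightarrow> (nat \<Rightarrow> real)" where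
  "householder n w x = (\<lambda>i. if i < n then x i - 2 * inner_n n x w / inner_n n w w * w i else x i)"

lemma measurable_coordinate_lborel_vec: "i \<in> I \<Longrightarrow> (\<lambda>x. x i) \<in> borel_measurable (lborel_vec I)"
  using measurable_component_singleton[of i I "\<lambda>_. lborel :: real measure"] by simp

lemma measurable_householder: "householder n w \<in> measurable (lborel_vec {..<n}) (lborel_vec {..<n})"
proof -
  have "(\<lambda>x i. if i \<in> {..<n} then x i - 2 * inner_n n x w / inner_n n w w * w i else x i) \<in> measurable (lborel_vec {..<n}) (lborel_vec {..<n})"
    unfolding inner_n_def
    by (intro measurable_coordinate_change borel_measurable_diff borel_measurable_times borel_measurable_divide borel_measurable_sum
        borel_measurable_const measurable_coordinate_lborel_vec) auto
  then show ?thesis by (simp add: householder_def[abs_def])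
qed

lemma inner_n_householder:
  assumes "inner_n n w w \<noteq> 0"
  shows "inner_n n (householder n w x) (householder n w y) = inner_n n x y"
    and "inner_n n (householder n w x) w = - inner_n n x w"
proof -
  let ?b = "2 / inner_n n w w"
  have "inner_n n (householder n w x) (householder n w y)
    = (\<Sum>i<n. x i * y i - ?b * inner_n n y w * (x i * w i) - ?b * inner_n n x w * (y i * w i) + ?b * inner_n n x w * (?b * inner_n n y w) * (w i * w i))"
    unfolding inner_n_def[of n "householder n w x"] by (intro sum.cong refl) (simp add: householder_def algebra_simps)
  also have "\<dots> = inner_n n x y - ?b * inner_n n y w * inner_n n x w - ?b * inner_n n x w * inner_n n y w
      + ?b * inner_n n x w * (?b * inner_n n y w) * inner_n n w w"
    by (simp only: sum.distrib sum_subtractf sum_distrib_left[symmetric]) (simp only: inner_n_def)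
  also have "\<dots> = inner_n n x y" using assms by (simp add: field_simps)
  finally show "inner_n n (householder n w x) (householder n w y) = inner_n n x y" .
  have "inner_n n (householder n w x) w = (\<Sum>i<n. x i * w i - ?b * inner_n n x w * (w i * w i))"
    unfolding inner_n_def[of n "householder n w x"] by (intro sum.cong refl) (simp add: householder_def algebra_simps)
  also have "\<dots> = inner_n n x w - ?b * inner_n n x w * inner_n n w w"
    by (simp only: sum_subtractf sum_distrib_left[symmetric]) (simp only: inner_n_def)
  finally show "inner_n n (householder n w x) w = - inner_n n x w" using assms by simp
qed

text \<open>In coordinates of which one is \<open>\<langle>x, w\<rangle>\<close> the reflection is a shear followed by a change of sign.
  The Jacobian of the change to these coordinates cancels.\<close>

lemma nn_integral_householder:
  fixes f :: "(nat \<Rightarrow> real) \<Rightarrow> ennreal"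
  assumes f: "f \<in> borel_measurable (lborel_vec {..<n})" and w: "inner_n n w w \<noteq> 0"
  shows "(\<integral>\<^sup>+x. f (householder n w x) \<partial>lborel_vec {..<n}) = (\<integral>\<^sup>+x. f x \<partial>lborel_vec {..<n})"
proof -
  let ?I = "{..<n}" and ?S = "inner_n n w w"
  obtain m where m: "m < n" "w m \<noteq> 0" using w by (force simp: inner_n_def intro: sum.neutral)
  define \<phi> where "\<phi> = (\<lambda>x::nat\<Rightarrow>real. \<Sum>j\<in>?I - {m}. x j * w j)"
  \<comment> \<open>\<open>T\<close> makes \<open>\<langle>x, w\<rangle>\<close> the coordinate number \<open>m\<close>; there the reflection is a shear \<open>A\<close> followed by a change of sign \<open>N\<close>\<close>
  define T where "T = (\<lambda>x i. if i \<in> {m} then w m * x i + \<phi> x else x i)"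
  define T' where "T' = (\<lambda>y i. if i \<in> {m} then (y m - \<phi> y) / w m else y i)"
  define A where "A = (\<lambda>x i. if i \<in> ?I - {m} then 1 * x i + (- 2 / ?S * w i * x m) else x i)"
  define N where "N = (\<lambda>x (i::nat). if i \<in> {m} then (- 1) * x i + 0 else (x i::real))"
  have inner: "inner_n n x w = w m * x m + \<phi> x" for x
    unfolding inner_n_def \<phi>_def using m by (subst sum.remove[of _ m]) auto
  have \<phi>_upd: "\<phi> (x(m := y)) = \<phi> x" for x y unfolding \<phi>_def by (intro sum.cong) auto
  have \<phi>_cong: "\<phi> x = \<phi> y" if "\<And>j. j \<noteq> m \<Longrightarrow> x j = y j" for x y unfolding \<phi>_def using that by (intro sum.cong) auto
  have \<phi>_meas: "\<phi> \<in> borel_measurable (lborel_vec ?I)"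
    unfolding \<phi>_def by (intro borel_measurable_sum borel_measurable_times borel_measurable_const measurable_coordinate_lborel_vec) auto
  have T'T: "T' (T x) = x" for x
  proof
    fix i
    have "\<phi> (T x) = \<phi> x" by (rule \<phi>_cong) (simp add: T_def)
    then show "T' (T x) i = x i" using m by (simp add: T'_def T_def)
  qed
  have TH: "T (householder n w x) = N (A (T x))" for x
  proof
    fix i
    have "w m * householder n w x m + \<phi> (householder n w x) = - (w m * x m + \<phi> x)"
      using inner_n_householder(2)[OF w, of x] by (simp add: inner)
    then show "T (householder n w x) i = N (A (T x)) i"
      using m by (auto simp: T_def N_def A_def householder_def inner)
  qed
  have meas: "T \<in> measurable (lborel_vec ?I) (lborel_vec ?I)" "T' \<in> measurable (lborel_vec ?I) (lborel_vec ?I)"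
      "A \<in> measurable (lborel_vec ?I) (lborel_vec ?I)" "N \<in> measurable (lborel_vec ?I) (lborel_vec ?I)"
    unfolding T_def T'_def A_def N_def using m(1)
    by (intro measurable_coordinate_change borel_measurable_add borel_measurable_diff borel_measurable_divide borel_measurable_times
        borel_measurable_const measurable_coordinate_lborel_vec \<phi>_meas; auto)+
  have g: "(\<lambda>x. f (T' x)) \<in> borel_measurable (lborel_vec ?I)"
    using measurable_compose[OF meas(2) f] .
  have IT: "ennreal \<bar>w m\<bar> * (\<integral>\<^sup>+x. h (T x) \<partial>lborel_vec ?I) = (\<integral>\<^sup>+x. h x \<partial>lborel_vec ?I)"
    if "h \<in> borel_measurable (lborel_vec ?I)" for h :: "_ \<Rightarrow> ennreal"
    using nn_integral_change_coordinates[of ?I "{m}" h "w m" "\<lambda>_. \<phi>"] that m \<phi>_meas \<phi>_upd unfolding T_def by simp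
  have IA: "(\<integral>\<^sup>+x. h (A x) \<partial>lborel_vec ?I) = (\<integral>\<^sup>+x. h x \<partial>lborel_vec ?I)"
    if "h \<in> borel_measurable (lborel_vec ?I)" for h :: "_ \<Rightarrow> ennreal"
  proof -
    have "ennreal (\<bar>1\<bar> ^ card (?I - {m})) * (\<integral>\<^sup>+x. h (A x) \<partial>lborel_vec ?I) = (\<integral>\<^sup>+x. h x \<partial>lborel_vec ?I)"
      unfolding A_def using m(1)
      by (intro nn_integral_change_coordinates that borel_measurable_times borel_measurable_const measurable_coordinate_lborel_vec) auto
    then show ?thesis by simp
  qed
  have IN: "(\<integral>\<^sup>+x. h (N x) \<partial>lborel_vec ?I) = (\<integral>\<^sup>+x. h x \<partial>lborel_vec ?I)"
    if "h \<in> borel_measurable (lborel_vec ?I)" for h :: "_ \<Rightarrow> ennreal"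
  proof -
    have "ennreal (\<bar>- 1\<bar> ^ card {m}) * (\<integral>\<^sup>+x. h (N x) \<partial>lborel_vec ?I) = (\<integral>\<^sup>+x. h x \<partial>lborel_vec ?I)"
      unfolding N_def using m(1)
      by (intro nn_integral_change_coordinates that borel_measurable_const) auto
    then show ?thesis by simp
  qed
  have "ennreal \<bar>w m\<bar> * (\<integral>\<^sup>+x. f (householder n w x) \<partial>lborel_vec ?I) = ennreal \<bar>w m\<bar> * (\<integral>\<^sup>+x. f (T' (N (A (T x)))) \<partial>lborel_vec ?I)"
    by (simp add: TH[symmetric] T'T)
  also have "\<dots> = (\<integral>\<^sup>+x. f (T' (N (A x))) \<partial>lborel_vec ?I)"
    by (rule IT[OF measurable_compose[OF meas(3) measurable_compose[OF meas(4) g]]])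
  also have "\<dots> = (\<integral>\<^sup>+x. f (T' (N x)) \<partial>lborel_vec ?I)" by (rule IA[OF measurable_compose[OF meas(4) g]])
  also have "\<dots> = (\<integral>\<^sup>+x. f (T' x) \<partial>lborel_vec ?I)" by (rule IN[OF g])
  also have "\<dots> = ennreal \<bar>w m\<bar> * (\<integral>\<^sup>+x. f (T' (T x)) \<partial>lborel_vec ?I)" by (rule IT[OF g, symmetric])
  also have "\<dots> = ennreal \<bar>w m\<bar> * (\<integral>\<^sup>+x. f x \<partial>lborel_vec ?I)" by (simp add: T'T)
  finally show ?thesis using m(2) by (simp add: ennreal_mult_cancel_left)
qed

lemma prod_gen_gauss_density:
  "(\<Prod>i<n. ennreal (gen_gauss_density p (x i)))
     = ennreal (1 / (2 * p powr (1 / p) * Gamma (1 + 1 / p)) ^ n) * ennreal (exp (- (1 / p) * (\<Sum>i<n. \<bar>x i\<bar> powr p)))"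
  if p: "p > 0"
proof -
  let ?Z = "2 * p powr (1 / p) * Gamma (1 + 1 / p)"
  have "?Z > 0" using p by (auto intro!: mult_pos_pos Gamma_real_pos add_pos_pos)
  then have Z: "?Z ^ n > 0" by simp
  have "(\<Prod>i<n. ennreal (gen_gauss_density p (x i))) = ennreal (\<Prod>i<n. gen_gauss_density p (x i))"
    using gen_gauss_density_pos[OF p] by (intro prod_ennreal) (auto intro: less_imp_le)
  also have "(\<Prod>i<n. gen_gauss_density p (x i)) = 1 / ?Z ^ n * exp (- (1 / p) * (\<Sum>i<n. \<bar>x i\<bar> powr p))"
    by (simp add: gen_gauss_density_def prod_dividef sum_distrib_left exp_sum)
  also have "ennreal \<dots> = ennreal (1 / ?Z ^ n) * ennreal (exp (- (1 / p) * (\<Sum>i<n. \<bar>x i\<bar> powr p)))"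
    using Z by (intro ennreal_mult) auto
  finally show ?thesis .
qed

lemma nn_integral_gauss_vec:
  assumes p: "p > 0" and f: "f \<in> borel_measurable (lborel_vec {..<n})"
  shows "(\<integral>\<^sup>+x. f x \<partial>gauss_vec n p) = ennreal (1 / (2 * p powr (1 / p) * Gamma (1 + 1 / p)) ^ n)
     * (\<integral>\<^sup>+x. ennreal (exp (- (1 / p) * (\<Sum>i<n. \<bar>x i\<bar> powr p))) * f x \<partial>lborel_vec {..<n})"
proof -
  have [measurable]: "(\<lambda>x. x i) \<in> borel_measurable (lborel_vec {..<n})" if "i \<in> {..<n}" for i
    using that by (rule measurable_coordinate_lborel_vec)
  note f[measurable]
  have "(\<integral>\<^sup>+x. f x \<partial>gauss_vec n p) = (\<integral>\<^sup>+x. (\<Prod>i<n. ennreal (gen_gauss_density p (x i))) * f x \<partial>lborel_vec {..<n})"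
    unfolding gauss_vec_def by (intro nn_integral_density f) measurable
  also have "\<dots> = (\<integral>\<^sup>+x. ennreal (1 / (2 * p powr (1 / p) * Gamma (1 + 1 / p)) ^ n)
     * (ennreal (exp (- (1 / p) * (\<Sum>i<n. \<bar>x i\<bar> powr p))) * f x) \<partial>lborel_vec {..<n})"
    unfolding prod_gen_gauss_density[OF p] by (simp add: mult.assoc)
  also have "\<dots> = ennreal (1 / (2 * p powr (1 / p) * Gamma (1 + 1 / p)) ^ n)
     * (\<integral>\<^sup>+x. ennreal (exp (- (1 / p) * (\<Sum>i<n. \<bar>x i\<bar> powr p))) * f x \<partial>lborel_vec {..<n})"
    by (intro nn_integral_cmult) measurable
  finally show ?thesis .
qed

lemma sum_abs_powr_two: "(\<Sum>i<n. \<bar>x i\<bar> powr 2) = inner_n n x x" for x :: "nat \<Rightarrow> real"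
proof -
  have "\<bar>y\<bar> powr 2 = y * y" for y :: real by (cases "y = 0") (auto simp: power2_eq_square)
  then show ?thesis by (simp add: inner_n_def)
qed

text \<open>The Gaussian density is a function of the Euclidean norm, which reflections preserve.\<close>

lemma nn_integral_gauss_vec_householder:
  assumes f: "f \<in> borel_measurable (lborel_vec {..<n})" and w: "inner_n n w w \<noteq> 0"
  shows "(\<integral>\<^sup>+x. f (householder n w x) \<partial>gauss_vec n 2) = (\<integral>\<^sup>+x. f x \<partial>gauss_vec n 2)"
proof -
  have [measurable]: "(\<lambda>x. x i) \<in> borel_measurable (lborel_vec {..<n})" if "i \<in> {..<n}" for i
    using that by (rule measurable_coordinate_lborel_vec)
  note f[measurable]
  let ?g = "\<lambda>x. ennreal (exp (- (1 / 2) * (\<Sum>i<n. \<bar>x i\<bar> powr 2))) * f x"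
  have g: "?g \<in> borel_measurable (lborel_vec {..<n})" by measurable
  have "ennreal (exp (- (1 / 2) * (\<Sum>i<n. \<bar>x i\<bar> powr 2))) * f (householder n w x) = ?g (householder n w x)" for x
    unfolding sum_abs_powr_two inner_n_householder(1)[OF w] ..
  then show ?thesis
    using nn_integral_householder[OF g w] f measurable_compose[OF measurable_householder f]
    by (simp add: nn_integral_gauss_vec)
qed

section \<open>The uniform distribution on the p-ball\<close>

definition norm_ratio :: "real \<Rightarrow> nat \<Rightarrow> (nat \<Rightarrow> real) \<Rightarrow> real" where
  "norm_ratio p n x = lp_norm 2 n x / lp_norm p n x"

lemma lp_norm_cong: "(\<And>i. i < n \<Longrightarrow> x i = y i) \<Longrightarrow> lp_norm q n x = lp_norm q n y"
  unfolding lp_norm_def by simp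

lemma lp_norm_scale:
  assumes "q > 0" "r \<ge> 0" "\<And>i. i < n \<Longrightarrow> y i = r * x i"
  shows "lp_norm q n y = r * lp_norm q n x"
proof -
  have "(\<Sum>i<n. \<bar>y i\<bar> powr q) = r powr q * (\<Sum>i<n. \<bar>x i\<bar> powr q)"
    using assms by (simp add: abs_mult powr_mult sum_distrib_left)
  then show ?thesis using assms by (simp add: lp_norm_def powr_mult powr_powr sum_nonneg)
qed

lemma measurable_lp_norm_lborel_vec: "lp_norm q n \<in> borel_measurable (lborel_vec {..<n})"
proof -
  have [measurable]: "(\<lambda>x. x i) \<in> borel_measurable (lborel_vec {..<n})" if "i \<in> {..<n}" for i
    using that by (rule measurable_coordinate_lborel_vec)
  show ?thesis unfolding lp_norm_def by measurable
qed

context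
  fixes p :: real and n :: nat
  assumes p: "p > 0" and n: "n \<ge> 1"
begin

text \<open>The volume of a cone, cut off at radius \<open>s powr (1/p)\<close>.\<close>

definition cone_vol :: "real set \<Rightarrow> real \<Rightarrow> ennreal" where
  "cone_vol A s = emeasure (lborel_vec {..<n}) {x \<in> space (lborel_vec {..<n}). (\<Sum>i<n. \<bar>x i\<bar> powr p) \<le> s \<and> norm_ratio p n x \<in> A}"

lemma cone_measurable:
  assumes "A \<in> sets borel"
  shows "{x \<in> space (lborel_vec {..<n}). (\<Sum>i<n. \<bar>x i\<bar> powr p) \<le> s \<and> norm_ratio p n x \<in> A} \<in> sets (lborel_vec {..<n})"
proof -
  have [measurable]: "(\<lambda>x. x i) \<in> borel_measurable (lborel_vec {..<n})" if "i \<in> {..<n}" for i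
    using that by (rule measurable_coordinate_lborel_vec)
  have [measurable]: "lp_norm q n \<in> borel_measurable (lborel_vec {..<n})" for q by (rule measurable_lp_norm_lborel_vec)
  note assms[measurable]
  show ?thesis unfolding norm_ratio_def by measurable
qed

lemma cone_vol_scale:
  assumes A: "A \<in> sets borel" and s: "s > 0"
  shows "cone_vol A s = ennreal (s powr (real n / p)) * cone_vol A 1"
proof -
  define r where "r = s powr (1 / p)"
  have r: "r > 0" "r powr p = s" "r ^ n = s powr (real n / p)"
    using s p n by (auto simp: r_def powr_powr powr_realpow[symmetric])
  let ?S = "\<lambda>s. {x \<in> space (lborel_vec {..<n}). (\<Sum>i<n. \<bar>x i\<bar> powr p) \<le> s \<and> norm_ratio p n x \<in> A}"
  have "cone_vol A s = (\<integral>\<^sup>+x. indicator (?S s) x \<partial>lborel_vec {..<n})"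
    unfolding cone_vol_def using cone_measurable[OF A] by simp
  also have "\<dots> = ennreal (r ^ n) * (\<integral>\<^sup>+x. indicator (?S s) (\<lambda>i. if i < n then r * x i else x i) \<partial>lborel_vec {..<n})"
    using cone_measurable[OF A, of s] by (intro nn_integral_scale_vec[symmetric] r(1)) simp
  also have "(\<integral>\<^sup>+x. indicator (?S s) (\<lambda>i. if i < n then r * x i else x i) \<partial>lborel_vec {..<n}) = (\<integral>\<^sup>+x. indicator (?S 1) x \<partial>lborel_vec {..<n})"
  proof (intro nn_integral_cong)
    fix x assume x: "x \<in> space (lborel_vec {..<n})"
    let ?y = "\<lambda>i. if i < n then r * x i else x i"
    have "?y \<in> space (lborel_vec {..<n})" using x by (auto simp: space_PiM PiE_def extensional_def)
    moreover have "norm_ratio p n ?y = norm_ratio p n x"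
      using lp_norm_scale[of 2 r n ?y x] lp_norm_scale[of p r n ?y x] p r(1) by (simp add: norm_ratio_def)
    moreover have "(\<Sum>i<n. \<bar>?y i\<bar> powr p) = s * (\<Sum>i<n. \<bar>x i\<bar> powr p)"
      using r by (simp add: abs_mult powr_mult sum_distrib_left)
    ultimately show "indicator (?S s) ?y = (indicator (?S 1) x :: ennreal)"
      using x s by (auto simp: indicator_def mult_le_cancel_left2)
  qed
  also have "\<dots> = cone_vol A 1" unfolding cone_vol_def using cone_measurable[OF A] by simp
  finally show ?thesis using r(3) by simp
qed

text \<open>\<open>exp (- u / p)\<close> as a mixture of the indicators of \<open>u \<le> s\<close>. The restriction to \<open>s > 0\<close> allows the
  homogeneity of \<open>cone_vol\<close> to be used under the integral.\<close>

lemma nn_integral_exp_tail: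
  assumes u: "u \<ge> 0"
  shows "(\<integral>\<^sup>+s. ennreal (1 / p * exp (- (1 / p) * s)) * indicator {0<..} s * indicator {u..} s \<partial>lborel) = ennreal (exp (- (1 / p) * u))"
proof -
  have "(\<integral>\<^sup>+s. ennreal (1 / p * exp (- (1 / p) * s)) * indicator {0<..} s * indicator {u..} s \<partial>lborel)
     = (\<integral>\<^sup>+s. ennreal (1 / p * exp (- (1 / p) * s)) * indicator {u..} s \<partial>lborel)"
  proof (rule nn_integral_cong_AE)
    have "AE s in lborel. s \<noteq> (0::real)" by (rule AE_lborel_singleton)
    then show "AE s in lborel. ennreal (1 / p * exp (- (1 / p) * s)) * indicator {0<..} s * indicator {u..} s
       = ennreal (1 / p * exp (- (1 / p) * s)) * indicator {u..} s"
      by eventually_elim (use u in \<open>auto split: split_indicator\<close>)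
  qed
  also have "\<dots> = ennreal (0 - (- exp (- (1 / p) * u)))"
  proof (rule nn_integral_FTC_atLeast)
    show "((\<lambda>s. - exp (- (1 / p) * s)) \<longlongrightarrow> 0) at_top" using p by real_asymp
  qed (use p in \<open>auto intro!: derivative_eq_intros\<close>)
  finally show ?thesis by simp
qed

text \<open>The layer-cake formula: the density depends on the \<open>p\<close>-norm only, so the law of a function of
  the direction is proportional to the volume of the corresponding cone.\<close>

lemma gauss_vec_cone:
  obtains C where "\<And>A. A \<in> sets borel \<Longrightarrow>
    emeasure (gauss_vec n p) {x \<in> space (gauss_vec n p). norm_ratio p n x \<in> A} = C * cone_vol A 1"
proof -
  let ?L = "lborel_vec {..<n}"
  interpret product_sigma_finite "\<lambda>_::nat. lborel :: real measure" ..
  interpret finite_product_sigma_finite "\<lambda>_::nat. lborel :: real measure" "{..<n}" by standard simp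
  interpret pair_sigma_finite ?L "lborel :: real measure" ..
  have co[measurable]: "(\<lambda>x. x i) \<in> borel_measurable ?L" if "i \<in> {..<n}" for i
    using that by (rule measurable_coordinate_lborel_vec)
  have [measurable]: "lp_norm q n \<in> borel_measurable ?L" for q by (rule measurable_lp_norm_lborel_vec)
  have [measurable]: "norm_ratio p n \<in> borel_measurable ?L" unfolding norm_ratio_def by measurable
  define u where "u = (\<lambda>x::nat\<Rightarrow>real. \<Sum>i<n. \<bar>x i\<bar> powr p)"
  have [measurable]: "u \<in> borel_measurable ?L" unfolding u_def by measurable
  note co[measurable del]
  have u0: "u x \<ge> 0" for x by (simp add: u_def sum_nonneg)
  define Z where "Z = ennreal (1 / (2 * p powr (1 / p) * Gamma (1 + 1 / p)) ^ n)"
  define J where "J = (\<integral>\<^sup>+s. ennreal (1 / p * exp (- (1 / p) * s)) * indicator {0<..} s * ennreal (s powr (real n / p)) \<partial>lborel)"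
  have "emeasure (gauss_vec n p) {x \<in> space (gauss_vec n p). norm_ratio p n x \<in> A} = Z * J * cone_vol A 1" if A[measurable]: "A \<in> sets borel" for A
  proof -
    let ?B = "{x \<in> space ?L. norm_ratio p n x \<in> A}"
    have B: "?B \<in> sets ?L" by measurable
    have "emeasure (gauss_vec n p) {x \<in> space (gauss_vec n p). norm_ratio p n x \<in> A} = (\<integral>\<^sup>+x. indicator ?B x \<partial>gauss_vec n p)"
      using B by (subst nn_integral_indicator) (auto simp: space_PiM)
    also have "\<dots> = Z * (\<integral>\<^sup>+x. ennreal (exp (- (1 / p) * u x)) * indicator ?B x \<partial>?L)"
      unfolding Z_def u_def using B by (intro nn_integral_gauss_vec p) simp
    also have "(\<integral>\<^sup>+x. ennreal (exp (- (1 / p) * u x)) * indicator ?B x \<partial>?L)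
      = (\<integral>\<^sup>+x. \<integral>\<^sup>+s. ennreal (1 / p * exp (- (1 / p) * s)) * indicator {0<..} s * indicator {u x..} s * indicator ?B x \<partial>lborel \<partial>?L)"
    proof (intro nn_integral_cong)
      fix x
      have "(\<integral>\<^sup>+s. ennreal (1 / p * exp (- (1 / p) * s)) * indicator {0<..} s * indicator {u x..} s * indicator ?B x \<partial>lborel)
        = (\<integral>\<^sup>+s. ennreal (1 / p * exp (- (1 / p) * s)) * indicator {0<..} s * indicator {u x..} s \<partial>lborel) * indicator ?B x"
        by (intro nn_integral_multc) measurable
      then show "ennreal (exp (- (1 / p) * u x)) * indicator ?B x
        = (\<integral>\<^sup>+s. ennreal (1 / p * exp (- (1 / p) * s)) * indicator {0<..} s * indicator {u x..} s * indicator ?B x \<partial>lborel)"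
        unfolding nn_integral_exp_tail[OF u0] by (rule sym)
    qed
    also have "\<dots> = (\<integral>\<^sup>+s. \<integral>\<^sup>+x. ennreal (1 / p * exp (- (1 / p) * s)) * indicator {0<..} s * indicator {u x..} s * indicator ?B x \<partial>?L \<partial>lborel)"
    proof (rule Fubini'[symmetric])
      have "(\<lambda>(x, s). ennreal (1 / p * exp (- (1 / p) * s)) * indicator {0<..} s * indicator {(x, s) \<in> space (?L \<Otimes>\<^sub>M lborel). u x \<le> s} (x, s) * indicator ?B x) \<in> borel_measurable (?L \<Otimes>\<^sub>M lborel)"
        by measurable
      also have "?this \<longleftrightarrow> (\<lambda>(x, s). ennreal (1 / p * exp (- (1 / p) * s)) * indicator {0<..} s * indicator {u x..} s * indicator ?B x) \<in> borel_measurable (?L \<Otimes>\<^sub>M lborel)"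
        by (intro measurable_cong) (auto split: split_indicator simp: space_pair_measure)
      finally show "(\<lambda>(x, s). ennreal (1 / p * exp (- (1 / p) * s)) * indicator {0<..} s * indicator {u x..} s * indicator ?B x) \<in> borel_measurable (?L \<Otimes>\<^sub>M lborel)" .
    qed
    also have "\<dots> = (\<integral>\<^sup>+s. ennreal (1 / p * exp (- (1 / p) * s)) * indicator {0<..} s * cone_vol A s \<partial>lborel)"
    proof (intro nn_integral_cong)
      fix s :: real
      have "(\<integral>\<^sup>+x. ennreal (1 / p * exp (- (1 / p) * s)) * indicator {0<..} s * indicator {u x..} s * indicator ?B x \<partial>?L)
        = (\<integral>\<^sup>+x. ennreal (1 / p * exp (- (1 / p) * s)) * indicator {0<..} s * indicator {x \<in> space ?L. u x \<le> s \<and> norm_ratio p n x \<in> A} x \<partial>?L)"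
        by (intro nn_integral_cong) (auto split: split_indicator)
      also have "\<dots> = ennreal (1 / p * exp (- (1 / p) * s)) * indicator {0<..} s * cone_vol A s"
        using cone_measurable[OF A, of s] unfolding cone_vol_def u_def by (subst nn_integral_cmult) auto
      finally show "(\<integral>\<^sup>+x. ennreal (1 / p * exp (- (1 / p) * s)) * indicator {0<..} s * indicator {u x..} s * indicator ?B x \<partial>?L)
        = ennreal (1 / p * exp (- (1 / p) * s)) * indicator {0<..} s * cone_vol A s" .
    qed
    also have "\<dots> = (\<integral>\<^sup>+s. ennreal (1 / p * exp (- (1 / p) * s)) * indicator {0<..} s * ennreal (s powr (real n / p)) * cone_vol A 1 \<partial>lborel)"
    proof (intro nn_integral_cong)
      fix s :: real
      show "ennreal (1 / p * exp (- (1 / p) * s)) * indicator {0<..} s * cone_vol A s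
        = ennreal (1 / p * exp (- (1 / p) * s)) * indicator {0<..} s * ennreal (s powr (real n / p)) * cone_vol A 1"
      proof (cases "s > 0")
        case True
        then show ?thesis by (subst cone_vol_scale[OF A]) (auto simp: mult.assoc)
      qed simp
    qed
    also have "\<dots> = J * cone_vol A 1"
      unfolding J_def by (intro nn_integral_multc) measurable
    finally show ?thesis by (simp add: mult.assoc)
  qed
  then show ?thesis by (rule that)
qed

lemma gauss_vec_norm_ratio:
  assumes A: "A \<in> sets borel"
  shows "emeasure (gauss_vec n p) {x \<in> space (gauss_vec n p). norm_ratio p n x \<in> A} = cone_vol A 1 / cone_vol UNIV 1"
    and "cone_vol UNIV 1 \<noteq> 0" "cone_vol UNIV 1 \<noteq> \<infinity>"
proof -
  interpret G: prob_space "gauss_vec n p" by (rule prob_space_gauss_vec[OF p])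
  obtain C where C: "\<And>A. A \<in> sets borel \<Longrightarrow>
    emeasure (gauss_vec n p) {x \<in> space (gauss_vec n p). norm_ratio p n x \<in> A} = C * cone_vol A 1"
    using gauss_vec_cone by blast
  have one: "C * cone_vol UNIV 1 = 1" using C[of UNIV] G.emeasure_space_1 by simp
  show nz: "cone_vol UNIV 1 \<noteq> 0" using one by auto
  show fin: "cone_vol UNIV 1 \<noteq> \<infinity>"
  proof
    assume inf: "cone_vol UNIV 1 = \<infinity>"
    then show False using one by (cases "C = 0") (auto simp: ennreal_mult_top)
  qed
  have "cone_vol A 1 / cone_vol UNIV 1 = C * cone_vol UNIV 1 * cone_vol A 1 / cone_vol UNIV 1" using one by simp
  also have "\<dots> = (C * cone_vol A 1) * cone_vol UNIV 1 / cone_vol UNIV 1" by (simp only: mult_ac)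
  also have "\<dots> = C * cone_vol A 1" using nz fin by (intro mult_divide_eq_ennreal) auto
  finally show "emeasure (gauss_vec n p) {x \<in> space (gauss_vec n p). norm_ratio p n x \<in> A} = cone_vol A 1 / cone_vol UNIV 1"
    using C[OF A] by simp
qed

end

definition zero_extend :: "nat \<Rightarrow> (nat \<Rightarrow> real) \<Rightarrow> (nat \<Rightarrow> real)" where
  "zero_extend n x = (\<lambda>i. if i < n then x i else 0)"

lemma measurable_zero_extend: "zero_extend n \<in> measurable (lborel_vec {..<n}) borel"
proof (rule measurable_coordinatewise_then_product)
  fix i
  show "(\<lambda>x. zero_extend n x i) \<in> borel_measurable (lborel_vec {..<n})"
    by (cases "i < n") (auto simp: zero_extend_def intro: measurable_coordinate_lborel_vec)
qed

lemma emeasure_lborel_n: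
  assumes "B \<in> sets borel"
  shows "emeasure (lborel_n n) B = emeasure (lborel_vec {..<n}) {x \<in> space (lborel_vec {..<n}). zero_extend n x \<in> B}"
  unfolding lborel_n_def using assms measurable_zero_extend[of n]
  by (subst emeasure_distr) (auto simp: zero_extend_def[abs_def] intro!: arg_cong[where f = "emeasure _"])

lemma sets_lborel_n [simp, measurable_cong]: "sets (lborel_n n) = sets borel"
  by (simp add: lborel_n_def)

lemma measurable_coordinate_borel: "(\<lambda>x::nat \<Rightarrow> real. x i) \<in> borel_measurable borel"
  by (intro borel_measurable_continuous_onI) simp

lemma measurable_lp_norm_borel [measurable]: "lp_norm q n \<in> borel_measurable borel"
proof -
  note measurable_coordinate_borel[measurable]
  show ?thesis unfolding lp_norm_def by measurable
qed

lemma measurable_norm_ratio_borel [measurable]: "norm_ratio q n \<in> borel_measurable borel"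
  unfolding norm_ratio_def by measurable

lemma lp_ball_borel: "lp_ball p n \<in> sets borel"
proof -
  note measurable_coordinate_borel[measurable]
  have "lp_ball p n = {x \<in> space borel. (\<forall>i. i \<ge> n \<longrightarrow> x i = 0) \<and> lp_norm p n x \<le> 1}"
    by (auto simp: lp_ball_def Rn_def)
  also have "\<dots> \<in> sets borel" by measurable
  finally show ?thesis .
qed

lemma lp_norm_zero_extend: "lp_norm q n (zero_extend n x) = lp_norm q n x"
  by (rule lp_norm_cong) (simp add: zero_extend_def)

lemma lp_norm_le_iff:
  assumes "p > 0" "r > 0"
  shows "lp_norm p n x \<le> r \<longleftrightarrow> (\<Sum>i<n. \<bar>x i\<bar> powr p) \<le> r powr p"
proof -
  let ?u = "\<Sum>i<n. \<bar>x i\<bar> powr p"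
  have u: "?u \<ge> 0" by (simp add: sum_nonneg)
  have "r = (r powr p) powr (1 / p)" using assms by (simp add: powr_powr)
  then have "lp_norm p n x \<le> r \<longleftrightarrow> ?u powr (1 / p) \<le> (r powr p) powr (1 / p)" by (simp add: lp_norm_def)
  also have "\<dots> \<longleftrightarrow> ?u \<le> r powr p"
    using assms u by (auto intro: powr_mono2 powr_less_mono2 simp: not_le[symmetric]) (meson not_le powr_less_mono2 powr_ge_zero zero_less_divide_1_iff)
  finally show ?thesis .
qed

text \<open>Under the uniform distribution the law of the norm ratio is the normalized cone volume by definition,
  and this is its law under the generalized Gaussian distribution as well. The law of the norm follows
  from homogeneity.\<close>

lemma uniform_lp_ball:
  assumes p: "p > 0" and n: "n \<ge> 1"
  shows "A \<in> sets borel \<Longrightarrow> emeasure (uniform_measure (lborel_n n) (lp_ball p n)) {x. norm_ratio p n x \<in> A}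
      = emeasure (gauss_vec n p) {x \<in> space (gauss_vec n p). norm_ratio p n x \<in> A}"
    and "0 < r \<Longrightarrow> r \<le> 1 \<Longrightarrow> emeasure (uniform_measure (lborel_n n) (lp_ball p n)) {x. lp_norm p n x \<le> r} = ennreal (r ^ n)"
proof -
  let ?L = "lborel_vec {..<n}"
  have ratio: "norm_ratio p n (zero_extend n x) = norm_ratio p n x" for x
    by (simp add: norm_ratio_def lp_norm_zero_extend)
  have ball: "zero_extend n x \<in> lp_ball p n \<longleftrightarrow> (\<Sum>i<n. \<bar>x i\<bar> powr p) \<le> 1" for x
    using lp_norm_le_iff[of p 1 n x] p by (simp add: lp_ball_def lp_norm_zero_extend) (simp add: Rn_def zero_extend_def)
  have vol: "emeasure (lborel_n n) (lp_ball p n) = cone_vol p n UNIV 1"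
    unfolding emeasure_lborel_n[OF lp_ball_borel] cone_vol_def[OF p n] by (simp add: ball)
  {
    assume A[measurable]: "A \<in> sets borel"
    have "{x \<in> space borel. norm_ratio p n x \<in> A} \<in> sets borel" by measurable
    then have S: "{x. norm_ratio p n x \<in> A} \<in> sets borel" by simp
    have "emeasure (uniform_measure (lborel_n n) (lp_ball p n)) {x. norm_ratio p n x \<in> A} = cone_vol p n A 1 / cone_vol p n UNIV 1"
      using S lp_ball_borel[of p n] by (simp add: emeasure_lborel_n sets.Int vol) (simp add: cone_vol_def[OF p n] ball ratio)
    then show "emeasure (uniform_measure (lborel_n n) (lp_ball p n)) {x. norm_ratio p n x \<in> A}
      = emeasure (gauss_vec n p) {x \<in> space (gauss_vec n p). norm_ratio p n x \<in> A}"
      unfolding gauss_vec_norm_ratio(1)[OF p n A] .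
  }
  assume r: "0 < r" "r \<le> 1"
  have "{x \<in> space borel. lp_norm p n x \<le> r} \<in> sets borel" by measurable
  then have S: "{x. lp_norm p n x \<le> r} \<in> sets borel" by simp
  have "r powr p \<le> 1" using r p powr_mono2[of p r 1] by simp
  moreover have "lp_norm p n (zero_extend n x) \<le> r \<longleftrightarrow> (\<Sum>i<n. \<bar>x i\<bar> powr p) \<le> r powr p" for x
    by (simp only: lp_norm_zero_extend lp_norm_le_iff[OF p r(1)])
  ultimately have "{x \<in> space ?L. zero_extend n x \<in> lp_ball p n \<inter> {x. lp_norm p n x \<le> r}} = {x \<in> space ?L. (\<Sum>i<n. \<bar>x i\<bar> powr p) \<le> r powr p \<and> norm_ratio p n x \<in> UNIV}"
    by (auto simp: ball)
  then have "emeasure (uniform_measure (lborel_n n) (lp_ball p n)) {x. lp_norm p n x \<le> r} = cone_vol p n UNIV (r powr p) / cone_vol p n UNIV 1"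
    using S lp_ball_borel[of p n] by (simp only: emeasure_uniform_measure sets_lborel_n emeasure_lborel_n sets.Int vol cone_vol_def[OF p n])
  also have "cone_vol p n UNIV (r powr p) = ennreal ((r powr p) powr (real n / p)) * cone_vol p n UNIV 1"
    using r by (intro cone_vol_scale[OF p n]) auto
  also have "(r powr p) powr (real n / p) = r ^ n" using r p by (simp add: powr_powr powr_realpow)
  also have "ennreal (r ^ n) * cone_vol p n UNIV 1 / cone_vol p n UNIV 1 = ennreal (r ^ n)"
    using gauss_vec_norm_ratio(2,3)[OF p n, of UNIV] by (intro mult_divide_eq_ennreal) auto
  finally show "emeasure (uniform_measure (lborel_n n) (lp_ball p n)) {x. lp_norm p n x \<le> r} = ennreal (r ^ n)" .
qed

section \<open>Orthogonal projections\<close>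

lemma inner_n_simps:
  "inner_n n (x + y) z = inner_n n x z + inner_n n y z"
  "inner_n n x (y + z) = inner_n n x y + inner_n n x z"
  "inner_n n (x - y) z = inner_n n x z - inner_n n y z"
  "inner_n n x (y - z) = inner_n n x y - inner_n n x z"
  "inner_n n (c *\<^sub>R x) z = c * inner_n n x z"
  "inner_n n x (c *\<^sub>R z) = c * inner_n n x z"
  by (simp_all add: inner_n_def scaleR_fun_def distrib_left distrib_right left_diff_distrib right_diff_distrib
      sum.distrib sum_subtractf sum_distrib_left mult.left_commute mult.assoc)

lemma inner_n_commute: "inner_n n x y = inner_n n y x"
  by (simp add: inner_n_def mult.commute)

lemma inner_n_self_nonneg: "inner_n n x x \<ge> 0"
  by (auto simp: inner_n_def intro!: sum_nonneg)

lemma inner_n_self_eq_0: "inner_n n x x = 0 \<longleftrightarrow> (\<forall>i<n. x i = 0)"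
  by (auto simp: inner_n_def sum_nonneg_eq_0_iff)

lemma Rn_eqI: "x \<in> Rn n \<Longrightarrow> y \<in> Rn n \<Longrightarrow> (\<And>i. i < n \<Longrightarrow> x i = y i) \<Longrightarrow> x = y"
  by (auto simp: Rn_def fun_eq_iff) (metis not_le)

lemma subspace_Rn: "subspace (Rn n)"
  by (auto simp: subspace_def Rn_def scaleR_fun_def)

definition unit_vec :: "nat \<Rightarrow> nat \<Rightarrow> real" where
  "unit_vec j = (\<lambda>l. if l = j then 1 else 0)"

lemma inner_n_unit_vec: "j < n \<Longrightarrow> inner_n n x (unit_vec j) = x j"
  by (simp add: inner_n_def unit_vec_def if_distrib[of "\<lambda>c. _ * c"] cong: if_cong)

lemma dim_Rn: "dim (Rn j) = j"
proof -
  have basis: "independent (unit_vec ` {..<j}) \<and> span (unit_vec ` {..<j}) = Rn j"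
  proof (induction j)
    case 0
    have "Rn 0 = {0}" by (auto simp: Rn_def)
    then show ?case by (simp add: independent_empty)
  next
    case (Suc j)
    have notin: "unit_vec j \<notin> Rn j" by (simp add: Rn_def unit_vec_def)
    have "independent (insert (unit_vec j) (unit_vec ` {..<j}))"
      using Suc notin by (simp add: independent_insert)
    moreover have "span (insert (unit_vec j) (unit_vec ` {..<j})) = Rn (Suc j)"
    proof
      have "unit_vec i \<in> Rn (Suc j)" if "i \<le> j" for i using that by (simp add: Rn_def unit_vec_def)
      then show "span (insert (unit_vec j) (unit_vec ` {..<j})) \<subseteq> Rn (Suc j)"
        by (intro span_minimal subspace_Rn) auto
      show "Rn (Suc j) \<subseteq> span (insert (unit_vec j) (unit_vec ` {..<j}))"
      proof
        fix x assume x: "x \<in> Rn (Suc j)"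
        have "x - x j *\<^sub>R unit_vec j \<in> Rn j"
          using x by (auto simp: Rn_def unit_vec_def scaleR_fun_def)
        then have "x - x j *\<^sub>R unit_vec j \<in> span (unit_vec ` {..<j})" using Suc by simp
        then show "x \<in> span (insert (unit_vec j) (unit_vec ` {..<j}))" by (auto simp: span_insert)
      qed
    qed
    ultimately show ?case by (simp add: lessThan_Suc)
  qed
  have inj: "inj_on unit_vec {..<j}"
  proof (rule inj_onI)
    fix a b assume "unit_vec a = unit_vec b"
    then have "unit_vec a a = unit_vec b a" by simp
    then show "a = b" by (simp add: unit_vec_def split: if_splits)
  qed
  have "dim (Rn j) = card (unit_vec ` {..<j})"
    using basis by (intro dim_eq_card) (simp_all add: span_span span_eq_iff[THEN iffD2, OF subspace_Rn])
  then show ?thesis using inj by (simp add: card_image)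
qed

lemma householder_alt:
  assumes "w \<in> Rn n"
  shows "householder n w x = x - (2 * inner_n n x w / inner_n n w w) *\<^sub>R w"
  using assms by (auto simp: householder_def scaleR_fun_def fun_eq_iff Rn_def)

lemma linear_householder: "w \<in> Rn n \<Longrightarrow> linear (householder n w)"
  by (rule linearI) (simp_all add: householder_alt inner_n_simps algebra_simps add_divide_distrib)

lemma householder_involution:
  assumes "w \<in> Rn n" "inner_n n w w \<noteq> 0"
  shows "householder n w (householder n w x) = x"
  using assms inner_n_householder(2)[OF assms(2), of x]
  by (simp add: householder_alt[of w n "householder n w x"]) (simp add: householder_alt)

lemma householder_in_Rn: "w \<in> Rn n \<Longrightarrow> householder n w x \<in> Rn n \<longleftrightarrow> x \<in> Rn n"
  by (simp add: Rn_def householder_def)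

text \<open>For vectors of equal length \<open>\<langle>v - v', v - v'\<rangle> = 2 \<langle>v, v - v'\<rangle>\<close>, so the reflection subtracts \<open>v - v'\<close> once.\<close>

lemma householder_maps:
  fixes v v' :: "nat \<Rightarrow> real"
  assumes eq: "inner_n n v v = inner_n n v' v'" and ne: "inner_n n (v - v') (v - v') \<noteq> 0" and Rn: "v - v' \<in> Rn n"
  shows "householder n (v - v') v = v'"
proof -
  have "inner_n n (v - v') (v - v') = 2 * inner_n n v (v - v')"
    using eq by (simp add: inner_n_simps inner_n_commute[of n v' v])
  then have "2 * inner_n n v (v - v') / inner_n n (v - v') (v - v') = 1" using ne by simp
  then show ?thesis unfolding householder_alt[OF Rn] by simp
qed

text \<open>Compositions of reflections are orthogonal, act transitively on subspaces of equal dimension and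
  preserve the Gaussian law.\<close>

inductive_set reflections :: "nat \<Rightarrow> ((nat \<Rightarrow> real) \<Rightarrow> (nat \<Rightarrow> real)) set" for n where
  id: "(\<lambda>x. x) \<in> reflections n"
| step: "U \<in> reflections n \<Longrightarrow> w \<in> Rn n \<Longrightarrow> inner_n n w w \<noteq> 0 \<Longrightarrow> (\<lambda>x. householder n w (U x)) \<in> reflections n"

lemma reflections_linear: "U \<in> reflections n \<Longrightarrow> linear U"
proof (induction rule: reflections.induct)
  case id
  show ?case by (rule linear_ident)
next
  case (step U w)
  then show ?case using linear_compose[OF step.IH linear_householder[OF step.hyps(2)]] by (simp add: o_def)
qed

lemma reflections_inner: "U \<in> reflections n \<Longrightarrow> inner_n n (U x) (U y) = inner_n n x y"
  by (induction rule: reflections.induct) (auto simp: inner_n_householder)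

lemma reflections_Rn: "U \<in> reflections n \<Longrightarrow> U x \<in> Rn n \<longleftrightarrow> x \<in> Rn n"
  by (induction rule: reflections.induct) (auto simp: householder_in_Rn)

lemma reflections_bij: "U \<in> reflections n \<Longrightarrow> bij U"
proof (induction rule: reflections.induct)
  case id
  show ?case by (simp add: bij_def inj_def)
next
  case (step U w)
  have "bij (householder n w)" by (rule involuntory_imp_bij) (rule householder_involution[OF step.hyps(2,3)])
  from bij_comp[OF step.IH this] show ?case by (simp add: o_def)
qed

lemma nn_integral_gauss_vec_reflections:
  "U \<in> reflections n \<Longrightarrow> f \<in> borel_measurable (lborel_vec {..<n}) \<Longrightarrow>
     (\<integral>\<^sup>+x. f (U x) \<partial>gauss_vec n 2) = (\<integral>\<^sup>+x. f x \<partial>gauss_vec n 2)"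
proof (induction arbitrary: f rule: reflections.induct)
  case (step U w)
  have "(\<integral>\<^sup>+x. f (householder n w (U x)) \<partial>gauss_vec n 2) = (\<integral>\<^sup>+x. f (householder n w x) \<partial>gauss_vec n 2)"
    using step.prems by (intro step.IH measurable_compose[OF measurable_householder])
  also have "\<dots> = (\<integral>\<^sup>+x. f x \<partial>gauss_vec n 2)" using step by (intro nn_integral_gauss_vec_householder)
  finally show ?case .
qed simp

text \<open>Reflections along vectors that vanish in the first \<open>j\<close> coordinates fix \<open>Rn j\<close>. One of them
  rotates a further vector of the subspace to the next coordinate axis.\<close>

lemma reflect_one_more_coordinate:
  assumes E: "subspace E" "E \<subseteq> Rn n" and U: "U \<in> reflections n" and j: "Rn j \<subseteq> U ` E" "U ` E \<noteq> Rn j"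
  shows "\<exists>V\<in>reflections n. Rn (Suc j) \<subseteq> V ` E"
proof -
  define F where "F = U ` E"
  have F: "subspace F" "F \<subseteq> Rn n" "Rn j \<subseteq> F" "F \<noteq> Rn j"
    using j E reflections_Rn[OF U] linear_subspace_image[OF reflections_linear[OF U] E(1)] by (auto simp: F_def)
  obtain v0 where v0: "v0 \<in> F" "v0 \<notin> Rn j" using F by auto
  define v where "v = v0 - (\<lambda>i. if i < j then v0 i else 0)"
  have "(\<lambda>i. if i < j then v0 i else 0) \<in> F" using F(3) by (auto simp: Rn_def)
  then have vF: "v \<in> F" unfolding v_def using F(1) v0(1) by (intro subspace_diff)
  have v_low: "v i = 0" if "i < j" for i using that by (simp add: v_def)
  obtain m where m: "m \<ge> j" "v m \<noteq> 0" using v0(2) by (auto simp: Rn_def v_def)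
  have vn: "v \<in> Rn n" using vF F(2) by auto
  have mn: "m < n" using vn m(2) by (auto simp: Rn_def not_le[symmetric])
  have vv: "inner_n n v v > 0"
    using inner_n_self_nonneg[of n v] inner_n_self_eq_0[of n v] m(2) mn by (metis less_eq_real_def)
  define \<alpha> where "\<alpha> = sqrt (inner_n n v v)"
  have \<alpha>: "\<alpha> > 0" "\<alpha> * \<alpha> = inner_n n v v" using vv by (auto simp: \<alpha>_def)
  have jn: "j < n" using m mn by simp
  let ?e = "\<alpha> *\<^sub>R unit_vec j"
  have ee: "inner_n n ?e ?e = inner_n n v v"
    using jn \<alpha> by (simp add: inner_n_simps inner_n_unit_vec) (simp add: unit_vec_def)
  have en: "?e \<in> Rn n" using jn by (auto simp: Rn_def unit_vec_def scaleR_fun_def)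
  let ?w = "v - ?e"
  have wn: "?w \<in> Rn n" using subspace_diff[OF subspace_Rn vn en] .
  have "\<exists>V\<in>reflections n. ?e \<in> V ` E \<and> Rn j \<subseteq> V ` E"
  proof (cases "inner_n n ?w ?w = 0")
    case True
    then have "v = ?e" using wn by (intro Rn_eqI[OF vn en]) (auto simp: inner_n_self_eq_0)
    then show ?thesis using vF F(3) U F_def by auto
  next
    case False
    have "?e = householder n ?w v" using householder_maps[OF ee[symmetric] False wn] by simp
    moreover have "x = householder n ?w x" if "x \<in> Rn j" for x
    proof -
      have "x i * ?w i = 0" for i using that v_low by (cases "i < j") (auto simp: Rn_def scaleR_fun_def unit_vec_def)
      then have "inner_n n x ?w = 0" unfolding inner_n_def by (intro sum.neutral) auto
      then show ?thesis by (simp add: householder_alt[OF wn])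
    qed
    ultimately have "?e \<in> (\<lambda>x. householder n ?w (U x)) ` E" "Rn j \<subseteq> (\<lambda>x. householder n ?w (U x)) ` E"
      using vF F(3) F_def by (auto simp: image_iff)
    then show ?thesis by (intro bexI[OF _ reflections.step[OF U wn False]] conjI)
  qed
  then obtain V where V: "V \<in> reflections n" "?e \<in> V ` E" "Rn j \<subseteq> V ` E" by blast
  have sub: "subspace (V ` E)"
    by (rule linear_subspace_image[OF reflections_linear[OF V(1)] E(1)])
  have "Rn (Suc j) \<subseteq> V ` E"
  proof
    fix x assume x: "x \<in> Rn (Suc j)"
    have "x - (x j / \<alpha>) *\<^sub>R ?e \<in> Rn j"
      using x \<alpha>(1) by (auto simp: Rn_def unit_vec_def scaleR_fun_def)
    then have "(x - (x j / \<alpha>) *\<^sub>R ?e) + (x j / \<alpha>) *\<^sub>R ?e \<in> V ` E"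
      using V(3) by (intro subspace_add[OF sub] subspace_scale[OF sub V(2)]) blast
    then show "x \<in> V ` E" by simp
  qed
  then show ?thesis using V(1) by blast
qed

lemma dim_reflections: "dim (U ` E) = dim E" if U: "U \<in> reflections n"
proof -
  obtain B where B: "B \<subseteq> E" "independent B" "E \<subseteq> span B" "card B = dim E" by (rule basis_exists)
  have lin: "linear U" and inj: "inj U" using reflections_linear[OF U] reflections_bij[OF U] by (auto simp: bij_def)
  have "U ` E \<subseteq> span (U ` B)" using B(3) linear_span_image[OF lin, of B] by auto
  moreover have "independent (U ` B)" by (rule linear_independent_injective_image[OF lin B(2) inj_on_subset[OF inj]]) auto
  moreover have "card (U ` B) = dim E" using B(4) inj by (simp add: card_image inj_on_subset[OF inj])
  ultimately show ?thesis using B(1) by (intro dim_unique[of "U ` B"]) auto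
qed

text \<open>Moving as many coordinate axes into the subspace as possible exhausts it, which avoids the
  choice of an orthonormal basis.\<close>

lemma reflect_to_Rn:
  assumes E: "E \<in> grassmannian n k"
  obtains U where "U \<in> reflections n" "U ` E = Rn k" "k \<le> n"
proof -
  have sE: "subspace E" "E \<subseteq> Rn n" "dim E = k" using E by (auto simp: grassmannian_def)
  define P where "P = (\<lambda>j. \<exists>U\<in>reflections n. Rn j \<subseteq> U ` E)"
  have bound: "j \<le> n" if "P j" for j
  proof (rule ccontr)
    assume "\<not> j \<le> n"
    then have "unit_vec n \<in> Rn j" by (simp add: Rn_def unit_vec_def)
    moreover obtain U where U: "U \<in> reflections n" "Rn j \<subseteq> U ` E" using \<open>P j\<close> by (auto simp: P_def)
    ultimately obtain y where "y \<in> E" "unit_vec n = U y" by blast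
    then have "unit_vec n \<in> Rn n" using sE(2) reflections_Rn[OF U(1), of y] by auto
    then show False by (auto simp: Rn_def unit_vec_def)
  qed
  have P0: "P 0"
  proof -
    have "Rn 0 = {0}" by (auto simp: Rn_def)
    then show ?thesis unfolding P_def using reflections.id[of n] subspace_0[OF sE(1)] by (auto intro!: bexI[of _ "\<lambda>x. x"])
  qed
  define j where "j = (GREATEST j. P j)"
  have "P j" unfolding j_def by (rule GreatestI_nat[of P, OF P0]) (use bound in blast)
  then obtain U where U: "U \<in> reflections n" "Rn j \<subseteq> U ` E" by (auto simp: P_def)
  have eq: "U ` E = Rn j"
  proof (rule ccontr)
    assume "U ` E \<noteq> Rn j"
    then have "P (Suc j)" unfolding P_def by (rule reflect_one_more_coordinate[OF sE(1,2) U])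
    then have "Suc j \<le> j" unfolding j_def by (rule Greatest_le_nat[of P]) (use bound in blast)
    then show False by simp
  qed
  have "dim (U ` E) = dim E" by (rule dim_reflections[OF U(1)])
  then have "j = k" using dim_Rn[of j] sE(3) eq by simp
  then show ?thesis using that[OF U(1)] eq bound[OF \<open>P j\<close>] by simp
qed

lemma orth_proj_eqI:
  assumes E: "E \<in> grassmannian n k" and y: "y \<in> E" "\<forall>z\<in>E. inner_n n (x - y) z = 0"
  shows "orth_proj n E x = y"
  unfolding orth_proj_def
proof (rule the_equality)
  fix y' assume y': "y' \<in> E \<and> (\<forall>z\<in>E. inner_n n (x - y') z = 0)"
  have sE: "subspace E" "E \<subseteq> Rn n" using E by (auto simp: grassmannian_def)
  have d: "y' - y \<in> E" using y y' sE(1) by (auto intro: subspace_diff)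
  then have "inner_n n (x - y) (y' - y) - inner_n n (x - y') (y' - y) = 0" using y y' by simp
  then have "inner_n n (y' - y) (y' - y) = 0" by (simp add: inner_n_simps)
  then have "\<forall>i<n. y' i = y i" by (simp add: inner_n_self_eq_0)
  then show "y' = y" using y y' sE(2) by (intro Rn_eqI[of _ n]) auto
qed (use y in auto)

text \<open>After the subspace has been moved to \<open>Rn k\<close>, the projection cuts off the coordinates from \<open>k\<close> on.
  In particular orthogonal projections exist.\<close>

lemma orth_proj_reflection:
  assumes E: "E \<in> grassmannian n k" and U: "U \<in> reflections n" "U ` E = Rn k" and k: "k \<le> n"
  shows "orth_proj n E x \<in> E" "\<forall>z\<in>E. inner_n n (x - orth_proj n E x) z = 0"
    and "lp_norm 2 n (orth_proj n E x) = lp_norm 2 k (U x)"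
proof -
  define t where "t = (\<lambda>i. if i < k then U x i else 0)"
  have "t \<in> Rn k" by (simp add: t_def Rn_def)
  then obtain y where y: "y \<in> E" "U y = t" using U(2) by (metis imageE)
  have orth: "inner_n n (x - y) z = 0" if "z \<in> E" for z
  proof -
    have "U z \<in> Rn k" using U(2) that by auto
    then have "(U x - t) i * U z i = 0" for i by (cases "i < k") (auto simp: t_def Rn_def)
    then have "inner_n n (U x - t) (U z) = 0" unfolding inner_n_def by (intro sum.neutral) auto
    moreover have "U x - t = U (x - y)" using y(2) reflections_linear[OF U(1)] by (simp add: linear_diff)
    ultimately show ?thesis using reflections_inner[OF U(1)] by simp
  qed
  have eq: "orth_proj n E x = y" using orth_proj_eqI[OF E y(1)] orth by blast
  show "orth_proj n E x \<in> E" "\<forall>z\<in>E. inner_n n (x - orth_proj n E x) z = 0" using eq y(1) orth by auto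
  have "inner_n n y y = inner_n n t t" using reflections_inner[OF U(1), of y y] y(2) by simp
  also have "\<dots> = (\<Sum>i<n. if i < k then U x i * U x i else 0)" unfolding inner_n_def t_def by (intro sum.cong) auto
  also have "\<dots> = (\<Sum>i\<in>{..<n} \<inter> {i. i < k}. U x i * U x i)" by (simp add: sum.inter_filter[symmetric] Int_def)
  also have "{..<n} \<inter> {i. i < k} = {..<k}" using k by auto
  finally have "inner_n n y y = inner_n k (U x) (U x)" by (simp add: inner_n_def)
  then show "lp_norm 2 n (orth_proj n E x) = lp_norm 2 k (U x)"
    unfolding eq lp_norm_def sum_abs_powr_two by simp
qed

lemma orth_proj_props:
  assumes "E \<in> grassmannian n k"
  shows "orth_proj n E x \<in> E" "\<forall>z\<in>E. inner_n n (x - orth_proj n E x) z = 0"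
proof -
  obtain U where U: "U \<in> reflections n" "U ` E = Rn k" "k \<le> n" by (rule reflect_to_Rn[OF assms])
  show "orth_proj n E x \<in> E" "\<forall>z\<in>E. inner_n n (x - orth_proj n E x) z = 0"
    using orth_proj_reflection[OF assms U] by auto
qed

lemma orth_proj_scale:
  assumes E: "E \<in> grassmannian n k"
  shows "orth_proj n E (c *\<^sub>R x) = c *\<^sub>R orth_proj n E x"
proof (rule orth_proj_eqI[OF E])
  have sE: "subspace E" using E by (auto simp: grassmannian_def)
  show "c *\<^sub>R orth_proj n E x \<in> E" using orth_proj_props(1)[OF E] sE by (intro subspace_scale)
  show "\<forall>z\<in>E. inner_n n (c *\<^sub>R x - c *\<^sub>R orth_proj n E x) z = 0"
    using orth_proj_props(2)[OF E, of x] by (simp add: scaleR_diff_right[symmetric] inner_n_simps(5) del: inner_n_simps(3))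
qed

text \<open>The entries of the matrix of the projection are measurable functions of the subspace, so this
  formula yields the measurability of the projection in both arguments.\<close>

lemma orth_proj_matrix:
  assumes E: "E \<in> grassmannian n k"
  shows "orth_proj n E x i = (\<Sum>j<n. proj_matrix n E i j * x j)"
proof -
  have sE: "subspace E" using E by (auto simp: grassmannian_def)
  define y where "y = (\<Sum>j<n. x j *\<^sub>R orth_proj n E (unit_vec j))"
  have inner_sum: "inner_n n (\<Sum>j\<in>J. g j) z = (\<Sum>j\<in>J. inner_n n (g j) z)" for J g z
  proof -
    have "inner_n n 0 z = 0" by (simp add: inner_n_def)
    then show ?thesis by (induction J rule: infinite_finite_induct) (simp_all add: inner_n_simps)
  qed
  have "orth_proj n E x = y"
  proof (rule orth_proj_eqI[OF E])
    show "y \<in> E" unfolding y_def using orth_proj_props(1)[OF E] sE by (intro subspace_sum subspace_scale) auto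
    show "\<forall>z\<in>E. inner_n n (x - y) z = 0"
    proof
      fix z assume z: "z \<in> E"
      have "inner_n n (unit_vec j) z = inner_n n (orth_proj n E (unit_vec j)) z" for j
        using orth_proj_props(2)[OF E, of "unit_vec j"] z by (simp add: inner_n_simps)
      then have "inner_n n y z = (\<Sum>j<n. x j * inner_n n (unit_vec j) z)" by (simp add: y_def inner_sum inner_n_simps)
      also have "\<dots> = inner_n n x z" by (simp add: inner_n_def[of n x] inner_n_commute[of n "unit_vec _"] inner_n_unit_vec)
      finally show "inner_n n (x - y) z = 0" by (simp add: inner_n_simps)
    qed
  qed
  moreover have "(\<Sum>j\<in>J. g j) i = (\<Sum>j\<in>J. g j i)" for J and g :: "nat \<Rightarrow> nat \<Rightarrow> real"
    by (induction J rule: infinite_finite_induct) auto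
  ultimately show ?thesis by (simp add: y_def scaleR_fun_def proj_matrix_def unit_vec_def mult.commute)
qed

section \<open>The Haar measure on the Grassmannian\<close>

lemma space_grassmannian_borel [simp]: "space (grassmannian_borel n k) = grassmannian n k"
  by (simp add: grassmannian_borel_def)

lemma measurable_proj_matrix: "(\<lambda>E. proj_matrix n E i j) \<in> borel_measurable (grassmannian_borel n k)"
proof -
  have "proj_matrix n \<in> borel_measurable (grassmannian_borel n k)"
    unfolding grassmannian_borel_def by (rule measurable_vimage_algebra1) simp
  then show ?thesis by (rule measurable_product_then_coordinatewise[OF measurable_product_then_coordinatewise])
qed

lemma measurable_orth_proj:
  assumes E: "E \<in> measurable N (grassmannian_borel n k)"
    and x: "\<And>j. j < n \<Longrightarrow> (\<lambda>\<omega>. x \<omega> j) \<in> borel_measurable N"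
  shows "(\<lambda>\<omega>. orth_proj n (E \<omega>) (x \<omega>) i) \<in> borel_measurable N"
proof -
  have "orth_proj n (E \<omega>) (x \<omega>) i = (\<Sum>j<n. proj_matrix n (E \<omega>) i j * x \<omega> j)" if "\<omega> \<in> space N" for \<omega>
    using measurable_space[OF E that] by (intro orth_proj_matrix) simp
  then have "(\<lambda>\<omega>. orth_proj n (E \<omega>) (x \<omega>) i) \<in> borel_measurable N \<longleftrightarrow> (\<lambda>\<omega>. \<Sum>j<n. proj_matrix n (E \<omega>) i j * x \<omega> j) \<in> borel_measurable N"
    by (intro measurable_cong) simp
  then show ?thesis
    using measurable_compose[OF E measurable_proj_matrix] x by (auto intro!: borel_measurable_sum borel_measurable_times)
qed

definition proj_ratio :: "nat \<Rightarrow> (nat \<Rightarrow> real) set \<Rightarrow> (nat \<Rightarrow> real) \<Rightarrow> real" where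
  "proj_ratio n E x = lp_norm 2 n (orth_proj n E x) / lp_norm 2 n x"

lemma measurable_lp_norm_compose:
  assumes x: "\<And>j. j < n \<Longrightarrow> (\<lambda>\<omega>. x \<omega> j) \<in> borel_measurable N"
  shows "(\<lambda>\<omega>. lp_norm q n (x \<omega>)) \<in> borel_measurable N"
  unfolding lp_norm_def using x by (intro powr_real_measurable borel_measurable_sum borel_measurable_abs borel_measurable_const) auto

lemma measurable_proj_ratio:
  assumes E: "E \<in> measurable N (grassmannian_borel n k)"
    and x: "\<And>j. j < n \<Longrightarrow> (\<lambda>\<omega>. x \<omega> j) \<in> borel_measurable N"
  shows "(\<lambda>\<omega>. lp_norm 2 n (orth_proj n (E \<omega>) (x \<omega>))) \<in> borel_measurable N"
    and "(\<lambda>\<omega>. proj_ratio n (E \<omega>) (x \<omega>)) \<in> borel_measurable N"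
  unfolding proj_ratio_def
  by (intro borel_measurable_divide measurable_lp_norm_compose measurable_orth_proj[OF E] x; assumption)+

lemma lp_norm_two: "lp_norm 2 n x = sqrt (inner_n n x x)"
  unfolding lp_norm_def sum_abs_powr_two by (simp add: powr_half_sqrt inner_n_self_nonneg)

lemma lp_norm_eq_0: "q > 0 \<Longrightarrow> lp_norm q n x = 0 \<longleftrightarrow> (\<forall>i<n. x i = 0)"
  by (auto simp: lp_norm_def sum_nonneg_eq_0_iff)

lemma lp_norm_nonneg: "lp_norm q n x \<ge> 0"
  by (simp add: lp_norm_def)

lemma orth_proj_cong:
  assumes "\<And>i. i < n \<Longrightarrow> x i = x' i"
  shows "orth_proj n E x = orth_proj n E x'"
proof -
  have "inner_n n (x - y) z = inner_n n (x' - y) z" for y z using assms by (simp add: inner_n_def)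
  then show ?thesis by (simp add: orth_proj_def)
qed

lemma reflections_orth_group: "U \<in> reflections n \<Longrightarrow> U \<in> orth_group n"
  unfolding orth_group_def using reflections_linear reflections_inner reflections_Rn by auto

lemma reflections_grassmannian:
  assumes U: "U \<in> reflections n" and E: "E \<in> grassmannian n k"
  shows "U ` E \<in> grassmannian n k"
  using E dim_reflections[OF U, of E] linear_subspace_image[OF reflections_linear[OF U]] reflections_Rn[OF U]
  by (auto simp: grassmannian_def)

lemma orth_proj_equivariant:
  assumes U: "U \<in> reflections n" and E: "E \<in> grassmannian n k"
  shows "orth_proj n (U ` E) (U x) = U (orth_proj n E x)"
proof (rule orth_proj_eqI[OF reflections_grassmannian[OF U E]])
  show "U (orth_proj n E x) \<in> U ` E" using orth_proj_props(1)[OF E] by auto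
  have "inner_n n (U x - U (orth_proj n E x)) (U z) = inner_n n (x - orth_proj n E x) z" for z
    using reflections_inner[OF U, of "x - orth_proj n E x" z] reflections_linear[OF U] by (simp add: linear_diff)
  then show "\<forall>z\<in>U ` E. inner_n n (U x - U (orth_proj n E x)) z = 0" using orth_proj_props(2)[OF E, of x] by auto
qed

lemma measurable_householder_image:
  assumes w: "w \<in> Rn n" "inner_n n w w \<noteq> 0"
  shows "(\<lambda>E. householder n w ` E) \<in> measurable (grassmannian_borel n k) (grassmannian_borel n k)"
proof -
  let ?H = "householder n w" and ?G = "grassmannian_borel n k"
  have H: "?H \<in> reflections n" using reflections.step[OF reflections.id w] by simp
  have mat: "proj_matrix n (?H ` E) i j = ?H (orth_proj n E (?H (unit_vec j))) i" if "E \<in> grassmannian n k" for E i j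
  proof -
    have "unit_vec j = ?H (?H (unit_vec j))" using householder_involution[OF w] by simp
    then show ?thesis
      using orth_proj_equivariant[OF H that, of "?H (unit_vec j)"] by (simp add: proj_matrix_def unit_vec_def)
  qed
  have P: "(\<lambda>E. orth_proj n E y l) \<in> borel_measurable ?G" for y l
    by (rule measurable_orth_proj[OF measurable_ident_sets[OF refl]]) auto
  have "(\<lambda>E. proj_matrix n (?H ` E)) \<in> borel_measurable ?G"
  proof (intro measurable_coordinatewise_then_product)
    fix i j
    have "(\<lambda>E. ?H (orth_proj n E (?H (unit_vec j))) i) \<in> borel_measurable ?G"
      unfolding householder_def[of n w "orth_proj n _ _"] inner_n_def[of n "orth_proj n _ _"] using P
      by (cases "i < n") (auto intro!: borel_measurable_diff borel_measurable_times borel_measurable_divide borel_measurable_sum)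
    also have "?this \<longleftrightarrow> (\<lambda>E. proj_matrix n (?H ` E) i j) \<in> borel_measurable ?G"
      by (intro measurable_cong) (simp add: mat)
    finally show "(\<lambda>E. proj_matrix n (?H ` E) i j) \<in> borel_measurable ?G" .
  qed
  then show ?thesis
    unfolding grassmannian_borel_def[of n k, THEN arg_cong, of "\<lambda>G. measurable ?G G"]
    by (intro measurable_vimage_algebra2) (auto intro: reflections_grassmannian[OF H])
qed

text \<open>The reflection that exchanges \<open>x\<close> and \<open>x'\<close> also acts on subspaces and preserves the Haar measure.\<close>

lemma haar_norm_invariant:
  assumes haar: "is_grassmannian_haar n k \<mu>" and B: "B \<in> sets borel"
    and x: "x \<in> Rn n" "x' \<in> Rn n" "inner_n n x x = inner_n n x' x'"
  shows "emeasure \<mu> {E \<in> space \<mu>. lp_norm 2 n (orth_proj n E x) \<in> B} = emeasure \<mu> {E \<in> space \<mu>. lp_norm 2 n (orth_proj n E x') \<in> B}"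
proof (cases "x = x'")
  case False
  let ?w = "x - x'"
  have sp: "space \<mu> = grassmannian n k" and st: "sets \<mu> = sets (grassmannian_borel n k)"
    using haar by (auto simp: is_grassmannian_haar_def)
  have w: "?w \<in> Rn n" "inner_n n ?w ?w \<noteq> 0"
  proof -
    show "?w \<in> Rn n" using subspace_diff[OF subspace_Rn x(1,2)] .
    show "inner_n n ?w ?w \<noteq> 0"
    proof
      assume "inner_n n ?w ?w = 0"
      then have "\<forall>i<n. x i = x' i" by (simp add: inner_n_self_eq_0)
      then show False using False Rn_eqI[OF x(1,2)] by auto
    qed
  qed
  let ?H = "householder n ?w"
  have H: "?H \<in> reflections n" using reflections.step[OF reflections.id w] by simp
  have "?H x = x'" by (rule householder_maps[OF x(3) w(2,1)])
  then have Hx: "orth_proj n (?H ` E) x' = ?H (orth_proj n E x)" if "E \<in> grassmannian n k" for E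
    using orth_proj_equivariant[OF H that, of x] by simp
  have meas: "(\<lambda>E. lp_norm 2 n (orth_proj n E y)) \<in> borel_measurable \<mu>" for y
    unfolding measurable_cong_sets[OF st refl] by (rule measurable_proj_ratio(1)[OF measurable_ident_sets[OF refl]]) auto
  have HM: "(\<lambda>E. ?H ` E) \<in> measurable \<mu> \<mu>"
    unfolding measurable_cong_sets[OF st st] by (rule measurable_householder_image[OF w])
  have inv: "distr \<mu> \<mu> (\<lambda>E. ?H ` E) = \<mu>"
    using haar reflections_orth_group[OF H] by (auto simp: is_grassmannian_haar_def)
  have S: "{E \<in> space \<mu>. lp_norm 2 n (orth_proj n E x') \<in> B} \<in> sets \<mu>"
    using meas[of x'] B by measurable
  have "emeasure \<mu> {E \<in> space \<mu>. lp_norm 2 n (orth_proj n E x') \<in> B} = emeasure (distr \<mu> \<mu> (\<lambda>E. ?H ` E)) {E \<in> space \<mu>. lp_norm 2 n (orth_proj n E x') \<in> B}"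
    by (simp only: inv)
  also have "\<dots> = emeasure \<mu> ((\<lambda>E. ?H ` E) -` {E \<in> space \<mu>. lp_norm 2 n (orth_proj n E x') \<in> B} \<inter> space \<mu>)"
    by (rule emeasure_distr[OF HM S])
  also have "(\<lambda>E. ?H ` E) -` {E \<in> space \<mu>. lp_norm 2 n (orth_proj n E x') \<in> B} \<inter> space \<mu> = {E \<in> space \<mu>. lp_norm 2 n (orth_proj n E x) \<in> B}"
    using reflections_grassmannian[OF H] by (auto simp: sp Hx lp_norm_two reflections_inner[OF H])
  finally show ?thesis ..
qed simp

lemma proj_ratio_normalize:
  assumes E: "E \<in> grassmannian n k" and x: "lp_norm 2 n x \<noteq> 0"
  shows "proj_ratio n E x = lp_norm 2 n (orth_proj n E ((1 / lp_norm 2 n x) *\<^sub>R zero_extend n x))"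
proof -
  have pos: "lp_norm 2 n x > 0" using x lp_norm_nonneg[of 2 n x] by simp
  have "orth_proj n E (zero_extend n x) = orth_proj n E x" by (rule orth_proj_cong) (simp add: zero_extend_def)
  then have "lp_norm 2 n (orth_proj n E ((1 / lp_norm 2 n x) *\<^sub>R zero_extend n x)) = 1 / lp_norm 2 n x * lp_norm 2 n (orth_proj n E x)"
    unfolding orth_proj_scale[OF E] using pos by (intro lp_norm_scale) (auto simp: scaleR_fun_def)
  then show ?thesis by (simp add: proj_ratio_def)
qed

lemma haar_proj_ratio_const:
  assumes haar: "is_grassmannian_haar n k \<mu>" and B: "B \<in> sets borel"
    and x: "lp_norm 2 n x \<noteq> 0" "lp_norm 2 n x' \<noteq> 0"
  shows "emeasure \<mu> {E \<in> space \<mu>. proj_ratio n E x \<in> B} = emeasure \<mu> {E \<in> space \<mu>. proj_ratio n E x' \<in> B}"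
proof -
  let ?u = "\<lambda>x. (1 / lp_norm 2 n x) *\<^sub>R zero_extend n x"
  have sp: "space \<mu> = grassmannian n k" using haar by (auto simp: is_grassmannian_haar_def)
  have Rn: "?u x \<in> Rn n" for x by (simp add: Rn_def zero_extend_def scaleR_fun_def)
  have one: "inner_n n (?u x) (?u x) = 1" if "lp_norm 2 n x \<noteq> 0" for x
  proof -
    have "inner_n n (zero_extend n x) (zero_extend n x) = (lp_norm 2 n x)\<^sup>2"
      by (simp add: lp_norm_two inner_n_self_nonneg) (simp add: inner_n_def zero_extend_def)
    then show ?thesis using that by (simp add: inner_n_simps power2_eq_square)
  qed
  have "{E \<in> space \<mu>. proj_ratio n E x \<in> B} = {E \<in> space \<mu>. lp_norm 2 n (orth_proj n E (?u x)) \<in> B}" if "lp_norm 2 n x \<noteq> 0" for x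
    using proj_ratio_normalize[OF _ that] by (auto simp: sp)
  then show ?thesis using haar_norm_invariant[OF haar B Rn Rn, of x x'] one x by simp
qed

lemma AE_gauss_vec_nonzero:
  assumes p: "p > 0" and n: "n \<ge> 1" and q: "q > 0"
  shows "AE x in gauss_vec n p. lp_norm q n x \<noteq> 0"
proof -
  have "AE y in gen_gauss p. indicator {0::real} y = (0::ennreal)"
    using AE_gen_gauss_nonzero[of p] by eventually_elim auto
  then have zero: "(\<integral>\<^sup>+y. indicator {0::real} y \<partial>gen_gauss p) = (0::ennreal)"
    by (subst nn_integral_0_iff_AE) auto
  let ?f = "\<lambda>i::nat. if i = 0 then indicator {0::real} else (\<lambda>_. 1::ennreal)"
  have m: "(\<lambda>x. indicator {0::real} (x 0) :: ennreal) \<in> borel_measurable (gauss_vec n p)"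
    using measurable_compose[OF measurable_gauss_vec_component[of 0 n p], of "indicator {0::real} :: real \<Rightarrow> ennreal" borel] n by simp
  have "(\<integral>\<^sup>+x. indicator {0::real} (x 0) \<partial>gauss_vec n p) = (\<integral>\<^sup>+x. (\<Prod>i<n. ?f i (x i)) \<partial>gauss_vec n p)"
  proof (intro nn_integral_cong)
    fix x :: "nat \<Rightarrow> real"
    have "(\<Prod>i<n. ?f i (x i)) = ?f 0 (x 0) * (\<Prod>i\<in>{..<n} - {0}. ?f i (x i))"
      using n by (intro prod.remove) auto
    also have "(\<Prod>i\<in>{..<n} - {0}. ?f i (x i)) = 1" by (intro prod.neutral) auto
    finally show "indicator {0::real} (x 0) = (\<Prod>i<n. ?f i (x i))" by simp
  qed
  also have "\<dots> = (\<Prod>i<n. \<integral>\<^sup>+y. ?f i y \<partial>gen_gauss p)" by (rule nn_integral_gauss_vec_prod) auto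
  also have "\<dots> = 0" using zero n by (intro prod_zero bexI[of _ 0]) auto
  finally have "AE x in gauss_vec n p. indicator {0::real} (x 0) = (0::ennreal)"
    using m by (subst (asm) nn_integral_0_iff_AE) auto
  then show ?thesis
    by eventually_elim (use n q in \<open>auto simp: lp_norm_eq_0 indicator_def intro!: exI[of _ 0]\<close>)
qed

definition coord_ratio :: "nat \<Rightarrow> nat \<Rightarrow> (nat \<Rightarrow> real) \<Rightarrow> real" where
  "coord_ratio k n g = lp_norm 2 k g / lp_norm 2 n g"

lemma measurable_coord_ratio: "k \<le> n \<Longrightarrow> coord_ratio k n \<in> borel_measurable (lborel_vec {..<n})"
  unfolding coord_ratio_def
  by (intro borel_measurable_divide measurable_lp_norm_compose measurable_coordinate_lborel_vec) auto

text \<open>For a fixed subspace, a rotation to \<open>Rn k\<close> leaves the Gaussian law invariant.\<close>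

lemma gauss_vec_proj_ratio:
  assumes E: "E \<in> grassmannian n k" and B: "B \<in> sets borel"
  shows "(\<integral>\<^sup>+g. indicator B (proj_ratio n E g) \<partial>gauss_vec n 2) = (\<integral>\<^sup>+g. indicator B (coord_ratio k n g) \<partial>gauss_vec n 2 :: ennreal)"
proof -
  obtain U where U: "U \<in> reflections n" "U ` E = Rn k" "k \<le> n" by (rule reflect_to_Rn[OF E])
  have "proj_ratio n E g = coord_ratio k n (U g)" for g
    using orth_proj_reflection(3)[OF E U] by (simp add: proj_ratio_def coord_ratio_def lp_norm_two[of n] reflections_inner[OF U(1)])
  then show ?thesis
    using nn_integral_gauss_vec_reflections[OF U(1), of "\<lambda>g. indicator B (coord_ratio k n g)"]
      measurable_compose[OF measurable_coord_ratio[OF U(3)], of "indicator B :: real \<Rightarrow> ennreal" borel] B by simp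
qed

text \<open>The left-hand side is the same for all \<open>x\<close>, hence equal to its mean with respect to the Gaussian
  law. After the order of integration is exchanged, the inner integral is the same for all subspaces.\<close>

lemma haar_proj_ratio_law:
  assumes haar: "is_grassmannian_haar n k \<mu>" and n: "n \<ge> 1" and kn: "k \<le> n" and B[measurable]: "B \<in> sets borel"
    and x: "lp_norm 2 n x \<noteq> 0"
  shows "emeasure \<mu> {E \<in> space \<mu>. proj_ratio n E x \<in> B} = emeasure (gauss_vec n 2) {g \<in> space (gauss_vec n 2). coord_ratio k n g \<in> B}"
proof -
  have sp: "space \<mu> = grassmannian n k" and st: "sets \<mu> = sets (grassmannian_borel n k)" and "prob_space \<mu>"
    using haar by (auto simp: is_grassmannian_haar_def)
  interpret H: prob_space \<mu> by fact
  interpret G: prob_space "gauss_vec n 2" by (rule prob_space_gauss_vec) simp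
  interpret pair_sigma_finite "gauss_vec n 2" \<mu> ..
  have id: "(\<lambda>E. E) \<in> measurable \<mu> (grassmannian_borel n k)" using st by (intro measurable_ident_sets)
  have m1: "(\<lambda>E. proj_ratio n E y) \<in> borel_measurable \<mu>" for y
    by (rule measurable_proj_ratio(2)[OF id]) auto
  have m2: "(\<lambda>\<omega>. proj_ratio n (snd \<omega>) (fst \<omega>)) \<in> borel_measurable (gauss_vec n 2 \<Otimes>\<^sub>M \<mu>)"
    by (rule measurable_proj_ratio(2)[OF measurable_compose[OF measurable_snd id]])
       (rule measurable_compose[OF measurable_fst measurable_gauss_vec_component])
  have m3: "coord_ratio k n \<in> borel_measurable (gauss_vec n 2)"
    using measurable_coord_ratio[OF kn] by simp
  have ind: "emeasure \<mu> {E \<in> space \<mu>. proj_ratio n E y \<in> B} = (\<integral>\<^sup>+E. indicator B (proj_ratio n E y) \<partial>\<mu>)" for y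
    using m1[of y] by (subst nn_integral_indicator[symmetric]) (auto intro!: nn_integral_cong simp: indicator_def simp del: nn_integral_indicator)
  have nz: "AE g in gauss_vec n 2. lp_norm 2 n g \<noteq> 0" by (rule AE_gauss_vec_nonzero) (use n in auto)
  have "emeasure \<mu> {E \<in> space \<mu>. proj_ratio n E x \<in> B} = (\<integral>\<^sup>+g. emeasure \<mu> {E \<in> space \<mu>. proj_ratio n E x \<in> B} \<partial>gauss_vec n 2)"
    by (simp only: nn_integral_const G.emeasure_space_1) simp
  also have "\<dots> = (\<integral>\<^sup>+g. \<integral>\<^sup>+E. indicator B (proj_ratio n E g) \<partial>\<mu> \<partial>gauss_vec n 2)"
  proof (rule nn_integral_cong_AE)
    show "AE g in gauss_vec n 2. emeasure \<mu> {E \<in> space \<mu>. proj_ratio n E x \<in> B} = (\<integral>\<^sup>+E. indicator B (proj_ratio n E g) \<partial>\<mu>)"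
      using nz
    proof eventually_elim
      case (elim g)
      show ?case unfolding haar_proj_ratio_const[OF haar B x elim] by (rule ind)
    qed
  qed
  also have "\<dots> = (\<integral>\<^sup>+E. \<integral>\<^sup>+g. indicator B (proj_ratio n E g) \<partial>gauss_vec n 2 \<partial>\<mu>)"
  proof (rule Fubini'[symmetric])
    show "(\<lambda>(g, E). indicator B (proj_ratio n E g) :: ennreal) \<in> borel_measurable (gauss_vec n 2 \<Otimes>\<^sub>M \<mu>)"
      using measurable_compose[OF m2, of "indicator B :: real \<Rightarrow> ennreal" borel] by (simp add: case_prod_beta')
  qed
  also have "\<dots> = (\<integral>\<^sup>+E. (\<integral>\<^sup>+g. indicator B (coord_ratio k n g) \<partial>gauss_vec n 2) \<partial>\<mu>)"
    by (intro nn_integral_cong gauss_vec_proj_ratio[OF _ B]) (simp add: sp)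
  also have "\<dots> = (\<integral>\<^sup>+g. indicator B (coord_ratio k n g) \<partial>gauss_vec n 2)"
    by (simp only: nn_integral_const H.emeasure_space_1) simp
  also have "\<dots> = emeasure (gauss_vec n 2) {g \<in> space (gauss_vec n 2). coord_ratio k n g \<in> B}"
    using m3 by (subst nn_integral_indicator[symmetric]) (auto intro!: nn_integral_cong simp: indicator_def simp del: nn_integral_indicator)
  finally show ?thesis .
qed

lemma indep_elements_joint_law:
  assumes "prob_space M" and ind: "indep_elements M S X T Y"
  shows "distr M (S \<Otimes>\<^sub>M T) (\<lambda>\<omega>. (X \<omega>, Y \<omega>)) = distr M S X \<Otimes>\<^sub>M distr M T Y"
proof -
  interpret prob_space M by fact
  have X[measurable]: "X \<in> measurable M S" and Y[measurable]: "Y \<in> measurable M T"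
    and I: "indep_set {X -` A \<inter> space M | A. A \<in> sets S} {Y -` B \<inter> space M | B. B \<in> sets T}"
    using ind by (auto simp: indep_elements_def)
  interpret X: prob_space "distr M S X" by (rule prob_space_distr) fact
  interpret Y: prob_space "distr M T Y" by (rule prob_space_distr) fact
  show ?thesis
  proof (rule pair_measure_eqI[symmetric])
    fix A B assume A: "A \<in> sets (distr M S X)" and B: "B \<in> sets (distr M T Y)"
    have "emeasure (distr M (S \<Otimes>\<^sub>M T) (\<lambda>\<omega>. (X \<omega>, Y \<omega>))) (A \<times> B) = emeasure M ((X -` A \<inter> space M) \<inter> (Y -` B \<inter> space M))"
      using A B by (subst emeasure_distr) (auto intro!: arg_cong[where f = "emeasure M"])
    also have "\<dots> = emeasure M (X -` A \<inter> space M) * emeasure M (Y -` B \<inter> space M)"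
      unfolding emeasure_eq_measure
      by (subst indep_setD[OF I]) (use A B in \<open>auto simp: ennreal_mult\<close>)
    finally show "emeasure (distr M S X) A * emeasure (distr M T Y) B = emeasure (distr M (S \<Otimes>\<^sub>M T) (\<lambda>\<omega>. (X \<omega>, Y \<omega>))) (A \<times> B)"
      using A B by (simp add: emeasure_distr)
  qed (auto intro: X.sigma_finite_measure_axioms Y.sigma_finite_measure_axioms)
qed

text \<open>Given \<open>X\<close>, the law of the projection ratio does not depend on \<open>X\<close>; hence the two ratios are
  independent, as on the side of the Gaussian vectors.\<close>

lemma ratio_pair_law:
  assumes M: "prob_space M" and n: "n \<ge> 1" and kn: "k \<le> n" and p: "p > 0"
    and X: "distr M borel X = uniform_measure (lborel_n n) (lp_ball p n)"
    and E: "is_grassmannian_haar n k (distr M (grassmannian_borel n k) E)"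
    and ind: "indep_elements M borel X (grassmannian_borel n k) E"
  shows "distr M (borel \<Otimes>\<^sub>M borel) (\<lambda>\<omega>. (norm_ratio p n (X \<omega>), proj_ratio n (E \<omega>) (X \<omega>)))
    = distr (gauss_pair n p) (borel \<Otimes>\<^sub>M borel) (\<lambda>\<omega>. (norm_ratio p n (fst \<omega>), coord_ratio k n (snd \<omega>)))"
proof -
  interpret prob_space M by fact
  let ?G = "grassmannian_borel n k"
  have Xm: "X \<in> measurable M borel" and Em: "E \<in> measurable M ?G"
    using ind by (auto simp: indep_elements_def)
  let ?\<nu> = "distr M borel X" and ?\<mu> = "distr M ?G E"
  interpret \<nu>: prob_space ?\<nu> by (rule prob_space_distr[OF Xm])
  interpret \<mu>: prob_space ?\<mu> by (rule prob_space_distr[OF Em])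
  interpret A: prob_space "gauss_vec n p" by (rule prob_space_gauss_vec[OF p])
  interpret B: prob_space "gauss_vec n 2" by (rule prob_space_gauss_vec) simp
  have hm: "norm_ratio p n \<in> borel_measurable (gauss_vec n p)"
    unfolding norm_ratio_def[abs_def]
    by (intro borel_measurable_divide measurable_lp_norm_compose measurable_gauss_vec_component)
  have cm: "coord_ratio k n \<in> borel_measurable (gauss_vec n 2)"
    using measurable_coord_ratio[OF kn] by simp
  let ?H = "distr (gauss_vec n p) borel (norm_ratio p n)" and ?R = "distr (gauss_vec n 2) borel (coord_ratio k n)"
  interpret H: prob_space ?H by (rule A.prob_space_distr[OF hm])
  interpret R: prob_space ?R by (rule B.prob_space_distr[OF cm])
  have Xcoord: "(\<lambda>\<omega>. X \<omega> j) \<in> borel_measurable M" for j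
    using measurable_compose[OF Xm measurable_coordinate_borel] .
  have Hm: "(\<lambda>\<omega>. norm_ratio p n (X \<omega>)) \<in> borel_measurable M"
    using measurable_compose[OF Xm measurable_norm_ratio_borel] .
  have Rm: "(\<lambda>\<omega>. proj_ratio n (E \<omega>) (X \<omega>)) \<in> borel_measurable M"
    by (rule measurable_proj_ratio(2)[OF Em Xcoord])
  have nz: "AE x in ?\<nu>. lp_norm 2 n x \<noteq> 0"
  proof -
    have "emeasure ?\<nu> {x. lp_norm p n x \<le> 0} \<le> ennreal r" if r: "0 < r" "r \<le> 1" for r
    proof -
      have S: "{x. lp_norm p n x \<le> r} \<in> sets borel" using measurable_lp_norm_borel[of p n] by simp
      have "emeasure ?\<nu> {x. lp_norm p n x \<le> 0} \<le> emeasure ?\<nu> {x. lp_norm p n x \<le> r}"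
        using r S by (intro emeasure_mono) auto
      also have "\<dots> = ennreal (r ^ n)" unfolding X by (rule uniform_lp_ball(2)[OF p n r])
      also have "\<dots> \<le> ennreal r" using r n power_decreasing[of 1 n r] by (intro ennreal_leI) simp
      finally show ?thesis .
    qed
    then have small: "measure ?\<nu> {x. lp_norm p n x \<le> 0} \<le> r" if "0 < r" "r \<le> 1" for r
      using that by (simp add: \<nu>.emeasure_eq_measure)
    have "measure ?\<nu> {x. lp_norm p n x \<le> 0} \<le> 0"
    proof (rule field_le_epsilon)
      fix e :: real assume "e > 0"
      then show "measure ?\<nu> {x. lp_norm p n x \<le> 0} \<le> 0 + e" using small[of "min e 1"] by simp
    qed
    then have "emeasure ?\<nu> {x. lp_norm p n x \<le> 0} = 0" by (simp add: \<nu>.emeasure_eq_measure measure_le_0_iff)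
    moreover have "{x \<in> space ?\<nu>. \<not> lp_norm 2 n x \<noteq> 0} \<subseteq> {x. lp_norm p n x \<le> 0}"
      by (clarsimp simp: lp_norm_eq_0[of 2]) (simp add: iffD2[OF lp_norm_eq_0[OF p]])
    moreover have "{x. lp_norm p n x \<le> 0} \<in> sets ?\<nu>" using measurable_lp_norm_borel[of p n] by simp
    ultimately show ?thesis by (intro AE_I) auto
  qed
  have "distr M (borel \<Otimes>\<^sub>M borel) (\<lambda>\<omega>. (norm_ratio p n (X \<omega>), proj_ratio n (E \<omega>) (X \<omega>))) = ?H \<Otimes>\<^sub>M ?R"
  proof (rule pair_measure_eqI[symmetric])
    fix C D assume "C \<in> sets ?H" "D \<in> sets ?R"
    then have C[measurable]: "C \<in> sets borel" and D[measurable]: "D \<in> sets borel" by auto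
    have idE: "(\<lambda>E. E) \<in> measurable ?\<mu> ?G" by (intro measurable_ident_sets) simp
    have rm: "(\<lambda>z. proj_ratio n (snd z) (fst z)) \<in> borel_measurable (borel \<Otimes>\<^sub>M ?G)"
      by (rule measurable_proj_ratio(2)[OF measurable_snd]) (rule measurable_compose[OF measurable_fst measurable_coordinate_borel])
    have hb: "(\<lambda>z. norm_ratio p n (fst z)) \<in> borel_measurable (borel \<Otimes>\<^sub>M ?G)"
      by (rule measurable_compose[OF measurable_fst measurable_norm_ratio_borel])
    have f: "(\<lambda>z. indicator C (norm_ratio p n (fst z)) * indicator D (proj_ratio n (snd z) (fst z)) :: ennreal) \<in> borel_measurable (borel \<Otimes>\<^sub>M ?G)"
      using measurable_compose[OF hb, of "indicator C :: real \<Rightarrow> ennreal" borel] measurable_compose[OF rm, of "indicator D :: real \<Rightarrow> ennreal" borel]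
      by (intro borel_measurable_times_ennreal) auto
    have "emeasure (distr M (borel \<Otimes>\<^sub>M borel) (\<lambda>\<omega>. (norm_ratio p n (X \<omega>), proj_ratio n (E \<omega>) (X \<omega>)))) (C \<times> D)
      = emeasure M {\<omega> \<in> space M. norm_ratio p n (X \<omega>) \<in> C \<and> proj_ratio n (E \<omega>) (X \<omega>) \<in> D}"
      using Hm Rm by (subst emeasure_distr) (auto intro!: arg_cong[where f = "emeasure M"])
    also have "\<dots> = (\<integral>\<^sup>+\<omega>. indicator {\<omega> \<in> space M. norm_ratio p n (X \<omega>) \<in> C \<and> proj_ratio n (E \<omega>) (X \<omega>) \<in> D} \<omega> \<partial>M)"
    proof -
      have "{\<omega> \<in> space M. norm_ratio p n (X \<omega>) \<in> C \<and> proj_ratio n (E \<omega>) (X \<omega>) \<in> D} \<in> sets M"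
        using Hm Rm by measurable
      then show ?thesis by simp
    qed
    also have "\<dots> = (\<integral>\<^sup>+\<omega>. indicator C (norm_ratio p n (X \<omega>)) * indicator D (proj_ratio n (E \<omega>) (X \<omega>)) \<partial>M)"
      by (intro nn_integral_cong) (auto split: split_indicator)
    also have "\<dots> = (\<integral>\<^sup>+z. indicator C (norm_ratio p n (fst z)) * indicator D (proj_ratio n (snd z) (fst z)) \<partial>(?\<nu> \<Otimes>\<^sub>M ?\<mu>))"
      unfolding indep_elements_joint_law[OF M ind, symmetric]
      using Xm Em f by (subst nn_integral_distr) auto
    also have "\<dots> = (\<integral>\<^sup>+x. \<integral>\<^sup>+e. indicator C (norm_ratio p n x) * indicator D (proj_ratio n e x) \<partial>?\<mu> \<partial>?\<nu>)"
    proof (subst \<mu>.nn_integral_fst[symmetric])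
      have "sets (?\<nu> \<Otimes>\<^sub>M ?\<mu>) = sets (borel \<Otimes>\<^sub>M ?G)" by (intro sets_pair_measure_cong) auto
      then show "(\<lambda>z. indicator C (norm_ratio p n (fst z)) * indicator D (proj_ratio n (snd z) (fst z)) :: ennreal) \<in> borel_measurable (?\<nu> \<Otimes>\<^sub>M ?\<mu>)"
        using f by (simp cong: measurable_cong_sets)
    qed simp
    also have "\<dots> = (\<integral>\<^sup>+x. indicator C (norm_ratio p n x) * emeasure ?R D \<partial>?\<nu>)"
    proof (rule nn_integral_cong_AE)
      show "AE x in ?\<nu>. (\<integral>\<^sup>+e. indicator C (norm_ratio p n x) * indicator D (proj_ratio n e x) \<partial>?\<mu>) = indicator C (norm_ratio p n x) * emeasure ?R D"
        using nz
      proof eventually_elim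
        case (elim x)
        have pm: "(\<lambda>e. proj_ratio n e x) \<in> borel_measurable ?\<mu>" by (rule measurable_proj_ratio(2)[OF idE]) auto
        have S: "{e \<in> space ?\<mu>. proj_ratio n e x \<in> D} \<in> sets ?\<mu>" using pm D by measurable
        have "(\<integral>\<^sup>+e. indicator C (norm_ratio p n x) * indicator D (proj_ratio n e x) \<partial>?\<mu>)
          = (\<integral>\<^sup>+e. indicator C (norm_ratio p n x) * indicator {e \<in> space ?\<mu>. proj_ratio n e x \<in> D} e \<partial>?\<mu>)"
          by (intro nn_integral_cong) (auto split: split_indicator)
        also have "\<dots> = indicator C (norm_ratio p n x) * emeasure ?\<mu> {e \<in> space ?\<mu>. proj_ratio n e x \<in> D}"
          using S by (rule nn_integral_cmult_indicator)
        also have "emeasure ?\<mu> {e \<in> space ?\<mu>. proj_ratio n e x \<in> D} = emeasure (gauss_vec n 2) {g \<in> space (gauss_vec n 2). coord_ratio k n g \<in> D}"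
          by (rule haar_proj_ratio_law[OF E n kn D elim])
        also have "\<dots> = emeasure ?R D"
          using cm by (subst emeasure_distr) (auto intro!: arg_cong[where f = "emeasure _"])
        finally show ?case .
      qed
    qed
    also have "\<dots> = (\<integral>\<^sup>+x. indicator {x. norm_ratio p n x \<in> C} x \<partial>?\<nu>) * emeasure ?R D"
    proof -
      have "(\<lambda>x. indicator C (norm_ratio p n x) :: ennreal) \<in> borel_measurable ?\<nu>"
        using measurable_compose[OF measurable_norm_ratio_borel[of p n], of "indicator C :: real \<Rightarrow> ennreal" borel] by simp
      then have "(\<integral>\<^sup>+x. indicator C (norm_ratio p n x) * emeasure ?R D \<partial>?\<nu>) = (\<integral>\<^sup>+x. indicator C (norm_ratio p n x) \<partial>?\<nu>) * emeasure ?R D"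
        by (rule nn_integral_multc)
      also have "(\<integral>\<^sup>+x. indicator C (norm_ratio p n x) \<partial>?\<nu>) = (\<integral>\<^sup>+x. indicator {x. norm_ratio p n x \<in> C} x \<partial>?\<nu>)"
        by (intro nn_integral_cong) (auto split: split_indicator)
      finally show ?thesis .
    qed
    also have "(\<integral>\<^sup>+x. indicator {x. norm_ratio p n x \<in> C} x \<partial>?\<nu>) = emeasure ?\<nu> {x. norm_ratio p n x \<in> C}"
    proof -
      have "{x \<in> space borel. norm_ratio p n x \<in> C} \<in> sets borel" by measurable
      then show ?thesis by (intro nn_integral_indicator) simp
    qed
    also have "\<dots> = emeasure (gauss_vec n p) {y \<in> space (gauss_vec n p). norm_ratio p n y \<in> C}"
      unfolding X by (rule uniform_lp_ball(1)[OF p n C])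
    also have "\<dots> = emeasure ?H C"
      using hm by (subst emeasure_distr) (auto intro!: arg_cong[where f = "emeasure _"])
    finally show "emeasure ?H C * emeasure ?R D
      = emeasure (distr M (borel \<Otimes>\<^sub>M borel) (\<lambda>\<omega>. (norm_ratio p n (X \<omega>), proj_ratio n (E \<omega>) (X \<omega>)))) (C \<times> D)" ..
  qed (auto intro: H.sigma_finite_measure_axioms R.sigma_finite_measure_axioms)
  also have "?H \<Otimes>\<^sub>M ?R = distr (gauss_vec n p \<Otimes>\<^sub>M gauss_vec n 2) (borel \<Otimes>\<^sub>M borel) (\<lambda>(x, y). (norm_ratio p n x, coord_ratio k n y))"
    by (rule pair_measure_distr[OF hm cm R.sigma_finite_measure_axioms])
  finally show ?thesis unfolding gauss_pair_def by (simp add: case_prod_beta')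
qed

section \<open>The moderate deviations principle\<close>

lemma gaussian_bounds_same_law:
  assumes g: "gaussian_bounds N Z' s v"
    and m: "\<And>n. n \<ge> 1 \<Longrightarrow> Z n \<in> borel_measurable (M n)" "\<And>n. n \<ge> 1 \<Longrightarrow> Z' n \<in> borel_measurable (N n)"
    and law: "\<And>n. n \<ge> 1 \<Longrightarrow> distr (M n) borel (Z n) = distr (N n) borel (Z' n)"
  shows "gaussian_bounds M Z s v"
proof -
  have eq: "\<P>(\<omega> in M n. Z n \<omega> \<in> S) = \<P>(\<omega> in N n. Z' n \<omega> \<in> S)"
    if n: "n \<ge> 1" and S: "S \<in> sets borel" for n S
  proof -
    have "\<P>(\<omega> in M n. Z n \<omega> \<in> S) = measure (distr (M n) borel (Z n)) S"
      using m(1)[OF n] S by (subst measure_distr) (auto intro!: arg_cong[where f = "measure _"])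
    also have "\<dots> = \<P>(\<omega> in N n. Z' n \<omega> \<in> S)"
      unfolding law[OF n] using m(2)[OF n] S by (subst measure_distr) (auto intro!: arg_cong[where f = "measure _"])
    finally show ?thesis .
  qed
  have S1: "{z::real. x \<le> \<bar>z\<bar>} \<in> sets borel" "{z::real. \<bar>z - y\<bar> < \<epsilon>} \<in> sets borel" for x y \<epsilon>
    by measurable
  show ?thesis
    unfolding gaussian_bounds_def
  proof (intro conjI allI impI)
    fix x \<beta> :: real assume "0 < x \<and> 2 * v * \<beta> < x\<^sup>2"
    then have "\<forall>\<^sub>F n in sequentially. \<P>(\<omega> in N n. x \<le> \<bar>Z' n \<omega>\<bar>) \<le> exp (- \<beta> * s n)"
      using gaussian_boundsD(1)[OF g] by blast
    then show "\<forall>\<^sub>F n in sequentially. \<P>(\<omega> in M n. x \<le> \<bar>Z n \<omega>\<bar>) \<le> exp (- \<beta> * s n)"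
      using eventually_ge_at_top[of 1]
      by eventually_elim (use eq[OF _ S1(1), of _ x] in simp)
  next
    fix y \<epsilon> \<beta> :: real assume "0 < \<epsilon> \<and> 0 < \<beta> \<and> (y = 0 \<or> y\<^sup>2 < 2 * v * \<beta>)"
    then have "\<forall>\<^sub>F n in sequentially. exp (- \<beta> * s n) \<le> \<P>(\<omega> in N n. \<bar>Z' n \<omega> - y\<bar> < \<epsilon>)"
      using gaussian_boundsD(2)[OF g] by blast
    then show "\<forall>\<^sub>F n in sequentially. exp (- \<beta> * s n) \<le> \<P>(\<omega> in M n. \<bar>Z n \<omega> - y\<bar> < \<epsilon>)"
      using eventually_ge_at_top[of 1]
      by eventually_elim (use eq[OF _ S1(2), of _ y \<epsilon>] in simp)
  qed
qed

lemma proj_norm_fluctuation_factor: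
  assumes p: "p > 0"
  shows "real n powr (1 / p) * sqrt (Gamma (1 / p) / (p powr (2 / p) * Gamma (3 / p))) = real n powr (1 / p) / sqrt (gen_gauss_var p)"
  by (simp add: gen_gauss_var_def real_sqrt_divide)

lemma proj_norm_factorization:
  assumes p: "p > 0" and x: "lp_norm 2 n x \<noteq> 0"
  shows "lp_norm 2 n (orth_proj n E x) = lp_norm p n x * (norm_ratio p n x * proj_ratio n E x)"
proof -
  have "lp_norm p n x \<noteq> 0" using x p by (simp add: lp_norm_eq_0)
  then show ?thesis using x by (simp add: norm_ratio_def proj_ratio_def)
qed

text \<open>The variable \<open>W\<close> with the factor \<open>\<parallel>X\<parallel>\<^sub>p\<close> replaced by 1 has the law treated above. The factor
  lies below \<open>1 - \<epsilon> x / 2\<close>, where \<open>x = t / sqrt k\<close>, with probability at most \<open>exp (- n \<cdot> \<epsilon> x / 2)\<close>, and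
  \<open>n \<cdot> x \<ge> t \<cdot> sqrt k\<close> grows faster than \<open>t\<^sup>2\<close>.\<close>

theorem (in mdp_scaling) projection_gaussian_bounds:
  fixes M :: "nat \<Rightarrow> 'a measure" and X :: "nat \<Rightarrow> 'a \<Rightarrow> (nat \<Rightarrow> real)" and E :: "nat \<Rightarrow> 'a \<Rightarrow> (nat \<Rightarrow> real) set"
  assumes M: "\<And>n. n \<ge> 1 \<Longrightarrow> prob_space (M n)"
    and X: "\<And>n. n \<ge> 1 \<Longrightarrow> distr (M n) borel (X n) = uniform_measure (lborel_n n) (lp_ball p n)"
    and E: "\<And>n. n \<ge> 1 \<Longrightarrow> is_grassmannian_haar n (k n) (distr (M n) (grassmannian_borel n (k n)) (E n))"
    and ind: "\<And>n. n \<ge> 1 \<Longrightarrow> indep_elements (M n) borel (X n) (grassmannian_borel n (k n)) (E n)"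
  defines "Y \<equiv> \<lambda>n \<omega>. proj_norm_fluctuation p n (k n) (E n \<omega>) (X n \<omega>) / t n"
  shows "\<And>n. n \<ge> 1 \<Longrightarrow> Y n \<in> borel_measurable (M n)"
    and "gaussian_bounds M Y (\<lambda>n. (t n)\<^sup>2) (limit_var (1/2) (- 1/p) (1/2) (- 1/2))"
proof -
  have pp: "p > 0" using p by simp
  have Xm: "X n \<in> measurable (M n) borel" and Em: "E n \<in> measurable (M n) (grassmannian_borel n (k n))" if "n \<ge> 1" for n
    using ind[OF that] by (auto simp: indep_elements_def)
  have Xcoord: "(\<lambda>\<omega>. X n \<omega> j) \<in> borel_measurable (M n)" if "n \<ge> 1" for n j
    using measurable_compose[OF Xm[OF that] measurable_coordinate_borel] .
  have qm: "(\<lambda>\<omega>. lp_norm q n (X n \<omega>)) \<in> borel_measurable (M n)" if "n \<ge> 1" for n q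
    using measurable_compose[OF Xm[OF that] measurable_lp_norm_borel] .
  have Hm: "(\<lambda>\<omega>. norm_ratio p n (X n \<omega>)) \<in> borel_measurable (M n)" if "n \<ge> 1" for n
    using measurable_compose[OF Xm[OF that] measurable_norm_ratio_borel] .
  have Rm: "(\<lambda>\<omega>. proj_ratio n (E n \<omega>) (X n \<omega>)) \<in> borel_measurable (M n)" if "n \<ge> 1" for n
    by (rule measurable_proj_ratio(2)[OF Em[OF that] Xcoord[OF that]])
  show Ym: "Y n \<in> borel_measurable (M n)" if n: "n \<ge> 1" for n
    unfolding Y_def proj_norm_fluctuation_def
    by (intro borel_measurable_divide borel_measurable_diff borel_measurable_times borel_measurable_const
        measurable_proj_ratio(1)[OF Em[OF n] Xcoord[OF n]])
  define c where "c = (\<lambda>n. real n powr (1 / p) / sqrt (gen_gauss_var p))"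
  define T where "T = (\<lambda>n \<omega>. c n * norm_ratio p n (X n \<omega>) * proj_ratio n (E n \<omega>) (X n \<omega>))"
  define W where "W = (\<lambda>n \<omega>. (T n \<omega> - sqrt (real (k n))) / t n)"
  have Wm: "W n \<in> borel_measurable (M n)" if n: "n \<ge> 1" for n
    unfolding W_def T_def by (intro borel_measurable_divide borel_measurable_diff borel_measurable_times borel_measurable_const Hm Rm n)
  have gW: "gaussian_bounds M W (\<lambda>n. (t n)\<^sup>2) (limit_var (1/2) (- 1/p) (1/2) (- 1/2))"
  proof (rule gaussian_bounds_same_law[OF radial_stat_gaussian_bounds Wm])
    fix n :: nat assume n: "n \<ge> 1"
    have kn: "k n \<le> n" using k_bounds[OF n] by simp
    show "(\<lambda>\<omega>. (radial_stat n \<omega> - sqrt (real (k n))) / t n) \<in> borel_measurable (gauss_pair n p)"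
      using n by measurable
    define \<phi> where "\<phi> = (\<lambda>z::real \<times> real. (c n * fst z * snd z - sqrt (real (k n))) / t n)"
    have \<phi>: "\<phi> \<in> borel_measurable (borel \<Otimes>\<^sub>M borel)" unfolding \<phi>_def by measurable
    let ?h = "\<lambda>\<omega>. (norm_ratio p n (X n \<omega>), proj_ratio n (E n \<omega>) (X n \<omega>))"
    let ?h' = "\<lambda>\<omega>. (norm_ratio p n (fst \<omega>), coord_ratio (k n) n (snd \<omega>))"
    have h: "?h \<in> measurable (M n) (borel \<Otimes>\<^sub>M borel)" using Hm[OF n] Rm[OF n] by measurable
    have h': "?h' \<in> measurable (gauss_pair n p) (borel \<Otimes>\<^sub>M borel)"
    proof -
      have "norm_ratio p n \<in> borel_measurable (gauss_vec n p)" "coord_ratio (k n) n \<in> borel_measurable (gauss_vec n 2)"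
        unfolding norm_ratio_def[abs_def] coord_ratio_def[abs_def] using kn
        by (auto intro!: borel_measurable_divide measurable_lp_norm_compose measurable_gauss_vec_component)
      from measurable_compose[OF measurable_fst this(1)] measurable_compose[OF measurable_snd this(2)]
      show ?thesis unfolding gauss_pair_def by (intro measurable_Pair) auto
    qed
    have "distr (M n) borel (W n) = distr (distr (M n) (borel \<Otimes>\<^sub>M borel) ?h) borel \<phi>"
      unfolding distr_distr[OF \<phi> h] by (simp add: comp_def \<phi>_def W_def[abs_def] T_def)
    also have "distr (M n) (borel \<Otimes>\<^sub>M borel) ?h = distr (gauss_pair n p) (borel \<Otimes>\<^sub>M borel) ?h'"
      by (rule ratio_pair_law[OF M[OF n] n kn pp X[OF n] E[OF n] ind[OF n]])
    also have "distr \<dots> borel \<phi> = distr (gauss_pair n p) borel (\<lambda>\<omega>. (radial_stat n \<omega> - sqrt (real (k n))) / t n)"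
      unfolding distr_distr[OF \<phi> h'] by (simp add: comp_def \<phi>_def radial_stat_def c_def norm_ratio_def coord_ratio_def mult_ac)
    finally show "distr (M n) borel (W n) = distr (gauss_pair n p) borel (\<lambda>\<omega>. (radial_stat n \<omega> - sqrt (real (k n))) / t n)" .
  qed
  have small_ball: "\<P>(\<omega> in M n. lp_norm p n (X n \<omega>) \<le> r) = r ^ n" if n: "n \<ge> 1" and r: "0 < r" "r \<le> 1" for n r
  proof -
    interpret prob_space "M n" by (rule M[OF n])
    have S: "{x. lp_norm p n x \<le> r} \<in> sets borel" using measurable_lp_norm_borel[of p n] by simp
    have "emeasure (M n) {\<omega> \<in> space (M n). lp_norm p n (X n \<omega>) \<le> r} = emeasure (distr (M n) borel (X n)) {x. lp_norm p n x \<le> r}"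
      using Xm[OF n] S by (subst emeasure_distr) (auto intro!: arg_cong[where f = "emeasure _"])
    also have "\<dots> = ennreal (r ^ n)" unfolding X[OF n] by (rule uniform_lp_ball(2)[OF pp n r])
    finally show ?thesis using r by (simp add: emeasure_eq_measure)
  qed
  show "gaussian_bounds M Y (\<lambda>n. (t n)\<^sup>2) (limit_var (1/2) (- 1/p) (1/2) (- 1/2))"
  proof (rule gaussian_bounds_transfer[OF speed_top M Wm Ym gW])
    fix \<epsilon> :: real assume \<epsilon>: "\<epsilon> > 0"
    define x where "x = (\<lambda>n. t n / sqrt (real (k n)))"
    have x0: "x \<longlonglongrightarrow> 0" using t_small by (simp add: x_def)
    have x_pos: "x n > 0" if "n \<ge> 1" for n using t_pos[OF that] k_bounds[OF that] by (auto simp: x_def)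
    have inv_top: "filterlim (\<lambda>n. 1 / x n) at_top sequentially"
    proof -
      have "\<forall>\<^sub>F n in sequentially. 0 < x n" using eventually_ge_at_top[of 1] by eventually_elim (rule x_pos)
      from filterlim_inverse_at_top[OF x0 this] show ?thesis by (simp add: inverse_eq_divide)
    qed
    define r where "r = (\<lambda>n. 1 - \<epsilon> * x n / 2)"
    have r_bounds: "\<forall>\<^sub>F n in sequentially. 0 < r n"
    proof -
      have "\<forall>\<^sub>F n in sequentially. x n < 2 / \<epsilon>" using x0 \<epsilon> by (intro order_tendstoD(2)) auto
      then show ?thesis by eventually_elim (use \<epsilon> in \<open>simp add: r_def field_simps\<close>)
    qed
    \<comment> \<open>outside \<open>A\<close> the scaled norm \<open>T\<close> is below \<open>2 sqrt k\<close>; outside \<open>B\<close> and \<open>C\<close> the factor differs from 1 by less than \<open>\<epsilon> x / 2\<close>\<close>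
    let ?A = "\<lambda>n \<omega>. 1 / x n \<le> \<bar>W n \<omega>\<bar>" and ?B = "\<lambda>n \<omega>. lp_norm p n (X n \<omega>) \<le> r n" and ?C = "\<lambda>n \<omega>. \<not> lp_norm p n (X n \<omega>) \<le> 1"
    have A: "superexp M ?A (\<lambda>n. (t n)\<^sup>2)"
      by (rule gaussian_bounds_superexp[OF gW inv_top M Wm])
    have B: "superexp M ?B (\<lambda>n. (t n)\<^sup>2)"
      unfolding superexp_def
    proof
      fix \<beta> :: real
      have "(\<lambda>n. \<beta> * x n) \<longlonglongrightarrow> 0" using tendsto_mult_right_zero[OF x0] .
      then have "\<forall>\<^sub>F n in sequentially. \<beta> * x n < \<epsilon> / 2" using \<epsilon> by (intro order_tendstoD(2)) auto
      then show "\<forall>\<^sub>F n in sequentially. \<P>(\<omega> in M n. ?B n \<omega>) \<le> exp (- \<beta> * (t n)\<^sup>2)"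
        using r_bounds eventually_ge_at_top[of 1]
      proof eventually_elim
        case (elim n)
        have kn: "real (k n) \<le> real n" "1 \<le> k n" using k_bounds[OF elim(3)] by auto
        have t_eq: "(t n)\<^sup>2 = (x n)\<^sup>2 * real (k n)" using kn by (simp add: x_def power_divide)
        have "\<P>(\<omega> in M n. ?B n \<omega>) = r n ^ n"
          using elim(2) x_pos[OF elim(3)] \<epsilon> by (intro small_ball[OF elim(3)]) (auto simp: r_def)
        also have "\<dots> \<le> exp (- (\<epsilon> * x n / 2)) ^ n"
          using elim(2) exp_ge_add_one_self[of "- (\<epsilon> * x n / 2)"] by (intro power_mono) (auto simp: r_def)
        also have "\<dots> = exp (- (\<epsilon> / 2 * x n * real n))" by (simp add: exp_of_nat_mult[symmetric] mult_ac)
        also have "\<dots> \<le> exp (- \<beta> * (t n)\<^sup>2)"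
        proof -
          have "\<beta> * x n * (x n * real (k n)) \<le> \<epsilon> / 2 * (x n * real (k n))"
            using elim(1) x_pos[OF elim(3)] by (intro mult_right_mono) auto
          also have "\<dots> \<le> \<epsilon> / 2 * (x n * real n)"
            using kn x_pos[OF elim(3)] \<epsilon> by (intro mult_left_mono) auto
          finally show ?thesis unfolding t_eq by (simp add: power2_eq_square mult_ac)
        qed
        finally show ?case .
      qed
    qed
    have C: "superexp M ?C (\<lambda>n. (t n)\<^sup>2)"
      unfolding superexp_def
    proof
      fix \<beta> :: real
      show "\<forall>\<^sub>F n in sequentially. \<P>(\<omega> in M n. ?C n \<omega>) \<le> exp (- \<beta> * (t n)\<^sup>2)"
        using eventually_ge_at_top[of 1]
      proof eventually_elim
        case (elim n)
        interpret prob_space "M n" by (rule M[OF elim])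
        have "{\<omega> \<in> space (M n). lp_norm p n (X n \<omega>) \<le> 1} \<in> events" using qm[OF elim, of p] by measurable
        then have "\<P>(\<omega> in M n. ?C n \<omega>) = 1 - \<P>(\<omega> in M n. lp_norm p n (X n \<omega>) \<le> 1)"
          by (rule prob_neg)
        then show ?case using small_ball[OF elim, of 1] by simp
      qed
    qed
    have meas: "{\<omega> \<in> space (M n). ?A n \<omega>} \<in> sets (M n)" "{\<omega> \<in> space (M n). ?B n \<omega>} \<in> sets (M n)" "{\<omega> \<in> space (M n). ?C n \<omega>} \<in> sets (M n)"
      if n: "n \<ge> 1" for n
      using Wm[OF n] qm[OF n, of p] by measurable
    show "superexp M (\<lambda>n \<omega>. \<epsilon> \<le> \<bar>Y n \<omega> - W n \<omega>\<bar>) (\<lambda>n. (t n)\<^sup>2)"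
    proof (rule superexp_mono[where Q = "\<lambda>n \<omega>. ?A n \<omega> \<or> (?B n \<omega> \<or> ?C n \<omega>)"])
      show "superexp M (\<lambda>n \<omega>. ?A n \<omega> \<or> (?B n \<omega> \<or> ?C n \<omega>)) (\<lambda>n. (t n)\<^sup>2)"
        by (intro superexp_disj[OF speed_top] A B C meas sets.sets_Collect_disj)
      show "{\<omega> \<in> space (M n). ?A n \<omega> \<or> (?B n \<omega> \<or> ?C n \<omega>)} \<in> sets (M n)" if "n \<ge> 1" for n
        using that by (intro meas sets.sets_Collect_disj)
      show "\<forall>\<^sub>F n in sequentially. \<forall>\<omega>\<in>space (M n). \<epsilon> \<le> \<bar>Y n \<omega> - W n \<omega>\<bar> \<longrightarrow> ?A n \<omega> \<or> (?B n \<omega> \<or> ?C n \<omega>)"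
        using r_bounds eventually_ge_at_top[of 1]
      proof eventually_elim
        case (elim n)
        have tn: "t n > 0" by (rule t_pos[OF elim(2)])
        have kn: "sqrt (real (k n)) > 0" using k_bounds[OF elim(2)] by simp
        show ?case
        proof (intro ballI impI, rule ccontr)
          fix \<omega> assume e: "\<epsilon> \<le> \<bar>Y n \<omega> - W n \<omega>\<bar>" and "\<not> (?A n \<omega> \<or> (?B n \<omega> \<or> ?C n \<omega>))"
          then have w: "\<bar>W n \<omega>\<bar> < 1 / x n" and q: "r n < lp_norm p n (X n \<omega>)" "lp_norm p n (X n \<omega>) \<le> 1" by auto
          let ?q = "lp_norm p n (X n \<omega>)"
          have "lp_norm 2 n (X n \<omega>) \<noteq> 0" using q(1) elim(1) lp_norm_eq_0[of 2 n "X n \<omega>"] lp_norm_eq_0[OF pp, of n "X n \<omega>"] by auto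
          then have "Y n \<omega> = (?q * T n \<omega> - sqrt (real (k n))) / t n"
            unfolding Y_def proj_norm_fluctuation_def proj_norm_fluctuation_factor[OF pp]
            by (simp add: proj_norm_factorization[OF pp] T_def c_def mult_ac)
          then have diff: "Y n \<omega> - W n \<omega> = (?q - 1) * T n \<omega> / t n"
            by (simp add: W_def diff_divide_distrib[symmetric] algebra_simps)
          have T0: "T n \<omega> \<ge> 0"
            using gen_gauss_var_pos[OF pp] by (auto simp: T_def c_def norm_ratio_def proj_ratio_def lp_norm_nonneg)
          have "T n \<omega> - sqrt (real (k n)) < sqrt (real (k n))"
            using w tn unfolding W_def x_def by (simp add: abs_less_iff divide_less_cancel)
          then have T2: "T n \<omega> < 2 * sqrt (real (k n))" by simp
          have "\<bar>Y n \<omega> - W n \<omega>\<bar> = (1 - ?q) * T n \<omega> / t n"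
            unfolding diff using q(2) T0 tn by (simp add: abs_mult abs_divide)
          also have "\<dots> \<le> (1 - ?q) * (2 * sqrt (real (k n))) / t n"
            using q(2) T2 tn by (intro divide_right_mono mult_left_mono) auto
          also have "\<dots> < (\<epsilon> * x n / 2) * (2 * sqrt (real (k n))) / t n"
            using q(1) kn tn by (intro divide_strict_right_mono mult_strict_right_mono) (auto simp: r_def)
          also have "\<dots> = \<epsilon>" using kn tn by (simp add: x_def)
          finally show False using e by simp
        qed
      qed
    qed (rule M)
  qed
qed

theorem theorem3:
  fixes p \<Lambda> :: real
    and k :: "nat \<Rightarrow> nat"
    and t :: "nat \<Rightarrow> real"
    and M :: "nat \<Rightarrow> 'a measure"
    and X :: "nat \<Rightarrow> 'a \<Rightarrow> (nat \<Rightarrow> real)"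
    and E :: "nat \<Rightarrow> 'a \<Rightarrow> (nat \<Rightarrow> real) set"
  assumes "2 \<le> p"
    and "\<And>n. n \<ge> 1 \<Longrightarrow> 1 \<le> k n \<and> k n \<le> n"
    and "\<Lambda> \<in> {0..1}"
    and "(\<lambda>n. real (k n) / real n) \<longlonglongrightarrow> \<Lambda>"
    and "(\<lambda>n. real (k n)) \<in> \<omega>(\<lambda>_. 1)"
    and "\<And>n. n \<ge> 1 \<Longrightarrow> t n > 0"
    and "t \<in> \<omega>(\<lambda>_. 1)"
    and "t \<in> o(\<lambda>n. sqrt (real (k n)))"
    and "t \<in> o(\<lambda>n. sqrt (real n - real (k n))) \<or>
         (\<lambda>n. real n - real (k n)) \<in> o(\<lambda>n. sqrt (real (k n)) / t n)"
    and "\<And>n. n \<ge> 1 \<Longrightarrow> prob_space (M n)"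
    and "\<And>n. n \<ge> 1 \<Longrightarrow> distr (M n) borel (X n) = uniform_measure (lborel_n n) (lp_ball p n)"
    and "\<And>n. n \<ge> 1 \<Longrightarrow>
           is_grassmannian_haar n (k n) (distr (M n) (grassmannian_borel n (k n)) (E n))"
    and "\<And>n. n \<ge> 1 \<Longrightarrow>
           indep_elements (M n) borel (X n) (grassmannian_borel n (k n)) (E n)"
  shows "satisfies_LDP M
           (\<lambda>n \<omega>. proj_norm_fluctuation p n (k n) (E n \<omega>) (X n \<omega>) / t n)
           (\<lambda>n. (t n)\<^sup>2)
           (\<lambda>x::real. alpha_const p \<Lambda> * ereal (x\<^sup>2))"
proof -
  have t_pos_ev: "\<forall>\<^sub>F n in sequentially. 0 < t n"
    using eventually_ge_at_top[of 1] by eventually_elim (rule assms(6))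
  interpret mdp_scaling p \<Lambda> k t
  proof
    show "filterlim t at_top sequentially"
      using assms(7) t_pos_ev by (intro filterlim_at_infinity_imp_filterlim_at_top) (simp add: smallomega_1_conv_filterlim)
    show "(\<lambda>n. t n / sqrt (real (k n))) \<longlonglongrightarrow> 0" by (rule smalloD_tendsto[OF assms(8)])
  qed (use assms in auto)
  have speed_pos: "(t n)\<^sup>2 > 0" if "n \<ge> 1" for n using assms(6)[OF that] by simp
  note bounds = projection_gaussian_bounds[OF assms(10-13)]
  have "satisfies_LDP M (\<lambda>n \<omega>. proj_norm_fluctuation p n (k n) (E n \<omega>) (X n \<omega>) / t n) (\<lambda>n. (t n)\<^sup>2)
     (\<lambda>x. ereal 1 / ereal (2 * limit_var (1/2) (- 1/p) (1/2) (- 1/2)) * ereal (x\<^sup>2))"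
    by (rule gaussian_bounds_imp_LDP[OF speed_pos limit_var_nonneg assms(10) bounds])
  then show ?thesis unfolding alpha_const_eq .
qed

end
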